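(* Let $f,g\in\mathcal{K}_H^0$ and $0\le\alpha<1$. Then the harmonic convolution $f*g$ is univalent and fully convex of order $\alpha$ in at least $|z|<s_0$, where $s_0=s_0(\alpha)$ is the real root of the equation $$2(1-\alpha)(1-r)^5+\alpha(1+r)(1-r)^2-(1+r)(r^2+4r+1)=0$$ in the interval $(0,1)$. In particular, $f*g$ is univalent and fully convex in $|z|<s_0(0)\approx0.0712543$.
   Context: Let $\mathbb{D}=\{z\in\mathbb{C}:|z|<1\}$. $\mathcal{S}_H$ is the class of univalent sense-preserving complex-valued harmonic functions $f=h+\overline{g}$ in $\mathbb{D}$, where $h(z)=z+\sum_{n\ge2}a_nz^n$ and $g(z)=\sum_{n\ge1}b_nz^n$ are analytic in $\mathbb{D}$ and $|g'(z)|<|h'(z)|$ in $\mathbb{D}$. $\mathcal{K}_H^0$ is the class of all $f\in\mathcal{S}_H$ such that $f(\mathbb{D})$ is convex and $f_{\bar z}(0)=0$ (i.e. $b_1=0$). For $f=z+\sum_{n\ge2}a_nz^n+\overline{\sum_{n\ge1}b_nz^n}$ and $F=z+\sum_{n\ge2}A_nz^n+\overline{\sum_{n\ge1}B_nz^n}$, the harmonic convolution is $f*F=z+\sum_{n\ge2}a_nA_nz^n+\overline{\sum_{n\ge1}b_nB_nz^n}$. A complex-valued harmonic function $f$ is said to be fully convex of order $\alpha$ ($0\le\alpha<1$) in a disk $|z|<\rho$ if, for every $0<r<\rho$, $f$ maps the circle $|z|=r$ in a one-to-one manner onto a convex curve satisfying $\frac{\partial}{\partial\theta}\left(\arg\left\{\frac{\partial}{\partial\theta}f(re^{i\theta})\right\}\right)>\alpha$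 for $0\le\theta\le2\pi$. Fully convex means fully convex of order $0$. *)

theory Defs
  imports "HOL-Complex_Analysis.Complex_Analysis"
begin

(* Harmonic functions on the disk of radius \<rho> about 0 are given by their canonical
   decomposition f = h + cnj g into analytic h and g; g 0 = 0 makes it unique. *)
definition harmonic_parts ::
    "real \<Rightarrow> (complex \<Rightarrow> complex) \<Rightarrow> (complex \<Rightarrow> complex) \<Rightarrow> (complex \<Rightarrow> complex) \<Rightarrow> bool" where
  "harmonic_parts \<rho> f h g \<longleftrightarrow>
     h holomorphic_on ball 0 \<rho> \<and> g holomorphic_on ball 0 \<rho> \<and> g 0 = 0 \<and>
     (\<forall>z\<in>ball 0 \<rho>. f z = h z + cnj (g z))"

definition harmonic_in_disk :: "real \<Rightarrow> (complex \<Rightarrow> complex) \<Rightarrow> bool" where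
  "harmonic_in_disk \<rho> f \<longleftrightarrow> (\<exists>h g. harmonic_parts \<rho> f h g)"

definition class_SH :: "(complex \<Rightarrow> complex) set" where
  "class_SH = {f. inj_on f (ball 0 1) \<and>
     (\<exists>h g. harmonic_parts 1 f h g \<and> h 0 = 0 \<and> deriv h 0 = 1 \<and>
            (\<forall>z\<in>ball 0 1. norm (deriv g z) < norm (deriv h z)))}"

definition wirtinger_bar :: "(complex \<Rightarrow> complex) \<Rightarrow> complex \<Rightarrow> complex" where
  "wirtinger_bar f z =
     (frechet_derivative f (at z) 1 + \<i> * frechet_derivative f (at z) \<i>) / 2"

definition class_KH0 :: "(complex \<Rightarrow> complex) set" where
  "class_KH0 = {f \<in> class_SH. convex (f ` ball 0 1) \<and> wirtinger_bar f 0 = 0}"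

(* Taylor coefficients a_n of h and b_n of g for f = h + cnj g harmonic in the unit disk. *)
definition analytic_coeff :: "(complex \<Rightarrow> complex) \<Rightarrow> nat \<Rightarrow> complex" where
  "analytic_coeff f n =
     (deriv ^^ n) (SOME h. \<exists>g. harmonic_parts 1 f h g) 0 / fact n"

definition coanalytic_coeff :: "(complex \<Rightarrow> complex) \<Rightarrow> nat \<Rightarrow> complex" where
  "coanalytic_coeff f n =
     (deriv ^^ n) (SOME g. \<exists>h. harmonic_parts 1 f h g) 0 / fact n"

(* For f, F in class_SH the n = 0 terms vanish and the n = 1 term of the first series is z.
   The value is meaningful only for norm z < 1. *)
definition harmonic_convolution ::
    "(complex \<Rightarrow> complex) \<Rightarrow> (complex \<Rightarrow> complex) \<Rightarrow> complex \<Rightarrow> complex" where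
  "harmonic_convolution f F z =
     (\<Sum>n. analytic_coeff f n * analytic_coeff F n * z ^ n) +
     cnj (\<Sum>n. coanalytic_coeff f n * coanalytic_coeff F n * z ^ n)"

(* A closed convex curve: the boundary of a bounded planar convex domain. *)
definition convex_curve :: "complex set \<Rightarrow> bool" where
  "convex_curve \<Gamma> \<longleftrightarrow>
     (\<exists>C. open C \<and> C \<noteq> {} \<and> bounded C \<and> convex C \<and> \<Gamma> = frontier C)"

(* The function \<phi> is a branch of the argument of the (nonvanishing) tangent vector along the
   circle of radius r, so its derivative does not depend on the choice of the branch. *)
definition fully_convex_of_order :: "real \<Rightarrow> real \<Rightarrow> (complex \<Rightarrow> complex) \<Rightarrow> bool" where
  "fully_convex_of_order \<alpha> \<rho> f \<longleftrightarrow>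
     harmonic_in_disk \<rho> f \<and>
     (\<forall>r. 0 < r \<and> r < \<rho> \<longrightarrow>
        inj_on f (sphere 0 r) \<and>
        convex_curve (f ` sphere 0 r) \<and>
        (let T = (\<lambda>\<theta>. vector_derivative (\<lambda>t. f (of_real r * cis t)) (at \<theta>)) in
         \<exists>\<phi>. \<forall>\<theta>. T \<theta> \<noteq> 0 \<and> T \<theta> = of_real (norm (T \<theta>)) * cis (\<phi> \<theta>) \<and>
                 (\<exists>d>\<alpha>. (\<phi> has_real_derivative d) (at \<theta>))))"

abbreviation fully_convex :: "real \<Rightarrow> (complex \<Rightarrow> complex) \<Rightarrow> bool" where
  "fully_convex \<equiv> fully_convex_of_order 0"

definition s0_equation :: "real \<Rightarrow> real \<Rightarrow> bool" where
  "s0_equation \<alpha> r \<longleftrightarrow>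
     2 * (1 - \<alpha>) * (1 - r) ^ 5 + \<alpha> * (1 + r) * (1 - r)\<^sup>2 - (1 + r) * (r\<^sup>2 + 4 * r + 1) = 0"

definition s0 :: "real \<Rightarrow> real" where
  "s0 \<alpha> = (THE r. r \<in> {0<..<1} \<and> s0_equation \<alpha> r)"

lemma harmonic_parts_unique:
  assumes "harmonic_parts \<rho> f h g" "harmonic_parts \<rho> f h' g'" "z \<in> ball 0 \<rho>"
  shows "h z = h' z" "g z = g' z"
proof -
  define k where "k = (\<lambda>z. h z - h' z)"
  define l where "l = (\<lambda>z. g' z - g z)"
  have kh: "k holomorphic_on ball 0 \<rho>" and lh: "l holomorphic_on ball 0 \<rho>"
    using assms unfolding k_def l_def harmonic_parts_def by (auto intro!: holomorphic_intros)
  have eq: "k w = cnj (l w)" if "w \<in> ball 0 \<rho>" for w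
  proof -
    have "h w + cnj (g w) = h' w + cnj (g' w)"
      using assms that unfolding harmonic_parts_def by metis
    then show ?thesis
      by (simp add: k_def l_def algebra_simps)
  qed
  have l0: "(l has_field_derivative 0) (at w)" if w: "w \<in> ball 0 \<rho>" for w
  proof -
    have dk: "(k has_field_derivative deriv k w) (at w)"
      and dl: "(l has_field_derivative deriv l w) (at w)"
      using kh lh w by (auto intro: holomorphic_derivI)
    have "((\<lambda>x. cnj (l x)) has_derivative (\<lambda>x. cnj (deriv l w * x))) (at w)"
      using dl unfolding has_field_derivative_def
      by (rule bounded_linear.has_derivative[OF bounded_linear_cnj])
    then have "(k has_derivative (\<lambda>x. cnj (deriv l w * x))) (at w)"
      by (rule has_derivative_transform_within_open[OF _ open_ball w]) (simp add: eq)
    with dk have "(*) (deriv k w) = (\<lambda>x. cnj (deriv l w * x))"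
      unfolding has_field_derivative_def by (rule has_derivative_unique)
    from fun_cong[OF this, of 1] fun_cong[OF this, of \<i>] have "deriv l w = 0"
      by (simp add: complex_eq_iff)
    with dl show ?thesis by simp
  qed
  have "0 < \<rho>"
    using assms(3) by (auto intro: le_less_trans[OF norm_ge_zero])
  then have 0: "0 \<in> ball 0 \<rho>" by simp
  have "\<exists>c. \<forall>w\<in>ball 0 \<rho>. l w = c"
    using has_field_derivative_zero_constant[of "ball 0 \<rho>" l] l0
    by (simp add: has_field_derivative_at_within)
  then have "l z = l 0"
    using 0 assms(3) by auto
  also have "l 0 = 0"
    using assms by (simp add: l_def harmonic_parts_def)
  finally have "l z = 0" .
  then show "g z = g' z" "h z = h' z"
    using eq[OF assms(3)] by (simp_all add: k_def l_def)
qed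

end

theory Submission
  imports Defs
begin

text \<open>
  By Clunie and Sheil-Small, \<open>f = h + cnj g\<close> in the class \<open>class_KH0\<close> has \<open>|a_n| \<le> (n+1)/2\<close> and
  \<open>|b_n| \<le> (n-1)/2\<close>. Granted this, the coefficients of the convolution are bounded by the squares of these
  numbers, and \<open>s0 \<alpha>\<close> is the radius up to which
  \<open>\<Sum>n\<ge>2. n(n-\<alpha>)((n+1)/2)\<^sup>2 r^(n-1) + n(n+\<alpha>)((n-1)/2)\<^sup>2 r^(n-1)\<close> stays below \<open>1 - \<alpha>\<close>, the
  coefficient condition for full convexity of order \<open>\<alpha>\<close>.

  The coefficient bounds rest on a unimodular \<open>u\<close> with \<open>|cnj u * a_n + u * b_n| \<le> 1\<close> for all \<open>n\<close>. If \<open>f\<close> has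
  boundary values on the circle, these run through a convex curve, and by continuity there is a direction for
  which the two parallel support lines touch the curve at the images of antipodal points of the circle. In that direction
  the boundary tangent changes sign as \<open>cos (t - \<beta>)\<close> does, and comparing the Fourier coefficients of the
  resulting positive measure gives the inequality. To avoid boundary regularity, the argument is applied to
  polygons of radial limits of \<open>f \<circ> \<phi>\<close> for Riemann maps \<open>\<phi>\<close> of an exhaustion: as \<open>\<phi>\<close> has finite
  Dirichlet integral, most radii have images of finite length.
\<close>

text \<open>The polynomial in \<open>s0_equation\<close> comes from the identity
  n(n-\<alpha>)((n+1)/2)^2 + n(n+\<alpha>)((n-1)/2)^2 = (n^4 + (1-2\<alpha>)n^2)/2. The generating
  functions of n^2 and n^4 have denominators (1-r)^3 and (1-r)^5, and clearing them turns the
  coefficient condition into positivity of that polynomial. The obstacle is that a convex harmonic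
  map need not extend to the circle and may have unbounded image. Limits along finitely many
  equidistributed radii are enough, since discrete Fourier sums recover any fixed coefficient once
  there are many radii. Convexity of the polygon of limits is stated only as the absence of strictly
  separated interlaced diagonals: a non-strict condition, which tolerates repeated vertices and
  holds because the preimages of two interlaced chords must meet in the disc. The direction found
  varies with the approximation, but it ranges over the compact unit circle, so a limit direction
  exists. The Riemann maps are normalized so that their derivatives at 0 tend to 1; then they tend
  to the identity near 0, and the inequality reaches the coefficients of the given map.\<close>

no_notation fps_nth (infixl "$" 75)
hide_const (open) Polynomial.content

section \<open>Dirichlet integrals and radial lengths of univalent functions\<close>

text \<open>The area formula is applied on \<open>real^2\<close>, whereas iterated integration works
  on pairs. The coordinate isomorphism preserves the content of boxes, so the integral carries
  over.\<close>

lemma has_integral_pair_of_vec2: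
  fixes F :: "real^2 \<Rightarrow> 'b::banach"
  assumes "(F has_integral i) (cbox a b)"
  shows "((\<lambda>x. F (vector [fst x, snd x])) has_integral i) (cbox (a$1, a$2) (b$1, b$2))"
proof -
  define g :: "real \<times> real \<Rightarrow> real^2" where "g = (\<lambda>x. vector [fst x, snd x])"
  define h :: "real^2 \<Rightarrow> real \<times> real" where "h = (\<lambda>v. (v$1, v$2))"
  have hg: "h (g x) = x" for x by (simp add: g_def h_def)
  have gh: "g (h x) = x" for x by (simp add: g_def h_def vec_eq_iff forall_2)
  have gbox: "g ` cbox u v = cbox (g u) (g v)" for u v
  proof -
    have "x \<in> cbox u v \<longleftrightarrow> g x \<in> cbox (g u) (g v)" for x
      by (cases x; cases u; cases v) (auto simp: g_def interval_cart forall_2 cbox_Pair_eq)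
    then show ?thesis using gh by (metis (no_types, lifting) imageI image_eqI subsetI subset_antisym image_subset_iff)
  qed
  have hbox: "h ` cbox u v = cbox (h u) (h v)" for u v
  proof -
    have "h ` cbox u v = h ` (g ` cbox (h u) (h v))" by (simp add: gbox gh)
    also have "\<dots> = cbox (h u) (h v)" by (simp add: image_image hg)
    finally show ?thesis .
  qed
  have cont: "content (g ` cbox u v) = 1 * content (cbox u v)" for u v
  proof (cases "cbox u v = {}")
    case False
    then have le: "fst u \<le> fst v" "snd u \<le> snd v"
      by (cases u; cases v; auto simp: cbox_Pair_eq)+
    have "cbox (g u) (g v) \<noteq> {}" using False gbox by (metis image_is_empty)
    then have "content (cbox (g u) (g v)) = (fst v - fst u) * (snd v - snd u)"
      by (simp add: content_cbox_cart UNIV_2 g_def)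
    also have "\<dots> = content (cbox u v)"
      using le by (cases u; cases v) (simp add: content_Pair)
    finally show ?thesis by (simp add: gbox)
  qed auto
  have "linear g" unfolding g_def
    by (rule linearI) (auto simp: vec_eq_iff forall_2)
  then have "isCont g x" for x by (simp add: linear_continuous_at linear_conv_bounded_linear)
  then have "((\<lambda>x. F (g x)) has_integral (1/1) *\<^sub>R i) (h ` cbox a b)"
    by (intro has_integral_twiddle[OF _ hg gh _ _ _ cont assms]) (auto simp only: gbox hbox)
  then show ?thesis by (simp add: hbox) (simp add: g_def h_def)
qed

lemma cis_eq_imp_eq:
  assumes "cis s = cis t" "\<bar>s - t\<bar> < 2 * pi"
  shows "s = t"
proof -
  have "cos (s - t) = 1"
    using arg_cong[OF assms(1), of "\<lambda>z. Re (z * cnj (cis t))"] by (simp add: cis_cnj cis_mult)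
  then obtain n :: int where n: "s - t = of_int n * 2 * pi" by (auto simp: cos_one_2pi_int)
  then have "\<bar>of_int n :: real\<bar> * (2 * pi) < 1 * (2*pi)" using assms(2) by (simp add: abs_mult)
  then have "\<bar>of_int n :: real\<bar> < 1" by (subst (asm) mult_less_cancel_right) auto
  then have "n = 0" by linarith
  with n show ?thesis by simp
qed

text \<open>In polar coordinates the integrand is the Jacobian of \<phi>, so injectivity makes the
  integral the area of the image of a slit annulus. The value 4 is the area of the square around the
  unit disc; what matters later is that it does not depend on \<rho>.\<close>

lemma energy_bound:
  assumes hol: "\<phi> holomorphic_on ball 0 1" and inj: "inj_on \<phi> (ball 0 1)"
    and im: "\<phi> ` ball 0 1 \<subseteq> ball 0 1" and r: "0 < r0" "r0 \<le> \<rho>" "\<rho> < 1"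
  shows "integral (cbox (0, r0) (2*pi, \<rho>))
           (\<lambda>x. (cmod (deriv \<phi> (of_real (snd x) * cis (fst x))))\<^sup>2 * snd x) \<le> 4"
proof -
  define P :: "real^2 \<Rightarrow> complex" where "P = (\<lambda>v. of_real (v$2) * cis (v$1))"
  define T :: "real^2 \<Rightarrow> real^2" where "T = (\<lambda>v. vector [Re (\<phi> (P v)), Im (\<phi> (P v))])"
  define T' :: "real^2 \<Rightarrow> real^2 \<Rightarrow> real^2" where
    "T' = (\<lambda>v w. let d = deriv \<phi> (P v) * (of_real (w$2) * cis (v$1) + of_real (v$2) * (of_real (w$1) * (\<i> * cis (v$1))))
                 in vector [Re d, Im d])"
  define a :: "real^2" where "a = vector [0, r0]"
  define b :: "real^2" where "b = vector [2*pi, \<rho>]"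
  \<comment> \<open>The open box leaves out the slit at angle 0, where polar coordinates are not
    injective.\<close>
  let ?S = "box a b"
  let ?F = "\<lambda>v. (cmod (deriv \<phi> (P v)))\<^sup>2 * v$2"
  have Sbd: "0 < v$1 \<and> v$1 < 2*pi \<and> r0 < v$2 \<and> v$2 < \<rho>" if "v \<in> ?S" for v
    using that by (auto simp: interval_cart forall_2 a_def b_def)
  have cBd: "0 \<le> v$1 \<and> v$1 \<le> 2*pi \<and> r0 \<le> v$2 \<and> v$2 \<le> \<rho>" if "v \<in> cbox a b" for v
    using that by (auto simp: interval_cart forall_2 a_def b_def)
  have Pin: "P v \<in> ball 0 1" if "v \<in> cbox a b" for v
    using cBd[OF that] r by (simp add: P_def norm_mult)
  have derP: "(P has_derivative (\<lambda>w. of_real (w$2) * cis (v$1) + of_real (v$2) * (of_real (w$1) * (\<i> * cis (v$1))))) (at v within A)" for v A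
  proof -
    have 1: "((\<lambda>v::real^2. v$1) has_derivative (\<lambda>w. w$1)) (at v within A)" and
      2: "((\<lambda>v::real^2. v$2) has_derivative (\<lambda>w. w$2)) (at v within A)"
      by (rule bounded_linear_imp_has_derivative[OF bounded_linear_vec_nth])+
    show ?thesis
      unfolding P_def
      by (rule derivative_eq_intros 1 2 refl)+ (auto simp: algebra_simps scaleR_conv_of_real)
  qed
  have derT: "(T has_derivative T' v) (at v within ?S)" if v: "v \<in> ?S" for v
  proof -
    have "v \<in> cbox a b" using v box_subset_cbox by blast
    then have "(\<phi> has_field_derivative deriv \<phi> (P v)) (at (P v))"
      by (intro holomorphic_derivI[OF hol]) (use Pin in auto)
    then have "(\<phi> has_derivative (*) (deriv \<phi> (P v))) (at (P v))"
      by (simp add: has_field_derivative_def)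
    then have *: "((\<lambda>x. \<phi> (P x)) has_derivative (\<lambda>w. deriv \<phi> (P v) * (of_real (w$2) * cis (v$1) + of_real (v$2) * (of_real (w$1) * (\<i> * cis (v$1)))))) (at v within ?S)"
      by (rule has_derivative_compose[OF derP])
    have lin: "bounded_linear (\<lambda>z. vector [Re z, Im z] :: real^2)"
      unfolding linear_conv_bounded_linear[symmetric]
      by (rule linearI) (auto simp: vec_eq_iff forall_2)
    show ?thesis
      using bounded_linear.has_derivative[OF lin *] unfolding T_def T'_def Let_def .
  qed
  have injT: "inj_on T ?S"
  proof (rule inj_onI)
    fix v w assume v: "v \<in> ?S" and w: "w \<in> ?S" and "T v = T w"
    then have "\<phi> (P v) = \<phi> (P w)"
      unfolding T_def by (auto simp: vec_eq_iff forall_2 complex_eq_iff)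
    moreover have "P v \<in> ball 0 1" "P w \<in> ball 0 1" using v w Pin box_subset_cbox by blast+
    ultimately have eq: "P v = P w" using inj by (auto dest: inj_onD)
    have n: "cmod (P v) = v$2" "cmod (P w) = w$2" using Sbd[OF v] Sbd[OF w] r by (auto simp: P_def norm_mult)
    then have 2: "v$2 = w$2" using eq by simp
    then have "cis (v$1) = cis (w$1)" using eq Sbd[OF v] r by (auto simp: P_def)
    then have "v$1 = w$1" by (rule cis_eq_imp_eq) (use Sbd[OF v] Sbd[OF w] in auto)
    with 2 show "v = w" by (simp add: vec_eq_iff forall_2)
  qed
  have det: "\<bar>det (matrix (T' v))\<bar> = ?F v" if v: "v \<in> ?S" for v
  proof -
    obtain x y where d: "deriv \<phi> (P v) = Complex x y" by (cases "deriv \<phi> (P v)")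
    define C S where "C = cos (v$1)" and "S = sin (v$1)"
    then have cs: "cis (v$1) = Complex C S" "C\<^sup>2 + S\<^sup>2 = 1"
      by (simp_all add: cis.ctr)
    \<comment> \<open>The angle is the first coordinate and the radius the second, which reverses
      the orientation.\<close>
    have "det (matrix (T' v)) = - ((x\<^sup>2 + y\<^sup>2) * v$2 * (C\<^sup>2 + S\<^sup>2))"
      unfolding det_2 matrix_def T'_def Let_def d cs(1)
      by (simp add: axis_def) (simp add: algebra_simps power2_eq_square)
    then show ?thesis using Sbd[OF v] r unfolding cs(2) by (simp add: d cmod_power2 abs_mult)
  qed
  have contF: "continuous_on (cbox a b) ?F"
  proof -
    have "continuous_on (ball 0 1) (deriv \<phi>)"
      using hol by (intro holomorphic_on_imp_continuous_on holomorphic_deriv) auto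
    moreover have "continuous_on (cbox a b) P" unfolding P_def cis_conv_exp by (intro continuous_intros)
    ultimately have "continuous_on (cbox a b) (\<lambda>v. deriv \<phi> (P v))"
      by (rule continuous_on_compose2) (use Pin in auto)
    then show ?thesis by (intro continuous_intros)
  qed
  have intF: "?F integrable_on cbox a b" by (rule integrable_continuous[OF contF])
  then have "?F integrable_on ?S" by (simp add: integrable_on_open_interval)
  then have intS: "(\<lambda>x. \<bar>det (matrix (T' x))\<bar>) integrable_on ?S"
    using det by (metis (mono_tags, lifting) integrable_cong)
  have Sl: "?S \<in> sets lebesgue" by simp
  have TS: "T ` ?S \<in> lmeasurable"
    using measurable_differentiable_image_eq[OF Sl derT injT] intS by blast
  have meas: "measure lebesgue (T ` ?S) = integral ?S (\<lambda>x. \<bar>det (matrix (T' x))\<bar>)"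
    by (rule measure_differentiable_image_eq[OF Sl derT injT intS])
  also have "\<dots> = integral ?S ?F" by (rule integral_cong) (rule det)
  also have "\<dots> = integral (cbox a b) ?F" by (simp add: integral_open_interval)
  finally have m: "integral (cbox a b) ?F = measure lebesgue (T ` ?S)" by simp
  let ?B = "cbox (vector [-1,-1]) (vector [1,1]) :: (real^2) set"
  have "T ` ?S \<subseteq> ?B"
  proof
    fix y assume "y \<in> T ` ?S"
    then obtain v where v: "v \<in> ?S" "y = T v" by blast
    then have "P v \<in> ball 0 1" using Pin box_subset_cbox by blast
    then have "cmod (\<phi> (P v)) < 1" using im by (auto simp: image_subset_iff)
    then have "\<bar>Re (\<phi> (P v))\<bar> \<le> 1" "\<bar>Im (\<phi> (P v))\<bar> \<le> 1"
      using abs_Re_le_cmod abs_Im_le_cmod by (meson less_imp_le order_trans)+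
    then show "y \<in> ?B" by (auto simp: v(2) T_def interval_cart forall_2)
  qed
  then have "measure lebesgue (T ` ?S) \<le> measure lebesgue ?B"
    by (rule measure_mono_fmeasurable) (use TS in auto)
  also have "\<dots> = content ?B" by simp
  also have "\<dots> = 4"
  proof -
    have "0 \<in> ?B" by (auto simp: interval_cart forall_2)
    then have "?B \<noteq> {}" by blast
    then show ?thesis by (subst content_cbox_cart) (auto simp: UNIV_2)
  qed
  finally have "integral (cbox a b) ?F \<le> 4" using m by simp
  moreover have "((\<lambda>x. ?F (vector [fst x, snd x])) has_integral integral (cbox a b) ?F) (cbox (a$1, a$2) (b$1, b$2))"
    by (rule has_integral_pair_of_vec2) (rule integrable_integral[OF intF])
  ultimately show ?thesis
    by (simp add: has_integral_iff a_def b_def P_def)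
qed

text \<open>With \<open>d = 2*pi/m\<close> this folds a full turn into one sector: integrating over
  the offset of m equidistributed angles amounts to integrating over the circle.\<close>

lemma integral_periods:
  fixes f :: "real \<Rightarrow> real"
  assumes "continuous_on UNIV f" "0 \<le> d"
  shows "integral {0..real m * d} f = integral {0..d} (\<lambda>t. \<Sum>j<m. f (t + real j * d))"
proof (induction m)
  case (Suc m)
  have int: "f integrable_on {a..b}" for a b
    using assms(1) by (intro integrable_continuous_interval continuous_on_subset[OF assms(1)]) auto
  have int': "(\<lambda>t. f (t + c)) integrable_on {a..b}" for a b c
    by (intro integrable_continuous_interval continuous_on_compose2[OF assms(1)] continuous_intros) auto
  have "integral {0..real (Suc m) * d} f = integral {0..real m * d} f + integral {real m * d..real (Suc m) * d} f"
    using assms(2) by (intro Henstock_Kurzweil_Integration.integral_combine[symmetric] int) (auto simp: algebra_simps)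
  also have "integral {real m * d..real (Suc m) * d} f = integral {0..d} (\<lambda>t. f (t + real m * d))"
    using integral_shift_real_ivl[of "real m * d" "real m * d" "real (Suc m) * d" f]
    by (simp add: algebra_simps)
  also have "integral {0..real m * d} f = integral {0..d} (\<lambda>t. \<Sum>j<m. f (t + real j * d))"
    by (rule Suc.IH)
  also have "\<dots> + integral {0..d} (\<lambda>t. f (t + real m * d)) = integral {0..d} (\<lambda>t. (\<Sum>j<m. f (t + real j * d)) + f (t + real m * d))"
    by (intro integral_add[symmetric] integrable_sum int') auto
  finally show ?case by simp
qed simp

lemma exists_le_of_integral_le:
  fixes f :: "real \<Rightarrow> real"
  assumes "continuous_on {a..b} f" "a < b" "integral {a..b} f \<le> c * (b - a)"
  obtains t where "t \<in> {a..b}" "f t \<le> c"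
proof (rule ccontr)
  assume "\<not> thesis"
  with that have gt: "c < f t" if "t \<in> {a..b}" for t using that by force
  obtain t0 where t0: "t0 \<in> {a..b}" "\<forall>t\<in>{a..b}. f t0 \<le> f t"
    using continuous_attains_inf[OF compact_Icc _ assms(1)] assms(2) by auto
  have "integral {a..b} (\<lambda>_. f t0) \<le> integral {a..b} f"
    using assms(1) t0(2) by (intro integral_le integrable_continuous_interval) auto
  then have "f t0 * (b - a) \<le> integral {a..b} f" using assms(2) by (simp add: mult.commute)
  then have "f t0 * (b - a) \<le> c * (b - a)" using assms(3) by (rule order_trans)
  moreover have "c * (b - a) < f t0 * (b - a)" using gt[OF t0(1)] assms(2) by simp
  ultimately show False by simp
qed

section \<open>Lengths of the images of radial segments\<close>

definition radial_length :: "(complex \<Rightarrow> complex) \<Rightarrow> real \<Rightarrow> real \<Rightarrow> real \<Rightarrow> real" where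
  "radial_length \<phi> r \<rho> t = integral {r..\<rho>} (\<lambda>s. cmod (deriv \<phi> (of_real s * cis t)))"

context
  fixes \<phi> :: "complex \<Rightarrow> complex"
  assumes hol: "\<phi> holomorphic_on ball 0 1"
begin

lemma continuous_on_deriv_polar:
  assumes "0 \<le> r" "\<rho> < 1"
  shows "continuous_on (UNIV \<times> {r..\<rho>}) (\<lambda>x. deriv \<phi> (of_real (snd x) * cis (fst x)))"
proof -
  have "continuous_on (ball 0 1) (deriv \<phi>)"
    using hol by (intro holomorphic_on_imp_continuous_on holomorphic_deriv) auto
  moreover have "continuous_on (UNIV \<times> {r..\<rho>}) (\<lambda>x. of_real (snd x) * cis (fst x))"
    unfolding cis_conv_exp by (intro continuous_intros)
  ultimately show ?thesis
    by (rule continuous_on_compose2) (use assms in \<open>auto simp: norm_mult\<close>)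
qed

lemma continuous_on_deriv_radius:
  assumes "0 \<le> r" "\<rho> < 1"
  shows "continuous_on {r..\<rho>} (\<lambda>s. deriv \<phi> (of_real s * cis t))"
proof -
  have "continuous_on {r..\<rho>} (\<lambda>s. (t, s))" by (intro continuous_intros)
  from continuous_on_compose2[OF continuous_on_deriv_polar[OF assms] this] show ?thesis by auto
qed

lemma radial_integrable:
  assumes "0 \<le> r" "\<rho> < 1"
  shows "(\<lambda>s. cmod (deriv \<phi> (of_real s * cis t))) integrable_on {r..\<rho>}"
  by (intro integrable_continuous_interval continuous_on_norm continuous_on_deriv_radius assms)

lemma continuous_radial_length:
  assumes "0 \<le> r" "\<rho> < 1"
  shows "continuous_on UNIV (radial_length \<phi> r \<rho>)"
  unfolding radial_length_def
  using integral_continuous_on_param[of UNIV r \<rho> "\<lambda>t s. cmod (deriv \<phi> (of_real s * cis t))"]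
    continuous_on_norm[OF continuous_on_deriv_polar[OF assms]] by (simp add: case_prod_unfold)

lemma radial_length_nonneg: "0 \<le> radial_length \<phi> r \<rho> t"
  unfolding radial_length_def
  \<comment> \<open>A non-integrable function has integral 0 by default, so the endpoints need no
    restriction.\<close>
  by (cases "(\<lambda>s. cmod (deriv \<phi> (of_real s * cis t))) integrable_on {r..\<rho>}")
     (auto simp: integral_nonneg not_integrable_integral)

lemma radial_length_combine:
  assumes "0 \<le> r" "r \<le> s" "s \<le> \<rho>" "\<rho> < 1"
  shows "radial_length \<phi> r \<rho> t = radial_length \<phi> r s t + radial_length \<phi> s \<rho> t"
  unfolding radial_length_def
  using assms by (intro Henstock_Kurzweil_Integration.integral_combine[symmetric] radial_integrable) auto

lemma dist_le_radial_length:
  assumes "0 \<le> r" "r \<le> \<rho>" "\<rho> < 1"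
  shows "cmod (\<phi> (of_real \<rho> * cis t) - \<phi> (of_real r * cis t)) \<le> radial_length \<phi> r \<rho> t"
proof -
  have "((\<lambda>s. deriv \<phi> (of_real s * cis t) * cis t) has_integral (\<phi> (of_real \<rho> * cis t) - \<phi> (of_real r * cis t))) {r..\<rho>}"
  proof (rule fundamental_theorem_of_calculus[OF assms(2)])
    fix s assume s: "s \<in> {r..\<rho>}"
    have "of_real s * cis t \<in> ball 0 1" using s assms by (simp add: norm_mult)
    then have "(\<phi> has_field_derivative deriv \<phi> (of_real s * cis t)) (at (of_real s * cis t))"
      by (intro holomorphic_derivI[OF hol]) auto
    moreover have "((\<lambda>s. of_real s * cis t) has_vector_derivative cis t) (at s within {r..\<rho>})"
      by (auto intro!: derivative_eq_intros)
    ultimately show "((\<lambda>s. \<phi> (of_real s * cis t)) has_vector_derivative deriv \<phi> (of_real s * cis t) * cis t) (at s within {r..\<rho>})"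
      using field_vector_diff_chain_within[of "\<lambda>s. of_real s * cis t" "cis t" s "{r..\<rho>}" \<phi> "deriv \<phi> (of_real s * cis t)"]
      by (simp add: o_def mult.commute has_field_derivative_at_within)
  qed
  then have eq: "integral {r..\<rho>} (\<lambda>s. deriv \<phi> (of_real s * cis t) * cis t) = \<phi> (of_real \<rho> * cis t) - \<phi> (of_real r * cis t)"
    and int: "(\<lambda>s. deriv \<phi> (of_real s * cis t) * cis t) integrable_on {r..\<rho>}" by (auto simp: has_integral_iff)
  show ?thesis unfolding radial_length_def eq[symmetric]
    by (intro integral_norm_bound_integral int radial_integrable assms) (auto simp: norm_mult)
qed

end

text \<open>By the area theorem the Dirichlet integral of \<open>\<phi>\<close> over a thin annulus near the unit circle is
  small, hence the images of most radial segments of that annulus are short.\<close>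

lemma small_mean_radial_length:
  fixes \<epsilon> R :: real
  assumes hol: "\<phi> holomorphic_on ball 0 1" and inj: "inj_on \<phi> (ball 0 1)"
    and im: "\<phi> ` ball 0 1 \<subseteq> ball 0 1" and "R < 1" "\<epsilon> > 0"
  obtains r where "0 < r" "R < r" "r < 1"
    "\<And>\<rho>. r \<le> \<rho> \<Longrightarrow> \<rho> < 1 \<Longrightarrow> integral {0..2*pi} (radial_length \<phi> r \<rho>) \<le> \<epsilon>"
proof -
  define K where "K = (\<lambda>t s. (cmod (deriv \<phi> (of_real s * cis t)))\<^sup>2 * s)"
  define E where "E = (\<lambda>a b. integral {0..2*pi} (\<lambda>t. integral {a..b} (K t)))"
  have contK: "continuous_on (UNIV \<times> {a..b}) (\<lambda>x. K (fst x) (snd x))" if "0 \<le> a" "b < 1" for a b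
    unfolding K_def using that by (intro continuous_intros continuous_on_deriv_polar[OF hol])
  have contIK: "continuous_on UNIV (\<lambda>t. integral {a..b} (K t))" if "0 \<le> a" "b < 1" for a b
    using integral_continuous_on_param[of UNIV a b K] contK[OF that] by (simp add: case_prod_unfold)
  have intIK: "(\<lambda>t. integral {a..b} (K t)) integrable_on {c..d}" if "0 \<le> a" "b < 1" for a b c d
    by (intro integrable_continuous_interval continuous_on_subset[OF contIK[OF that]]) auto
  have intK: "K t integrable_on {a..b}" if "0 \<le> a" "b < 1" for a b t
  proof -
    have "continuous_on {a..b} (\<lambda>s. (t, s))" by (intro continuous_intros)
    from continuous_on_compose2[OF contK[OF that] this] show ?thesis
      by (intro integrable_continuous_interval) auto
  qed
  have E4: "E a b \<le> 4" if "0 < a" "a \<le> b" "b < 1" for a b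
  proof -
    have "continuous_on (cbox (0, a) (2*pi, b)) (\<lambda>x. K (fst x) (snd x))"
      using that by (intro continuous_on_subset[OF contK[of a b]]) (auto simp: cbox_Pair_eq)
    then have "integral (cbox (0, a) (2*pi, b)) (\<lambda>x. K (fst x) (snd x)) = E a b"
      unfolding E_def by (subst integral_prod_continuous) auto
    then show ?thesis using energy_bound[OF hol inj im that] by (simp add: K_def)
  qed
  have Eadd: "E a c = E a b + E b c" if "0 < a" "a \<le> b" "b \<le> c" "c < 1" for a b c
  proof -
    have "E a c = integral {0..2*pi} (\<lambda>t. integral {a..b} (K t) + integral {b..c} (K t))"
      unfolding E_def using that
      by (intro integral_cong) (auto intro!: Henstock_Kurzweil_Integration.integral_combine[symmetric] intK)
    also have "\<dots> = E a b + E b c" unfolding E_def using that by (intro integral_add intIK) auto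
    finally show ?thesis .
  qed
  have E0: "0 \<le> E a b" if "0 < a" "b < 1" for a b
    unfolding E_def using that
    by (intro integral_nonneg intIK) (auto intro!: integral_nonneg intK, auto simp: K_def)
  \<comment> \<open>\<open>E (1/2)\<close> is increasing and bounded by 4, so beyond some radius the
    remaining energy is at most \<epsilon>/2.\<close>
  define M where "M = Sup (E (1/2) ` {1/2..<1})"
  have bdd: "bdd_above (E (1/2) ` {1/2..<1})" using E4 by (auto intro!: bdd_aboveI[of _ 4])
  have "M - \<epsilon>/2 < M" using assms by simp
  then obtain r1 where r1: "r1 \<in> {1/2..<1}" "M - \<epsilon>/2 < E (1/2) r1"
    unfolding M_def using less_cSup_iff[OF _ bdd] by auto
  \<comment> \<open>The three entries make the remaining energy small, push \<open>r\<close> beyond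
    \<open>R\<close>, and keep the width of the annulus at most \<epsilon>/(2 pi), so that the
    linear term below contributes at most \<epsilon>/2.\<close>
  define r where "r = Max {r1, (R + 1)/2, 1 - \<epsilon>/(2*pi)}"
  have r: "r1 \<le> r" "R < r" "r < 1" "1 - \<epsilon>/(2*pi) \<le> r" using r1 assms
    unfolding r_def by (auto simp: less_max_iff_disj)
  have half: "1/2 \<le> r" "0 < r" using r r1 by auto
  have Er: "M - \<epsilon>/2 < E (1/2) r"
    using Eadd[of "1/2" r1 r] E0[of r1 r] r r1 by auto
  show thesis
  proof (rule that[of r])
    fix \<rho> assume \<rho>: "r \<le> \<rho>" "\<rho> < 1"
    have "E (1/2) \<rho> \<le> M" unfolding M_def using \<rho> half by (intro cSup_upper bdd) auto
    then have E: "E r \<rho> \<le> \<epsilon>/2" using Eadd[of "1/2" r \<rho>] Er \<rho> half by auto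
    have le: "radial_length \<phi> r \<rho> t \<le> (\<rho> - r)/2 + integral {r..\<rho>} (K t)" for t
    proof -
      have "radial_length \<phi> r \<rho> t \<le> integral {r..\<rho>} (\<lambda>s. 1/2 + K t s)"
        unfolding radial_length_def
      proof (intro integral_le radial_integrable[OF hol] integrable_add intK)
        fix s assume s: "s \<in> {r..\<rho>}"
        let ?d = "cmod (deriv \<phi> (of_real s * cis t))"
        \<comment> \<open>Arithmetic-geometric mean inequality. Since \<open>s\<close> is at least
          1/2, the factor 1/2 is absorbed by the weight \<open>s\<close> in \<open>K\<close>; this
          is why the energy is measured from radius 1/2 on.\<close>
        have "?d \<le> 1/2 + ?d\<^sup>2 * (1/2)" using sum_squares_bound[of 1 ?d] by simp
        also have "?d\<^sup>2 * (1/2) \<le> K t s" unfolding K_def using s half by (intro mult_left_mono) auto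
        finally show "?d \<le> 1/2 + K t s" by simp
      qed (use \<rho> half in auto)
      also have "\<dots> = (\<rho> - r)/2 + integral {r..\<rho>} (K t)"
        using \<rho> half by (subst integral_add) (auto intro: intK)
      finally show ?thesis .
    qed
    have "integral {0..2*pi} (radial_length \<phi> r \<rho>) \<le> integral {0..2*pi} (\<lambda>t. (\<rho> - r)/2 + integral {r..\<rho>} (K t))"
      using \<rho> half le
      by (intro integral_le integrable_add intIK integrable_continuous_interval
          continuous_on_subset[OF continuous_radial_length[OF hol]]) auto
    also have "\<dots> = pi * (\<rho> - r) + E r \<rho>"
      unfolding E_def using \<rho> half by (subst integral_add) (auto intro: intIK)
    also have "\<dots> \<le> pi * (\<epsilon>/(2*pi)) + \<epsilon>/2" using E \<rho> r by (intro add_mono mult_left_mono) auto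
    finally show "integral {0..2*pi} (radial_length \<phi> r \<rho>) \<le> \<epsilon>" by simp
  qed (use r half in auto)
qed

text \<open>For fixed \<rho>, averaging the sum of the N lengths over the offset \<tau> yields an
  offset with sum at most N \<epsilon>. The lengths grow with \<rho>, so the sets of good offsets
  are nested compact sets, and one \<tau> serves all \<rho> < 1. Note that \<open>r\<close> is
  chosen before \<open>N\<close>.\<close>

lemma equidistributed_short_radii:
  fixes \<epsilon> R :: real
  assumes hol: "\<phi> holomorphic_on ball 0 1" and inj: "inj_on \<phi> (ball 0 1)"
    and im: "\<phi> ` ball 0 1 \<subseteq> ball 0 1" and "R < 1" "\<epsilon> > 0"
  obtains r where "0 < r" "R < r" "r < 1"
    "\<And>N::nat. 0 < N \<Longrightarrow> \<exists>\<tau>. \<forall>\<rho>\<in>{r..<1}.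
        (\<Sum>j<N. radial_length \<phi> r \<rho> (\<tau> + real j * (2*pi/N))) \<le> N * \<epsilon>"
proof -
  obtain r where r: "0 < r" "R < r" "r < 1"
    and rI: "\<And>\<rho>. r \<le> \<rho> \<Longrightarrow> \<rho> < 1 \<Longrightarrow> integral {0..2*pi} (radial_length \<phi> r \<rho>) \<le> 2*pi*\<epsilon>"
    using small_mean_radial_length[OF hol inj im \<open>R < 1\<close>, of "2*pi*\<epsilon>"] \<open>\<epsilon> > 0\<close> by auto
  have "\<exists>\<tau>. \<forall>\<rho>\<in>{r..<1}. (\<Sum>j<N. radial_length \<phi> r \<rho> (\<tau> + real j * (2*pi/N))) \<le> N * \<epsilon>"
    if N: "0 < N" for N :: nat
  proof -
    define \<Psi> where "\<Psi> = (\<lambda>\<rho> \<tau>. \<Sum>j<N. radial_length \<phi> r \<rho> (\<tau> + real j * (2*pi/N)))"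
    have cont: "continuous_on UNIV (\<Psi> \<rho>)" if "\<rho> < 1" for \<rho>
      unfolding \<Psi>_def using that r
      by (intro continuous_intros continuous_on_compose2[OF continuous_radial_length[OF hol]]) auto
    have mono: "\<Psi> \<rho> \<tau> \<le> \<Psi> \<rho>' \<tau>" if "r \<le> \<rho>" "\<rho> \<le> \<rho>'" "\<rho>' < 1" for \<rho> \<rho>' \<tau>
      unfolding \<Psi>_def
    proof (rule sum_mono)
      fix j
      show "radial_length \<phi> r \<rho> (\<tau> + real j * (2*pi/N)) \<le> radial_length \<phi> r \<rho>' (\<tau> + real j * (2*pi/N))"
        using radial_length_combine[OF hol, of r \<rho> \<rho>'] radial_length_nonneg[OF hol, of \<rho> \<rho>'] that r by simp
    qed
    \<comment> \<open>Starts at \<open>q 0 = r\<close> and increases to 1, so by monotonicity these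
      countably many radii suffice.\<close>
    define q where "q = (\<lambda>m::nat. 1 - (1 - r) / real (m + 1))"
    have q: "r \<le> q m" "q m < 1" for m
      using r divide_left_mono[of 1 "real (m + 1)" "1 - r"] by (auto simp: q_def)
    have qmono: "q m \<le> q n" if "m \<le> n" for m n
      unfolding q_def using that r by (auto intro!: divide_left_mono)
    define F where "F = (\<lambda>m. {\<tau> \<in> {0..2*pi/N}. \<Psi> (q m) \<tau> \<le> N * \<epsilon>})"
    have "\<Inter>(range F) \<noteq> {}"
    proof (rule compact_nest)
      fix m
      have "closed {\<tau> \<in> {0..2*pi/N}. \<Psi> (q m) \<tau> \<le> N * \<epsilon>}"
        using q[of m] by (intro continuous_closed_preimage_constant continuous_on_closed_Collect_le
            closed_Collect_le continuous_on_subset[OF cont] continuous_intros | auto)+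
      then show "compact (F m)"
        unfolding F_def compact_eq_bounded_closed
        by (auto intro: bounded_subset[OF bounded_closed_interval[of 0 "2*pi/N"]])
      have "integral {0..2*pi/N} (\<Psi> (q m)) = integral {0..real N * (2*pi/N)} (radial_length \<phi> r (q m))"
        unfolding \<Psi>_def using q[of m] r by (intro integral_periods[symmetric] continuous_radial_length[OF hol]) auto
      also have "\<dots> \<le> (N * \<epsilon>) * (2*pi/N - 0)" using rI[OF q] N by (simp add: mult.commute)
      finally obtain t where "t \<in> {0..2*pi/N}" "\<Psi> (q m) t \<le> N * \<epsilon>"
        using N q[of m] by (elim exists_le_of_integral_le[rotated 2]) (auto intro: continuous_on_subset[OF cont])
      then show "F m \<noteq> {}" by (auto simp: F_def)
    next
      fix m n :: nat assume "m \<le> n"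
      then show "F n \<subseteq> F m" using mono[OF q(1) qmono q(2)] unfolding F_def by (auto intro: order_trans)
    qed
    then obtain \<tau> where \<tau>: "\<And>m. \<tau> \<in> F m" by blast
    have "\<Psi> \<rho> \<tau> \<le> N * \<epsilon>" if \<rho>: "\<rho> \<in> {r..<1}" for \<rho>
    proof -
      obtain m :: nat where m: "(1 - r) / (1 - \<rho>) < real m" using reals_Archimedean2 by blast
      then have "1 - r < (1 - \<rho>) * real m" using \<rho> by (simp add: field_simps)
      also have "\<dots> \<le> (1 - \<rho>) * real (m + 1)" using \<rho> by (intro mult_left_mono) auto
      finally have "\<rho> \<le> q m" unfolding q_def by (simp add: field_simps)
      then show ?thesis using mono[of \<rho> "q m" \<tau>] \<tau>[of m] q[of m] \<rho> by (auto simp: F_def)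
    qed
    then show ?thesis unfolding \<Psi>_def by blast
  qed
  with r that show thesis by blast
qed

section \<open>Radial limits of homeomorphisms onto convex domains\<close>

text \<open>A Cayley transform takes the disc to the upper half plane and the four boundary points
  to real numbers in the same order. There the curves join interlaced points on the lower edge of a
  rectangle, so \<open>fashoda_interlace\<close> applies.\<close>

lemma disc_chords_meet:
  assumes ang: "a < b" "b < c" "c < d" "d < a + 2*pi"
    and p1: "path \<gamma>" "pathstart \<gamma> = cis a" "pathfinish \<gamma> = cis c" "path_image \<gamma> \<subseteq> ball 0 1 \<union> {cis a, cis c}"
    and p2: "path \<delta>" "pathstart \<delta> = cis b" "pathfinish \<delta> = cis d" "path_image \<delta> \<subseteq> ball 0 1 \<union> {cis b, cis d}"
  obtains z where "z \<in> ball 0 1" "z \<in> path_image \<gamma>" "z \<in> path_image \<delta>"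
proof -
  \<comment> \<open>The point \<open>- cis \<mu>\<close> is the midpoint of the open arc from
    \<open>cis d\<close> to \<open>cis (a + 2*pi)\<close>, which contains none of the four points.
    The map \<open>C\<close> sends it to infinity, and \<open>cis t\<close> to the tangent of (t -
    \<mu>)/2.\<close>
  define \<mu> where "\<mu> = (a + d) / 2"
  define C :: "complex \<Rightarrow> complex" where "C = (\<lambda>z. \<i> * (1 - z * cis (- \<mu>)) / (1 + z * cis (- \<mu>)))"
  define H :: "complex \<Rightarrow> real^2" where "H = (\<lambda>z. vector [Re (C z), Im (C z)])"
  define D where "D = cball 0 1 - {- cis \<mu>}"
  have nz: "1 + z * cis (- \<mu>) \<noteq> 0" if "z \<in> D" for z
  proof
    assume "1 + z * cis (- \<mu>) = 0"
    then have "(1 + z * cis (- \<mu>)) * cis \<mu> = 0" by simp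
    then have "z = - cis \<mu>" by (simp add: algebra_simps cis_mult add_eq_0_iff2)
    then show False using that by (simp add: D_def)
  qed
  have cisC: "C (cis t) = of_real (tan ((t - \<mu>) / 2))" and cisD: "cis t \<in> D" if "\<bar>t - \<mu>\<bar> < pi" for t
  proof -
    define u where "u = (t - \<mu>) / 2"
    have u: "cos u > 0" using that by (intro cos_gt_zero_pi) (auto simp: u_def)
    have 1: "cis t * cis (- \<mu>) = cis u * cis u" by (simp add: cis_mult u_def)
    have 2: "1 = cis u * cis (- u)" by (simp add: cis_mult)
    have 3: "1 + cis t * cis (- \<mu>) = cis u * (2 * of_real (cos u))" unfolding 1
      by (subst (1) 2) (simp add: complex_eq_iff algebra_simps)
    have 4: "1 - cis t * cis (- \<mu>) = cis u * (- 2 * \<i> * of_real (sin u))" unfolding 1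
      by (subst (1) 2) (simp add: complex_eq_iff algebra_simps)
    have "C (cis t) = \<i> * (- 2 * \<i> * of_real (sin u)) / (2 * of_real (cos u))"
      unfolding C_def 3 4 using u by (simp add: field_simps)
    also have "\<dots> = of_real (tan u)" by (simp add: tan_def)
    finally show "C (cis t) = of_real (tan ((t - \<mu>) / 2))" by (simp add: u_def)
    have "1 + cis t * cis (- \<mu>) \<noteq> 0" unfolding 3 using u by simp
    moreover have "1 + (- cis \<mu>) * cis (-\<mu>) = 0" by (simp add: cis_mult)
    ultimately have "cis t \<noteq> - cis \<mu>" by metis
    then show "cis t \<in> D" by (simp add: D_def)
  qed
  have abcd: "\<bar>a - \<mu>\<bar> < pi" "\<bar>b - \<mu>\<bar> < pi" "\<bar>c - \<mu>\<bar> < pi" "\<bar>d - \<mu>\<bar> < pi"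
    using ang by (auto simp: \<mu>_def abs_if field_simps)
  have H_cis: "H (cis t) $ 1 = tan ((t - \<mu>)/2)" "H (cis t) $ 2 = 0" if "\<bar>t - \<mu>\<bar> < pi" for t
    using cisC[OF that] by (simp_all add: H_def)
  have ballD: "ball 0 1 \<subseteq> D" by (auto simp: D_def)
  have imD: "path_image \<gamma> \<subseteq> D" "path_image \<delta> \<subseteq> D"
    using p1(4) p2(4) ballD cisD abcd by blast+
  have contC: "continuous_on D C" unfolding C_def using nz by (intro continuous_intros) auto
  have contH: "continuous_on D H"
  proof -
    have "linear (\<lambda>z. vector [Re z, Im z] :: real^2)" by (rule linearI) (auto simp: vec_eq_iff forall_2)
    then have "continuous_on UNIV (\<lambda>z. vector [Re z, Im z] :: real^2)"
      by (simp add: linear_continuous_on linear_conv_bounded_linear)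
    from continuous_on_compose2[OF this contC] show ?thesis by (simp add: H_def)
  qed
  have pos: "H z $ 2 \<ge> 0" if "z \<in> D" for z
  proof -
    define w where "w = z * cis (- \<mu>)"
    have w: "cmod w \<le> 1" "1 + w \<noteq> 0" using that nz[OF that] by (auto simp: w_def D_def norm_mult)
    have "Im (\<i> * (1 - w) / (1 + w)) = (1 - (cmod w)\<^sup>2) / (cmod (1 + w))\<^sup>2"
      unfolding complex_div_cnj[of "\<i> * (1 - w)"]
      by (simp add: cmod_power2 flip: of_real_power) (simp add: power2_eq_square algebra_simps)
    moreover have "(cmod w)\<^sup>2 \<le> 1" using w by (simp add: power_le_one)
    ultimately show ?thesis by (simp add: H_def C_def w_def)
  qed
  have injH: "z = w" if "z \<in> D" "w \<in> D" "H z = H w" for z w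
  proof -
    have "C z = C w" using that(3) by (simp add: H_def vec_eq_iff forall_2 complex_eq_iff)
    then have "(1 - z * cis (- \<mu>)) * (1 + w * cis (- \<mu>)) = (1 - w * cis (- \<mu>)) * (1 + z * cis (- \<mu>))"
      using nz[OF that(1)] nz[OF that(2)] by (simp add: C_def frac_eq_eq)
    then show ?thesis by (simp add: algebra_simps)
  qed
  have paths: "path (H \<circ> \<gamma>)" "path (H \<circ> \<delta>)"
    using p1(1) p2(1) imD contH by (auto intro: path_continuous_image continuous_on_subset)
  have "bounded (H ` path_image \<gamma> \<union> H ` path_image \<delta>)"
    using paths by (metis bounded_Un bounded_path_image path_image_compose)
  then obtain M where M: "\<And>x. x \<in> H ` path_image \<gamma> \<union> H ` path_image \<delta> \<Longrightarrow> norm x \<le> M"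
    unfolding bounded_iff by blast
  \<comment> \<open>The lower edge lies on the real axis, where the four end points are; the images
    of both curves lie above it.\<close>
  define l where "l = (vector [- M, 0] :: real^2)"
  define u where "u = (vector [M, M] :: real^2)"
  have box: "H z \<in> cbox l u" if "z \<in> path_image \<gamma> \<union> path_image \<delta>" for z
  proof -
    have "norm (H z) \<le> M" using M that by blast
    then have "\<bar>H z $ i\<bar> \<le> M" for i using component_le_norm_cart[of "H z" i] by linarith
    then have "\<bar>H z $ 1\<bar> \<le> M" "\<bar>H z $ 2\<bar> \<le> M" by blast+
    moreover have "H z $ 2 \<ge> 0" using that imD pos by blast
    ultimately show ?thesis by (auto simp: interval_cart forall_2 l_def u_def)
  qed
  have mono: "tan ((s - \<mu>)/2) < tan ((t - \<mu>)/2)" if "s < t" "\<bar>s - \<mu>\<bar> < pi" "\<bar>t - \<mu>\<bar> < pi" for s t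
    using that by (intro tan_monotone) (auto simp: abs_less_iff)
  obtain x where x: "x \<in> path_image (H \<circ> \<gamma>)" "x \<in> path_image (H \<circ> \<delta>)"
  proof (rule fashoda_interlace[OF paths, of l u])
    show "path_image (H \<circ> \<gamma>) \<subseteq> cbox l u" "path_image (H \<circ> \<delta>) \<subseteq> cbox l u"
      using box by (auto simp: path_image_compose)
  qed (use abcd ang p1 p2 mono in \<open>auto simp: pathstart_compose pathfinish_compose H_cis l_def\<close>)
  then obtain z w where zw: "z \<in> path_image \<gamma>" "w \<in> path_image \<delta>" "x = H z" "x = H w"
    by (auto simp: path_image_compose)
  then have "z = w" using injH imD by blast
  have ne: "cis s \<noteq> cis t" if "s \<noteq> t" "\<bar>s - \<mu>\<bar> < pi" "\<bar>t - \<mu>\<bar> < pi" for s t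
  proof
    assume "cis s = cis t"
    moreover have "\<bar>s - t\<bar> < 2 * pi" using that by linarith
    ultimately show False using cis_eq_imp_eq[of s t] that by blast
  qed
  have "z \<in> ball 0 1"
  proof (rule ccontr)
    assume "z \<notin> ball 0 1"
    then have "z \<in> {cis a, cis c}" "z \<in> {cis b, cis d}" using zw \<open>z = w\<close> p1(4) p2(4) by blast+
    then show False using ne abcd ang by auto
  qed
  with zw \<open>z = w\<close> show thesis using that by blast
qed

text \<open>The path runs inwards along one radius, then through the preimage of the segment between
  two values of \<open>G\<close>, then outwards along the other radius. On the radii
  \<open>G\<close> is within \<open>e\<close> of its limits, and on the segment its height is at
  most that of the two ends. At the end points themselves \<open>G\<close> is not controlled, hence
  the restriction to the open disc.\<close>

lemma chord_preimage_path:
  fixes G :: "complex \<Rightarrow> complex"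
  assumes cont: "continuous_on (ball 0 1) G" and inj: "inj_on G (ball 0 1)"
    and conv: "convex (G ` ball 0 1)" and e: "0 < e"
    and Wa: "((\<lambda>s. G (of_real s * cis a)) \<longlongrightarrow> Wa) (at_left 1)"
    and Wb: "((\<lambda>s. G (of_real s * cis b)) \<longlongrightarrow> Wb) (at_left 1)"
  obtains \<gamma> where "path \<gamma>" "pathstart \<gamma> = cis a" "pathfinish \<gamma> = cis b"
    "path_image \<gamma> \<subseteq> ball 0 1 \<union> {cis a, cis b}"
    "\<And>z n. z \<in> path_image \<gamma> \<Longrightarrow> z \<in> ball 0 1 \<Longrightarrow> norm n = 1 \<Longrightarrow> G z \<bullet> n \<le> max (Wa \<bullet> n) (Wb \<bullet> n) + e"
proof -
  have "\<forall>\<^sub>F s in at_left 1. dist (G (of_real s * cis a)) Wa < e \<and> dist (G (of_real s * cis b)) Wb < e"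
    using tendstoD[OF Wa e] tendstoD[OF Wb e] by eventually_elim auto
  then obtain l where l: "l < 1" "\<And>s. l < s \<Longrightarrow> s < 1 \<Longrightarrow> dist (G (of_real s * cis a)) Wa < e \<and> dist (G (of_real s * cis b)) Wb < e"
    unfolding eventually_at_left_field by blast
  define \<sigma> where "\<sigma> = (max l 0 + 1) / 2"
  have \<sigma>: "0 < \<sigma>" "l < \<sigma>" "\<sigma> < 1" using l(1) by (auto simp: \<sigma>_def max_def)
  obtain g where hom: "homeomorphism (ball 0 1) (G ` ball 0 1) G g"
    using invariance_of_domain_homeomorphism[OF open_ball cont order_refl inj] .
  define A where "A = of_real \<sigma> * cis a"
  define B where "B = of_real \<sigma> * cis b"
  have AB: "A \<in> ball 0 1" "B \<in> ball 0 1" using \<sigma> by (auto simp: A_def B_def norm_mult)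
  have seg: "closed_segment (G A) (G B) \<subseteq> G ` ball 0 1"
    using AB conv by (intro closed_segment_subset) auto
  define m where "m = g \<circ> linepath (G A) (G B)"
  have pm: "path m" unfolding m_def using hom seg
    by (intro path_continuous_image) (auto intro: continuous_on_subset simp: homeomorphism_def)
  have ms: "pathstart m = A" "pathfinish m = B"
    using hom AB by (auto simp: m_def pathstart_compose pathfinish_compose homeomorphism_def)
  define \<gamma> where "\<gamma> = linepath (cis a) A +++ (m +++ linepath B (cis b))"
  have img: "path_image \<gamma> = closed_segment (cis a) A \<union> (g ` closed_segment (G A) (G B) \<union> closed_segment B (cis b))"
    unfolding \<gamma>_def using ms by (simp add: path_image_join m_def path_image_compose)
  have rad: "\<exists>s\<in>{\<sigma>..1}. z = of_real s * cis t" if "z \<in> closed_segment (cis t) (of_real \<sigma> * cis t)" for z t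
  proof -
    from that obtain u where u: "0 \<le> u" "u \<le> 1" "z = (1 - u) *\<^sub>R cis t + u *\<^sub>R (of_real \<sigma> * cis t)"
      unfolding in_segment by blast
    have "u * (1 - \<sigma>) \<le> 1 * (1 - \<sigma>)" using u \<sigma> by (intro mult_right_mono) auto
    then have "\<sigma> \<le> 1 - u * (1 - \<sigma>)" by simp
    moreover have "0 \<le> u * (1 - \<sigma>)" using u \<sigma> by simp
    moreover have "z = of_real (1 - u * (1 - \<sigma>)) * cis t"
      unfolding u(3) by (simp add: scaleR_conv_of_real algebra_simps)
    ultimately show ?thesis by (intro bexI[of _ "1 - u * (1 - \<sigma>)"]) auto
  qed
  have gm: "z \<in> ball 0 1 \<and> G z \<in> closed_segment (G A) (G B)" if "z \<in> g ` closed_segment (G A) (G B)" for z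
    using that seg hom by (auto simp: homeomorphism_def)
  have lin: "\<bar>x \<bullet> n - y \<bullet> n\<bar> \<le> dist x y" if "norm n = 1" for x y n :: complex
    using Cauchy_Schwarz_ineq2[of "x - y" n] that by (simp add: inner_diff_left dist_norm)
  show thesis
  proof (rule that[of \<gamma>])
    show "path \<gamma>" using pm ms by (simp add: \<gamma>_def)
    show "pathstart \<gamma> = cis a" "pathfinish \<gamma> = cis b" by (auto simp: \<gamma>_def)
    show "path_image \<gamma> \<subseteq> ball 0 1 \<union> {cis a, cis b}"
    proof
      fix z assume "z \<in> path_image \<gamma>"
      then consider "z \<in> closed_segment (cis a) A" | "z \<in> g ` closed_segment (G A) (G B)" | "z \<in> closed_segment (cis b) B"
        unfolding img by (auto simp: closed_segment_commute)
      then show "z \<in> ball 0 1 \<union> {cis a, cis b}"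
      proof cases
        case 1
        then obtain s where "s \<in> {\<sigma>..1}" "z = of_real s * cis a" using rad A_def by blast
        then show ?thesis using \<sigma> by (cases "s = 1") (auto simp: norm_mult)
      next
        case 3
        then obtain s where "s \<in> {\<sigma>..1}" "z = of_real s * cis b" using rad B_def by blast
        then show ?thesis using \<sigma> by (cases "s = 1") (auto simp: norm_mult)
      qed (use gm in blast)
    qed
  next
    fix z n :: complex assume z: "z \<in> path_image \<gamma>" "z \<in> ball 0 1" and n: "norm n = 1"
    have near: "G (of_real s * cis a) \<bullet> n \<le> Wa \<bullet> n + e" "G (of_real s * cis b) \<bullet> n \<le> Wb \<bullet> n + e"
      if "\<sigma> \<le> s" "s < 1" for s
      using l(2)[of s] that \<sigma> lin[OF n, of "G (of_real s * cis a)" Wa] lin[OF n, of "G (of_real s * cis b)" Wb] by auto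
    consider "z \<in> closed_segment (cis a) A" | "z \<in> g ` closed_segment (G A) (G B)" | "z \<in> closed_segment (cis b) B"
      using z(1) unfolding img by (auto simp: closed_segment_commute)
    then show "G z \<bullet> n \<le> max (Wa \<bullet> n) (Wb \<bullet> n) + e"
    proof cases
      case 1
      then obtain s where s: "s \<in> {\<sigma>..1}" "z = of_real s * cis a" using rad A_def by blast
      then have "s < 1" using z(2) \<sigma> by (auto simp: norm_mult)
      then show ?thesis using near(1)[of s] s by auto
    next
      case 3
      then obtain s where s: "s \<in> {\<sigma>..1}" "z = of_real s * cis b" using rad B_def by blast
      then have "s < 1" using z(2) \<sigma> by (auto simp: norm_mult)
      then show ?thesis using near(2)[of s] s by auto
    next
      case 2
      then have "G z \<in> closed_segment (G A) (G B)" using gm by blast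
      moreover have "closed_segment (G A) (G B) \<subseteq> {w. w \<bullet> n \<le> max (Wa \<bullet> n) (Wb \<bullet> n) + e}"
      proof (rule closed_segment_subset)
        show "convex {w. w \<bullet> n \<le> max (Wa \<bullet> n) (Wb \<bullet> n) + e}"
          using convex_halfspace_le[of n] by (simp add: inner_commute)
      qed (use near[of \<sigma>] \<sigma> in \<open>auto simp: A_def B_def\<close>)
      ultimately show ?thesis by blast
    qed
  qed
qed

text \<open>The preimages of the chords from \<open>W a\<close> to \<open>W c\<close> and from
  \<open>W b\<close> to \<open>W d\<close> meet inside the disc. At the common point the height in
  direction \<open>n\<close> is at most the larger value on the first chord and at least the smaller
  value on the second, up to \<open>e\<close>.\<close>

lemma radial_limits_not_interlaced:
  fixes G :: "complex \<Rightarrow> complex"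
  assumes cont: "continuous_on (ball 0 1) G" and inj: "inj_on G (ball 0 1)"
    and conv: "convex (G ` ball 0 1)"
    and ang: "a < b" "b < c" "c < d" "d < a + 2*pi"
    and lim: "\<And>t. t \<in> {a,b,c,d} \<Longrightarrow> ((\<lambda>s. G (of_real s * cis t)) \<longlongrightarrow> W t) (at_left 1)"
    and n: "norm n = 1"
  shows "min (W b \<bullet> n) (W d \<bullet> n) \<le> max (W a \<bullet> n) (W c \<bullet> n)"
proof (rule field_le_epsilon)
  fix e :: real assume "0 < e"
  then have e: "0 < e/2" by simp
  obtain \<gamma> where \<gamma>: "path \<gamma>" "pathstart \<gamma> = cis a" "pathfinish \<gamma> = cis c" "path_image \<gamma> \<subseteq> ball 0 1 \<union> {cis a, cis c}"
    "\<And>z n. z \<in> path_image \<gamma> \<Longrightarrow> z \<in> ball 0 1 \<Longrightarrow> norm n = 1 \<Longrightarrow> G z \<bullet> n \<le> max (W a \<bullet> n) (W c \<bullet> n) + e/2"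
    using chord_preimage_path[OF cont inj conv e lim lim, of a c] by auto
  obtain \<delta> where \<delta>: "path \<delta>" "pathstart \<delta> = cis b" "pathfinish \<delta> = cis d" "path_image \<delta> \<subseteq> ball 0 1 \<union> {cis b, cis d}"
    "\<And>z n. z \<in> path_image \<delta> \<Longrightarrow> z \<in> ball 0 1 \<Longrightarrow> norm n = 1 \<Longrightarrow> G z \<bullet> n \<le> max (W b \<bullet> n) (W d \<bullet> n) + e/2"
    using chord_preimage_path[OF cont inj conv e lim lim, of b d] by auto
  obtain z where z: "z \<in> ball 0 1" "z \<in> path_image \<gamma>" "z \<in> path_image \<delta>"
    using disc_chords_meet[OF ang \<gamma>(1-4) \<delta>(1-4)] by blast
  have "G z \<bullet> n \<le> max (W a \<bullet> n) (W c \<bullet> n) + e/2" using \<gamma>(5) z n by blast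
  \<comment> \<open>Reversing the direction turns the upper bound along the second path into a lower
    bound.\<close>
  moreover have "G z \<bullet> (- n) \<le> max (W b \<bullet> (- n)) (W d \<bullet> (- n)) + e/2" using \<delta>(5)[of z "- n"] z n by simp
  ultimately show "min (W b \<bullet> n) (W d \<bullet> n) \<le> max (W a \<bullet> n) (W c \<bullet> n) + e"
    by (auto simp: min_def max_def split: if_splits)
qed

section \<open>Convex polygons\<close>

text \<open>Weak convex position of a closed N-gon: within one period, no line strictly separates
  two diagonals with interlaced ends. The non-strict inequality allows repeated and collinear
  vertices, which limits may produce.\<close>

definition crossing :: "nat \<Rightarrow> (nat \<Rightarrow> complex) \<Rightarrow> bool" where
  "crossing N x \<longleftrightarrow> (\<forall>\<psi> a b c d. a < b \<longrightarrow> b < c \<longrightarrow> c < d \<longrightarrow> d < a + N \<longrightarrow>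
     min (x b \<bullet> cis \<psi>) (x d \<bullet> cis \<psi>) \<le> max (x a \<bullet> cis \<psi>) (x c \<bullet> cis \<psi>))"

lemma periodic_ex_index:
  fixes y :: "nat \<Rightarrow> 'a" and k :: nat
  assumes per: "\<And>j. y (j + N) = y j" and "0 < N"
  shows "\<exists>j. k \<le> j \<and> j < k + N \<and> y j = y i"
proof -
  have per': "y (j + m * N) = y j" for j m
  proof (induction m)
    case (Suc m)
    have "j + Suc m * N = (j + m * N) + N" by simp
    then show ?case using per Suc.IH by metis
  qed simp
  have 1: "y i = y (i mod N)" for i using per'[of "i mod N" "i div N"] by simp
  \<comment> \<open>Modulo N, the summand \<open>k * (N - 1)\<close> is -k written without
    subtraction, so \<open>j\<close> is congruent to \<open>i\<close>.\<close>
  define j where "j = k + (i + k * (N - 1)) mod N"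
  have "j mod N = (k + (i + k * (N - 1))) mod N" unfolding j_def by (simp add: mod_add_right_eq)
  also have "k + (i + k * (N - 1)) = i + k * N" using \<open>0 < N\<close> by (cases N) (auto simp: algebra_simps)
  also have "\<dots> mod N = i mod N" by simp
  finally have "y j = y i" using 1 by metis
  then show ?thesis using \<open>0 < N\<close> unfolding j_def by (intro exI[of _ j]) (auto simp: j_def)
qed

text \<open>With \<open>p\<close> a minimum and \<open>q\<close> a maximum, a descent between \<open>p\<close> and \<open>q\<close> (or an ascent between
  \<open>q\<close> and \<open>p\<close>) would separate two diagonals.\<close>

lemma crossing_unimodal:
  assumes per: "\<And>j. x (j + N) = x j" and N: "0 < N" and cr: "crossing N x"
  obtains p q where "p \<le> q" "q \<le> p + N" "p < N"
    "\<And>j. p \<le> j \<Longrightarrow> j < q \<Longrightarrow> x j \<bullet> cis \<psi> \<le> x (Suc j) \<bullet> cis \<psi>"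
    "\<And>j. q \<le> j \<Longrightarrow> j < p + N \<Longrightarrow> x (Suc j) \<bullet> cis \<psi> \<le> x j \<bullet> cis \<psi>"
proof -
  define y where "y = (\<lambda>j. x j \<bullet> cis \<psi>)"
  have pery: "y (j + N) = y j" for j by (simp add: y_def per)
  have cross: "min (y b) (y d) \<le> max (y a) (y c)" if "a < b" "b < c" "c < d" "d < a + N" for a b c d
    using cr that unfolding crossing_def y_def by blast
  have ne: "y ` {..<N} \<noteq> {}" "finite (y ` {..<N})" using N by auto
  obtain p where p: "p < N" "\<And>j. j < N \<Longrightarrow> y p \<le> y j"
    using Min_in[OF ne(2,1)] Min_le[OF ne(2)] by (metis (no_types, lifting) imageE imageI lessThan_iff)
  obtain q0 where q0: "q0 < N" "\<And>j. j < N \<Longrightarrow> y j \<le> y q0"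
    using Max_in[OF ne(2,1)] Max_ge[OF ne(2)] by (metis (no_types, lifting) imageE imageI lessThan_iff)
  have pmin: "y p \<le> y i" for i using periodic_ex_index[of y N 0 i] pery N p(2) by force
  have qmax: "y i \<le> y q0" for i using periodic_ex_index[of y N 0 i] pery N q0(2) by force
  obtain q where q: "p \<le> q" "q < p + N" "y q = y q0"
    using periodic_ex_index[of y N p q0] pery N by blast
  have qmax: "y i \<le> y q" for i using qmax q by simp
  show thesis
  proof (rule that[of p q])
    fix j assume j: "p \<le> j" "j < q"
    show "x j \<bullet> cis \<psi> \<le> x (Suc j) \<bullet> cis \<psi>"
    proof (rule ccontr)
      assume "\<not> ?thesis"
      then have lt: "y (Suc j) < y j" by (simp add: y_def)
      then have "p \<noteq> j" "q \<noteq> Suc j" using pmin[of "Suc j"] qmax[of j] by auto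
      then have "p < j" "Suc j < q" using j by auto
      then have "min (y j) (y q) \<le> max (y p) (y (Suc j))" using q by (intro cross) auto
      then show False using lt qmax[of j] pmin[of "Suc j"] by (auto simp: min_def max_def split: if_splits)
    qed
  next
    fix j assume j: "q \<le> j" "j < p + N"
    show "x (Suc j) \<bullet> cis \<psi> \<le> x j \<bullet> cis \<psi>"
    proof (rule ccontr)
      assume "\<not> ?thesis"
      then have lt: "y j < y (Suc j)" by (simp add: y_def)
      have "Suc j \<noteq> p + N" using lt pmin[of j] pery[of p] by auto
      moreover have "q \<noteq> j" using lt qmax[of "Suc j"] by auto
      ultimately have lt2: "q < j" "Suc j < p + N" using j by auto
      show False
      \<comment> \<open>The crossing condition needs distinct indices; if they coincide, minimum and
        maximum agree and all heights are equal.\<close>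
      proof (cases "p = q")
        case True
        then have "y i = y p" for i using pmin qmax by (metis antisym)
        then show False using lt by (metis less_irrefl)
      next
        case False
        then have "min (y q) (y (Suc j)) \<le> max (y p) (y j)" using q lt2 by (intro cross) auto
        then show False using lt qmax[of "Suc j"] pmin[of j] by (auto simp: min_def max_def split: if_splits)
      qed
    qed
  qed (use p q in auto)
qed

lemma cos_sum_to_product: "2 * (sin (a::real) * sin b) = cos (a - b) - cos (a + b)"
  by (simp add: cos_add cos_diff)

text \<open>Directions are split according to the sign of \<open>B\<close>. Reversing a direction changes that sign,
  so by connectedness some direction admits both signs, and then a convex combination has \<open>B = 0\<close>.\<close>

lemma crossing_balanced_direction:
  fixes \<tau> :: real
  assumes per: "\<And>j. x (j + N) = x j" and N: "0 < N" and cr: "crossing N x"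
  obtains \<psi> A where "A \<noteq> 0"
    "\<And>j. ((x (Suc j) - x j) \<bullet> cis \<psi>) * (A \<bullet> cis (\<tau> + (real j + 1/2) * (2*pi/N))) \<ge> 0"
proof -
  \<comment> \<open>Angles halfway between consecutive vertices: the increment from vertex j to
    vertex j+1 is attached to its midpoint.\<close>
  define t where "t = (\<lambda>j::nat. \<tau> + (real j + 1/2) * (2*pi/N))"
  note finish = that
  define v where "v = (\<lambda>\<psi> j. (x (Suc j) - x j) \<bullet> cis \<psi>)"
  have perv: "v \<psi> (j + N) = v \<psi> j" for \<psi> j using per[of j] per[of "Suc j"] by (simp add: v_def)
  have pert: "A \<bullet> cis (t (j + N)) = A \<bullet> cis (t j)" for A j
  proof -
    have "t (j + N) = t j + 2 * pi" using N by (simp add: t_def field_simps)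
    then show ?thesis by (simp add: cis.ctr)
  qed
  \<comment> \<open>The line \<open>A \<bullet> z = B\<close> meets the unit circle at the angles
    belonging to the indices p and q. The affine function \<open>A \<bullet> z - B\<close> is
    therefore nonnegative on the arc from p to q and nonpositive on the rest, like the increments
    when p is a lowest and q a highest vertex.\<close>
  define A where "A = (\<lambda>(p,q). cis (\<tau> + (real p + real q) * (pi/N)))"
  define B where "B = (\<lambda>(p::nat,q::nat). cos ((real q - real p) * (pi/N)))"
  \<comment> \<open>The sign \<sigma> records a reversal of the direction, under which
    \<open>v\<close> changes sign and \<open>A\<close>, \<open>B\<close> stay.\<close>
  define S where "S = (\<lambda>(\<sigma>,k) . {\<psi>. \<forall>j<N. \<sigma> * v \<psi> j * (A k \<bullet> cis (t j) - B k) \<ge> 0})"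
  \<comment> \<open>\<open>crossing_unimodal\<close> gives p < N and q \<le> p + N, so finitely many
    pairs suffice and finite unions of the closed sets \<open>S k\<close> stay closed.\<close>
  define I where "I = {..<N} \<times> {..<2*N}"
  have v_pi: "v (\<psi> + pi) j = - v \<psi> j" for \<psi> j by (simp add: v_def inner_complex_def)
  have prodform: "A (p,q) \<bullet> cis (t j) - B (p,q) =
      2 * (sin ((real j + 1/2 - real p) * (pi/N)) * sin ((real q - (real j + 1/2)) * (pi/N)))" for p q j
  proof -
    define a where "a = (real j + 1/2 - real p) * (pi/N)"
    define b where "b = (real q - (real j + 1/2)) * (pi/N)"
    have "A (p,q) \<bullet> cis (t j) = cos (t j - (\<tau> + (real p + real q) * (pi/N)))"
      by (simp add: A_def inner_complex_def cos_diff)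
    also have "t j - (\<tau> + (real p + real q) * (pi/N)) = a - b"
      using N unfolding t_def a_def b_def by (simp add: field_simps)
    finally have 1: "A (p,q) \<bullet> cis (t j) = cos (a - b)" .
    have "(real q - real p) * (pi/N) = a + b" by (simp add: a_def b_def algebra_simps)
    then have "B (p,q) = cos (a + b)" by (simp add: B_def)
    with 1 show ?thesis unfolding a_def[symmetric] b_def[symmetric] by (simp only: cos_sum_to_product)
  qed
  \<comment> \<open>The affine function does not vanish at midpoints: otherwise an odd integer would
    be a multiple of 2 N.\<close>
  have nz: "sin ((real j + 1/2 - real p) * (pi/N)) \<noteq> 0" for j p
  proof
    assume "sin ((real j + 1/2 - real p) * (pi/N)) = 0"
    then obtain i :: int where "(real j + 1/2 - real p) * (pi/N) = of_int i * pi" by (auto simp: sin_zero_iff_int2)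
    then have "(real j + 1/2 - real p) / N * pi = of_int i * pi" by simp
    then have "(real j + 1/2 - real p) / N = of_int i" by (subst (asm) mult_cancel_right) auto
    then have "real_of_int (2 * int j + 1 - 2 * int p) = real_of_int (2 * int N * i)"
      using N by (simp add: field_simps)
    then have "2 * int j + 1 - 2 * int p = 2 * int N * i" by (simp only: of_int_eq_iff)
    then have "even (2 * int j + 1 - 2 * int p)" by simp
    then show False by simp
  qed
  have nzAB: "A k \<bullet> cis (t j) - B k \<noteq> 0" for k j
  proof -
    obtain p q where k: "k = (p,q)" by (cases k)
    have "sin ((real q - (real j + 1/2)) * (pi/N)) = - sin ((real j + 1/2 - real q) * (pi/N))"
      by (subst sin_minus[symmetric]) (simp add: algebra_simps)
    then show ?thesis unfolding k prodform using nz by simp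
  qed
  have closedS: "closed (S k)" for k
  proof -
    obtain \<sigma> l where k: "k = (\<sigma>, l)" by (cases k)
    have "S k = (\<Inter>j\<in>{..<N}. {\<psi>. \<sigma> * v \<psi> j * (A l \<bullet> cis (t j) - B l) \<ge> 0})"
      by (auto simp: S_def k)
    also have "closed \<dots>"
      unfolding v_def cis_conv_exp by (intro closed_INT ballI closed_Collect_le continuous_intros)
    finally show ?thesis .
  qed
  have base: "\<exists>k\<in>I. \<psi> \<in> S (1, k)" for \<psi>
  proof -
    obtain p q where pq: "p \<le> q" "q \<le> p + N" "p < N"
      and up: "\<And>j. p \<le> j \<Longrightarrow> j < q \<Longrightarrow> v \<psi> j \<ge> 0"
      and dn: "\<And>j. q \<le> j \<Longrightarrow> j < p + N \<Longrightarrow> v \<psi> j \<le> 0"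
      using crossing_unimodal[OF per N cr, of \<psi>] by (auto simp: v_def inner_diff_left)
    have main: "v \<psi> j * (A (p,q) \<bullet> cis (t j) - B (p,q)) \<ge> 0" if j: "p \<le> j" "j < p + N" for j
    proof -
      define a where "a = (real j + 1/2 - real p) * (pi/N)"
      define b where "b = (real q - (real j + 1/2)) * (pi/N)"
      have eq: "A (p,q) \<bullet> cis (t j) - B (p,q) = 2 * (sin a * sin b)"
        unfolding a_def b_def by (rule prodform)
      have scale: "0 \<le> c * (pi/N)" "c * (pi/N) \<le> pi" if "0 \<le> c" "c \<le> real N" for c
        using that N by (auto simp: field_simps)
      have a: "0 \<le> a" "a \<le> pi" unfolding a_def using j by (intro scale; linarith)+
      show ?thesis
      proof (cases "j < q")
        case True
        then have "0 \<le> b" "b \<le> pi" unfolding b_def using j pq by (intro scale; linarith)+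
        then show ?thesis unfolding eq using up[OF j(1) True] a by (simp add: sin_ge_zero)
      next
        case False
        have "- b = (real j + 1/2 - real q) * (pi/N)" by (simp add: b_def algebra_simps)
        moreover have "0 \<le> (real j + 1/2 - real q) * (pi/N)" "(real j + 1/2 - real q) * (pi/N) \<le> pi"
          using j pq False by (intro scale; linarith)+
        ultimately have "0 \<le> sin (- b)" by (simp add: sin_ge_zero)
        then have "sin a * sin b \<le> 0" using a by (simp add: mult_nonneg_nonpos sin_ge_zero)
        then show ?thesis unfolding eq using dn[of j] False j by (simp add: mult_nonpos_nonpos)
      qed
    qed
    have "v \<psi> j * (A (p,q) \<bullet> cis (t j) - B (p,q)) \<ge> 0" for j
    proof -
      let ?y = "\<lambda>j. v \<psi> j * (A (p,q) \<bullet> cis (t j) - B (p,q))"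
      have "?y (j + N) = ?y j" for j by (simp add: perv pert)
      then obtain i where "p \<le> i" "i < p + N" "?y i = ?y j"
        using periodic_ex_index[of ?y N p j] N by blast
      with main[of i] show ?thesis by simp
    qed
    then show ?thesis using pq by (intro bexI[of _ "(p,q)"]) (auto simp: S_def I_def)
  qed
  define Sp where "Sp = (\<Union>k\<in>{(\<sigma>,k). \<sigma> \<in> {-1,1} \<and> k \<in> I \<and> \<sigma> * B k \<ge> 0}. S k)"
  define Sm where "Sm = (\<Union>k\<in>{(\<sigma>,k). \<sigma> \<in> {-1,1} \<and> k \<in> I \<and> \<sigma> * B k \<le> 0}. S k)"
  have finI: "finite ({-1,1::real} \<times> I)" by (simp add: I_def)
  have cl: "closed Sp" "closed Sm"
    unfolding Sp_def Sm_def by (intro closed_UN closedS ballI finite_subset[OF _ finI]; auto)+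
  have SpI: "\<psi> \<in> Sp" if "\<sigma> = 1 \<or> \<sigma> = - 1" "k \<in> I" "0 \<le> \<sigma> * B k" "\<psi> \<in> S (\<sigma>, k)" for \<psi> \<sigma> k
    unfolding Sp_def by (rule UN_I[of "(\<sigma>, k)"]) (use that in auto)
  have SmI: "\<psi> \<in> Sm" if "\<sigma> = 1 \<or> \<sigma> = - 1" "k \<in> I" "\<sigma> * B k \<le> 0" "\<psi> \<in> S (\<sigma>, k)" for \<psi> \<sigma> k
    unfolding Sm_def by (rule UN_I[of "(\<sigma>, k)"]) (use that in auto)
  have cover: "\<psi> \<in> Sp \<union> Sm" for \<psi>
  proof -
    obtain k where "k \<in> I" "\<psi> \<in> S (1,k)" using base by blast
    then show ?thesis using SpI[of 1 k \<psi>] SmI[of 1 k \<psi>] by (cases "B k \<ge> 0") auto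
  qed
  have swap: "\<psi> + pi \<in> S (-\<sigma>, k)" if "\<psi> \<in> S (\<sigma>, k)" for \<psi> \<sigma> k
    using that by (simp add: S_def v_pi)
  have swap1: "\<psi> + pi \<in> Sm" if "\<psi> \<in> Sp" for \<psi>
  proof -
    from that obtain \<sigma> k where *: "\<sigma> = 1 \<or> \<sigma> = - 1" "k \<in> I" "0 \<le> \<sigma> * B k" "\<psi> \<in> S (\<sigma>, k)"
      unfolding Sp_def by auto
    then show ?thesis by (intro SmI[of "-\<sigma>" k] swap) auto
  qed
  have swap2: "\<psi> + pi \<in> Sp" if "\<psi> \<in> Sm" for \<psi>
  proof -
    from that obtain \<sigma> k where *: "\<sigma> = 1 \<or> \<sigma> = - 1" "k \<in> I" "\<sigma> * B k \<le> 0" "\<psi> \<in> S (\<sigma>, k)"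
      unfolding Sm_def by auto
    then show ?thesis by (intro SpI[of "-\<sigma>" k] swap) auto
  qed
  have ne: "Sp \<noteq> {}" "Sm \<noteq> {}" using cover[of 0] swap1 swap2 by blast+
  have "Sp \<inter> Sm \<noteq> {}"
  proof
    assume "Sp \<inter> Sm = {}"
    moreover have "UNIV \<subseteq> Sp \<union> Sm" using cover by blast
    ultimately have "\<not> connected (UNIV :: real set)"
      unfolding connected_closed using cl ne by (metis Int_UNIV_right)
    then show False using connected_UNIV by blast
  qed
  then obtain \<psi> where "\<psi> \<in> Sp" "\<psi> \<in> Sm" by blast
  obtain \<sigma> k where k1: "\<sigma> \<in> {-1,1}" "\<sigma> * B k \<ge> 0" and S1: "\<psi> \<in> S (\<sigma>, k)"
    using \<open>\<psi> \<in> Sp\<close> unfolding Sp_def by blast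
  obtain \<sigma>' k' where k2: "\<sigma>' \<in> {-1,1}" "\<sigma>' * B k' \<le> 0" and S2: "\<psi> \<in> S (\<sigma>', k')"
    using \<open>\<psi> \<in> Sm\<close> unfolding Sm_def by blast
  note k = k1(1) k2(1) k1(2) k2(2) and S = S1 S2
  define a where "a = \<sigma> *\<^sub>R A k"
  define a' where "a' = \<sigma>' *\<^sub>R A k'"
  define \<beta> where "\<beta> = \<sigma> * B k"
  define \<beta>' where "\<beta>' = - \<sigma>' * B k'"
  have \<beta>: "0 \<le> \<beta>" "0 \<le> \<beta>'" using k by (auto simp: \<beta>_def \<beta>'_def)
  have n: "a \<noteq> 0" "a' \<noteq> 0" using k by (auto simp: a_def a'_def A_def split: prod.splits)
  have 1: "v \<psi> j * (a \<bullet> cis (t j) - \<beta>) \<ge> 0" "v \<psi> j * (a' \<bullet> cis (t j) + \<beta>') \<ge> 0" if "j < N" for j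
    using S that by (auto simp: S_def a_def a'_def \<beta>_def \<beta>'_def algebra_simps)
  have conc: thesis if "c \<noteq> 0" "\<And>j. j < N \<Longrightarrow> v \<psi>' j * (c \<bullet> cis (t j)) \<ge> 0" for \<psi>' c
  proof (rule finish[OF \<open>c \<noteq> 0\<close>, of \<psi>'])
    fix j
    let ?y = "\<lambda>j. v \<psi>' j * (c \<bullet> cis (t j))"
    have "?y (j + N) = ?y j" for j by (simp add: perv pert)
    then obtain i where "i < N" "?y i = ?y j"
      using periodic_ex_index[of ?y N 0 j] N by auto
    with \<open>\<And>j. j < N \<Longrightarrow> v \<psi>' j * (c \<bullet> cis (t j)) \<ge> 0\<close>[of i]
    show "((x (Suc j) - x j) \<bullet> cis \<psi>') * (c \<bullet> cis (\<tau> + (real j + 1/2) * (2*pi/N))) \<ge> 0" by (simp add: v_def t_def)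
  qed
  show thesis
  proof (cases "\<beta> = 0 \<or> \<beta>' = 0")
    case True
    then show thesis using 1 n conc[of a \<psi>] conc[of a' \<psi>] by auto
  next
    case False
    \<comment> \<open>The weights are chosen so that the constants \<beta> and \<beta>'
      cancel.\<close>
    define c where "c = \<beta>' *\<^sub>R a + \<beta> *\<^sub>R a'"
    have c: "v \<psi> j * (c \<bullet> cis (t j)) \<ge> 0" if "j < N" for j
    proof -
      have "0 \<le> \<beta>' * (v \<psi> j * (a \<bullet> cis (t j) - \<beta>)) + \<beta> * (v \<psi> j * (a' \<bullet> cis (t j) + \<beta>'))"
        using 1[OF that] \<beta> by simp
      also have "\<dots> = v \<psi> j * (c \<bullet> cis (t j))" by (simp add: c_def algebra_simps inner_add_left)
      finally show ?thesis .
    qed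
    show thesis
    proof (cases "c = 0")
      case False then show thesis using c conc by blast
    next
      \<comment> \<open>If the combination degenerates, the two affine functions are opposite, so
        both inequalities together force every increment to vanish; then any nonzero vector, here 1,
        does the job.\<close>
      case True
      have na: "norm a = 1" "norm a' = 1" using k by (auto simp: a_def a'_def A_def split: prod.splits)
      have eq: "\<beta>' *\<^sub>R a = - (\<beta> *\<^sub>R a')" using True by (simp add: c_def add_eq_0_iff2)
      have "norm (\<beta>' *\<^sub>R a) = norm (\<beta> *\<^sub>R a')" unfolding eq by simp
      then have "\<beta>' = \<beta>" using na \<beta> by simp
      then have "\<beta> *\<^sub>R (a + a') = 0" using True by (simp add: c_def scaleR_add_right)
      then have "a' = - a" using False by (simp add: add_eq_0_iff2)
      have "v \<psi> j = 0" if "j < N" for j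
      proof -
        have "v \<psi> j * (a \<bullet> cis (t j) - \<beta>) = 0"
          using 1[OF that] \<open>a' = - a\<close> \<open>\<beta>' = \<beta>\<close> by (simp add: algebra_simps)
        moreover have "a \<bullet> cis (t j) - \<beta> = \<sigma> * (A k \<bullet> cis (t j) - B k)"
          by (simp add: a_def \<beta>_def algebra_simps)
        ultimately show ?thesis using nzAB[of k j] k(1) by auto
      qed
      then show thesis using conc[of 1 \<psi>] by simp
    qed
  qed
qed


text \<open>Let \<open>S n\<close> be the Fourier sums of the increments. Weighting the increments
  by \<open>A \<bullet> cis (t j)\<close> gives nonnegative masses of total
  \<open>Re (A * S 1)\<close>, whose coefficient of index n+1 is
  \<open>(A * S (n + 2) + cnj A * S n) / 2\<close>. A coefficient is at most the total mass, hence
  |S (n+2)| \<le> |S n| + 2 |S 1|, and so |S n| \<le> n |S 1|. Summation by parts turns this into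
  the claim for the vertices; as \<open>N * \<bar>sin (n * pi / N)\<bar>\<close> tends to n pi, the
  factor n on the right will cancel in the limit.\<close>

lemma crossing_coefficient_bound:
  fixes \<tau> :: real
  assumes per: "\<And>j. x (j + N) = x j" and N: "0 < N" and cr: "crossing N x"
  obtains \<psi> where "\<And>n::nat. N * \<bar>sin (n * pi / N)\<bar> * cmod ((\<Sum>j<N. (x j \<bullet> cis \<psi>) *\<^sub>R cis (- (real n * (\<tau> + real j * (2*pi/N))))) / N)
     \<le> n * (N * \<bar>sin (pi / N)\<bar> * cmod ((\<Sum>j<N. (x j \<bullet> cis \<psi>) *\<^sub>R cis (- (\<tau> + real j * (2*pi/N)))) / N))"
proof -
  define t where "t = (\<lambda>j::nat. \<tau> + (real j + 1/2) * (2*pi/N))"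
  define \<theta> where "\<theta> = (\<lambda>j::nat. \<tau> + real j * (2*pi/N))"
  obtain \<psi> A where A: "A \<noteq> 0" and
    sgn: "\<And>j. ((x (Suc j) - x j) \<bullet> cis \<psi>) * (A \<bullet> cis (t j)) \<ge> 0"
    using crossing_balanced_direction[OF per N cr, of \<tau>] unfolding t_def by blast
  define y where "y = (\<lambda>j. x j \<bullet> cis \<psi>)"
  define v where "v = (\<lambda>j. y (Suc j) - y j)"
  define S where "S = (\<lambda>n::nat. \<Sum>j<N. v j *\<^sub>R cis (- (real n * t j)))"
  have sgn: "v j * (A \<bullet> cis (t j)) \<ge> 0" for j using sgn[of j] by (simp add: v_def y_def inner_diff_left)
  have y_per: "y (j + N) = y j" for j by (simp add: y_def per)
  \<comment> \<open>Each midpoint is half a step from both neighbouring vertices, so summation by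
    parts produces the symmetric factor 2i sin(n pi/N).\<close>
  have t\<theta>: "t j = \<theta> j + pi / N" "t j = \<theta> (Suc j) - pi / N" for j
    using N by (auto simp: t_def \<theta>_def field_simps)
  have normS: "cmod (S n) = 2 * (N * \<bar>sin (n * pi / N)\<bar> * cmod ((\<Sum>j<N. y j *\<^sub>R cis (- (real n * \<theta> j))) / N))" for n
  proof -
    define g where "g = (\<lambda>j. y j *\<^sub>R cis (- (real n * (\<theta> j - pi / N))))"
    have "\<theta> N = \<theta> 0 + 2 * pi" using N by (simp add: \<theta>_def)
    then have "cis (- (real n * (\<theta> N - pi / N))) = cis (- (real n * (\<theta> 0 - pi / N))) * cis (- (real n * (2*pi)))"
      by (simp add: cis_mult algebra_simps)
    also have "cis (- (real n * (2*pi))) = 1" using cis_multiple_2pi[of "- real n"] by (simp add: mult.commute mult.left_commute)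
    finally have "g N = g 0" using y_per[of 0] by (simp add: g_def)
    then have shift: "(\<Sum>j<N. g (Suc j)) = (\<Sum>j<N. g j)"
      using sum.lessThan_Suc_shift[of g N] by simp
    have "S n = (\<Sum>j<N. g (Suc j)) - (\<Sum>j<N. y j *\<^sub>R cis (- (real n * t j)))"
      unfolding S_def v_def sum_subtractf[symmetric] g_def t\<theta>(2)
      by (intro sum.cong refl) (simp add: scaleR_diff_left)
    also have "\<dots> = (\<Sum>j<N. g j) - (\<Sum>j<N. y j *\<^sub>R cis (- (real n * t j)))" by (simp only: shift)
    also have "\<dots> = (\<Sum>j<N. y j *\<^sub>R cis (- (real n * \<theta> j)) * (cis (real n * pi / N) - cis (- (real n * pi / N))))"
      unfolding sum_subtractf[symmetric] g_def t\<theta>(1)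
      by (intro sum.cong refl) (simp add: cis_mult algebra_simps)
    also have "\<dots> = (\<Sum>j<N. y j *\<^sub>R cis (- (real n * \<theta> j))) * (cis (real n * pi / N) - cis (- (real n * pi / N)))"
      by (simp add: sum_distrib_right)
    also have "cis (real n * pi / N) - cis (- (real n * pi / N)) = 2 * \<i> * of_real (sin (real n * pi / N))"
      by (simp add: complex_eq_iff)
    finally show ?thesis using N by (simp add: norm_mult norm_divide)
  qed
  have "S 0 = of_real (y N - y 0)"
    unfolding S_def v_def sum_lessThan_telescope[symmetric] by (simp add: scaleR_conv_of_real)
  then have S0: "S 0 = 0" using y_per[of 0] by simp
  have rec: "cmod (S (n + 2)) \<le> cmod (S n) + 2 * cmod (S 1)" for n
  proof -
    have \<rho>: "of_real (A \<bullet> cis u) = (A * cis (- u) + cnj A * cis u) / 2" for u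
      by (simp add: complex_eq_iff inner_complex_def)
    have sumeq: "(\<Sum>j<N. (v j * (A \<bullet> cis (t j))) *\<^sub>R cis (- (real (n + 1) * t j))) = (A * S (n + 2) + cnj A * S n) / 2"
    proof -
      have "(v j * (A \<bullet> cis (t j))) *\<^sub>R cis (- (real (n + 1) * t j))
          = (A * (v j *\<^sub>R cis (- (real (n + 2) * t j))) + cnj A * (v j *\<^sub>R cis (- (real n * t j)))) / 2" for j
      proof -
        have "(v j * (A \<bullet> cis (t j))) *\<^sub>R cis (- (real (n + 1) * t j))
          = of_real (v j) * of_real (A \<bullet> cis (t j)) * cis (- (real (n + 1) * t j))"
          by (simp add: scaleR_conv_of_real)
        also have "\<dots> = of_real (v j) * (A * (cis (- t j) * cis (- (real (n + 1) * t j))) + cnj A * (cis (t j) * cis (- (real (n + 1) * t j)))) / 2"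
          unfolding \<rho> by (simp add: algebra_simps)
        also have "cis (- t j) * cis (- (real (n + 1) * t j)) = cis (- (real (n + 2) * t j))"
          unfolding cis_mult by (rule arg_cong[of _ _ cis]) (simp add: algebra_simps)
        also have "cis (t j) * cis (- (real (n + 1) * t j)) = cis (- (real n * t j))"
          unfolding cis_mult by (rule arg_cong[of _ _ cis]) (simp add: algebra_simps)
        finally show ?thesis by (simp add: scaleR_conv_of_real algebra_simps)
      qed
      then have "(\<Sum>j<N. (v j * (A \<bullet> cis (t j))) *\<^sub>R cis (- (real (n + 1) * t j)))
          = (\<Sum>j<N. (A * (v j *\<^sub>R cis (- (real (n + 2) * t j))) + cnj A * (v j *\<^sub>R cis (- (real n * t j)))) / 2)"
        by (rule sum.cong[OF refl])
      also have "\<dots> = (A * S (n + 2) + cnj A * S n) / 2"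
        unfolding S_def sum_distrib_left sum.distrib[symmetric] sum_divide_distrib by simp
      finally show ?thesis .
    qed
    moreover have "cmod (\<Sum>j<N. (v j * (A \<bullet> cis (t j))) *\<^sub>R cis (- (real (n + 1) * t j))) \<le> (\<Sum>j<N. v j * (A \<bullet> cis (t j)))"
      using sgn by (intro sum_norm_le) simp
    moreover have "(\<Sum>j<N. v j * (A \<bullet> cis (t j))) = Re (A * S 1)"
      unfolding S_def by (simp add: sum_distrib_left inner_complex_def algebra_simps sum_subtractf sum.distrib)
    moreover have "Re (A * S 1) \<le> cmod A * cmod (S 1)" using complex_Re_le_cmod[of "A * S 1"] by (simp add: norm_mult)
    ultimately have "cmod (\<Sum>j<N. (v j * (A \<bullet> cis (t j))) *\<^sub>R cis (- (real (n + 1) * t j))) \<le> cmod A * cmod (S 1)"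
      by linarith
    then have "cmod (A * S (n + 2) + cnj A * S n) \<le> 2 * (cmod A * cmod (S 1))"
      unfolding sumeq by (simp add: norm_divide)
    moreover have "cmod A * cmod (S (n+2)) \<le> cmod (A * S (n + 2) + cnj A * S n) + cmod A * cmod (S n)"
      using norm_triangle_ineq4[of "A * S (n + 2) + cnj A * S n" "cnj A * S n"] by (simp add: norm_mult)
    ultimately have "cmod A * cmod (S (n+2)) \<le> cmod A * (cmod (S n) + 2 * cmod (S 1))" by (simp add: algebra_simps)
    then show ?thesis using A by (simp add: mult_le_cancel_left)
  qed
  have "cmod (S n) \<le> n * cmod (S 1)" for n
  \<comment> \<open>The recursion has step two: even indices start from \<open>S 0 = 0\<close>,
    which says that the polygon is closed, and odd ones from \<open>S 1\<close>.\<close>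
  proof (induction n rule: nat_induct2)
    case (step n)
    then show ?case using rec[of n] by (simp add: algebra_simps)
  qed (auto simp: S0)
  then have le: "cmod (S n) \<le> n * cmod (S 1)" for n by blast
  define P where "P = (\<lambda>n::nat. N * \<bar>sin (n * pi / N)\<bar> * cmod ((\<Sum>j<N. y j *\<^sub>R cis (- (real n * \<theta> j))) / N))"
  have "P n \<le> n * P 1" for n using le[of n] unfolding normS P_def by simp
  then show thesis
    by (intro that[of \<psi>]) (simp add: P_def y_def \<theta>_def)
qed

section \<open>Taylor coefficients as limits of circle means\<close>

definition taylor :: "(complex \<Rightarrow> complex) \<Rightarrow> nat \<Rightarrow> complex" where
  "taylor f n = (deriv ^^ n) f 0 / fact n"

lemma taylor_sums:
  assumes "f holomorphic_on ball 0 r" "z \<in> ball 0 r"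
  shows "(\<lambda>n. taylor f n * z ^ n) sums f z"
  using holomorphic_power_series[OF assms] by (simp add: taylor_def)

definition circle_mean :: "nat \<Rightarrow> real \<Rightarrow> (real \<Rightarrow> complex) \<Rightarrow> complex" where
  "circle_mean N \<tau> F = (\<Sum>j<N. F (\<tau> + real j * (2*pi/N))) / N"

lemma circle_mean_add: "circle_mean N \<tau> (\<lambda>\<theta>. F \<theta> + G \<theta>) = circle_mean N \<tau> F + circle_mean N \<tau> G"
  by (simp add: circle_mean_def sum.distrib add_divide_distrib)

lemma circle_mean_cmult: "circle_mean N \<tau> (\<lambda>\<theta>. c * F \<theta>) = c * circle_mean N \<tau> F"
  by (simp add: circle_mean_def sum_distrib_left)

lemma circle_mean_cnj: "circle_mean N \<tau> (\<lambda>\<theta>. cnj (F \<theta>)) = cnj (circle_mean N \<tau> F)"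
  by (simp add: circle_mean_def)

lemma circle_mean_sum: "circle_mean N \<tau> (\<lambda>\<theta>. \<Sum>i\<in>I. F i \<theta>) = (\<Sum>i\<in>I. circle_mean N \<tau> (F i))"
  unfolding circle_mean_def by (subst sum.swap) (simp add: sum_divide_distrib)

lemma norm_circle_mean_le:
  assumes "\<And>j. j < N \<Longrightarrow> cmod (F (\<tau> + real j * (2*pi/N))) \<le> g (\<tau> + real j * (2*pi/N))"
  shows "cmod (circle_mean N \<tau> F) \<le> (\<Sum>j<N. g (\<tau> + real j * (2*pi/N))) / N"
  unfolding circle_mean_def norm_divide using assms
  by (auto intro!: divide_right_mono sum_norm_le)

lemma circle_mean_bound:
  assumes "\<And>\<theta>. cmod (F \<theta>) \<le> c" "0 \<le> c"
  shows "cmod (circle_mean N \<tau> F) \<le> c"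
proof -
  have "cmod (circle_mean N \<tau> F) \<le> (\<Sum>j<N. c) / N" by (rule norm_circle_mean_le) (rule assms)
  also have "\<dots> \<le> c" using assms(2) by (cases "N = 0") auto
  finally show ?thesis .
qed

lemma circle_mean_cis:
  assumes "\<bar>k\<bar> < int N"
  shows "circle_mean N \<tau> (\<lambda>\<theta>. cis (of_int k * \<theta>)) = (if k = 0 then 1 else 0)"
proof (cases "k = 0")
  case False
  define q where "q = cis (of_int k * (2*pi/N))"
  have N: "N > 0" using assms by auto
  have "q ^ N = cis (real N * (of_int k * (2*pi/N)))" by (simp only: q_def Complex.DeMoivre)
  also have "real N * (of_int k * (2*pi/N)) = 2 * pi * of_int k" using N by simp
  finally have qN: "q ^ N = 1" using cis_multiple_2pi[of "of_int k"] by simp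
  have "q \<noteq> 1"
  proof
    assume "q = 1"
    then have "Re q = 1" by simp
    then have "cos (of_int k * (2*pi/N)) = 1" unfolding q_def cis.simps by simp
    then obtain m :: int where "of_int k * (2*pi/N) = of_int m * 2 * pi" by (auto simp: cos_one_2pi_int)
    then have "real_of_int k = real_of_int (m * int N)" using N by (simp add: field_simps)
    then have "k = m * int N" by (simp only: of_int_eq_iff)
    then have "\<bar>m\<bar> * int N < 1 * int N" using assms by (simp add: abs_mult)
    then have "m = 0" by (subst (asm) mult_less_cancel_right) auto
    with \<open>k = m * int N\<close> False show False by simp
  qed
  have "cis (of_int k * (\<tau> + real j * (2*pi/N))) = cis (of_int k * \<tau>) * q ^ j" for j
    unfolding q_def Complex.DeMoivre cis_mult by (rule arg_cong[of _ _ cis]) (simp add: algebra_simps)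
  then have "circle_mean N \<tau> (\<lambda>\<theta>. cis (of_int k * \<theta>)) = cis (of_int k * \<tau>) * (\<Sum>j<N. q ^ j) / N"
    by (simp add: circle_mean_def sum_distrib_left)
  also have "(\<Sum>j<N. q ^ j) = 0" using geometric_sum[OF \<open>q \<noteq> 1\<close>, of N] qN by simp
  finally show ?thesis using False by simp
qed (use assms in \<open>simp add: circle_mean_def\<close>)

text \<open>Cut the power series at M: the means of the polynomial part are exact for large N, and
  the tail is small on the whole circle. The estimate is uniform in \<tau> because the offset will
  be chosen after N.\<close>

lemma circle_mean_taylor:
  assumes h: "h holomorphic_on ball 0 1" and r: "0 \<le> r" "r < 1" and e: "0 < e"
  shows "\<forall>\<^sub>F N in sequentially. \<forall>\<tau>. cmod (circle_mean N \<tau> (\<lambda>\<theta>. h (of_real r * cis \<theta>) * cis (- (of_int k * \<theta>)))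
           - (if k \<ge> 0 then taylor h (nat k) * of_real r ^ nat k else 0)) < e"
proof -
  define c where "c = taylor h"
  have sums: "(\<lambda>n. c n * z ^ n) sums h z" if "z \<in> ball 0 1" for z
    unfolding c_def by (rule taylor_sums[OF h that])
  define r' where "r' = (1 + r) / 2"
  have "summable (\<lambda>n. c n * of_real r' ^ n)"
    using sums[of "of_real r'"] r by (auto simp: sums_iff r'_def simp del: of_real_add of_real_divide)
  then have "summable (\<lambda>n. norm (c n * of_real r ^ n))"
    by (rule powser_insidea) (use r in \<open>auto simp: r'_def simp del: of_real_add of_real_divide\<close>)
  then have abs: "summable (\<lambda>n. cmod (c n) * r ^ n)" using r by (simp add: norm_mult norm_power)
  have "(\<lambda>M. \<Sum>n. cmod (c (n + M)) * r ^ (n + M)) \<longlonglongrightarrow> 0"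
    using suminf_exist_split2[OF abs] by simp
  then have "\<forall>\<^sub>F M in sequentially. (\<Sum>n. cmod (c (n + M)) * r ^ (n + M)) < e"
    using e by (rule order_tendstoD)
  moreover have "\<forall>\<^sub>F M in sequentially. nat \<bar>k\<bar> < M" by (rule eventually_gt_at_top)
  ultimately have "\<forall>\<^sub>F M in sequentially. (\<Sum>n. cmod (c (n + M)) * r ^ (n + M)) < e \<and> nat \<bar>k\<bar> < M"
    by eventually_elim auto
  from eventually_happens'[OF sequentially_bot this]
  obtain M where M: "(\<Sum>n. cmod (c (n + M)) * r ^ (n + M)) < e" "nat \<bar>k\<bar> < M" by blast
  define T where "T = (\<Sum>n. cmod (c (n + M)) * r ^ (n + M))"
  have abs': "summable (\<lambda>n. cmod (c (n + M)) * r ^ (n + M))"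
    using summable_iff_shift[of "\<lambda>n. cmod (c n) * r ^ n" M] abs by blast
  have T0: "0 \<le> T" unfolding T_def using r by (intro suminf_nonneg abs') auto
  \<comment> \<open>For n < M and |k| < M the frequency n - k is less than 2 M in absolute value, so
    no aliasing occurs.\<close>
  have "cmod (circle_mean N \<tau> (\<lambda>\<theta>. h (of_real r * cis \<theta>) * cis (- (of_int k * \<theta>)))
           - (if k \<ge> 0 then taylor h (nat k) * of_real r ^ nat k else 0)) < e" if N: "N \<ge> 2 * M" for N \<tau>
  proof -
    define P where "P = (\<lambda>z. \<Sum>n<M. c n * z ^ n)"
    have tail: "cmod (h z - P z) \<le> T" if z: "cmod z = r" for z
    proof -
      have sz: "summable (\<lambda>n. c n * z ^ n)" "h z = (\<Sum>n. c n * z ^ n)"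
        using sums[of z] z r by (auto simp: sums_iff)
      have "h z - P z = (\<Sum>n. c (n + M) * z ^ (n + M))"
        unfolding P_def sz(2) using suminf_split_initial_segment[OF sz(1), of M] by simp
      also have "cmod \<dots> \<le> (\<Sum>n. cmod (c (n + M) * z ^ (n + M)))"
        using abs' by (intro summable_norm) (simp add: norm_mult norm_power z)
      finally show ?thesis by (simp add: T_def norm_mult norm_power z)
    qed
    have "circle_mean N \<tau> (\<lambda>\<theta>. P (of_real r * cis \<theta>) * cis (- (of_int k * \<theta>)))
        = circle_mean N \<tau> (\<lambda>\<theta>. \<Sum>n<M. (c n * of_real r ^ n) * cis (of_int (int n - k) * \<theta>))"
      unfolding P_def sum_distrib_right
      by (intro arg_cong[of _ _ "circle_mean N \<tau>"] ext sum.cong refl)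
         (simp add: power_mult_distrib Complex.DeMoivre cis_mult algebra_simps)
    also have "\<dots> = (\<Sum>n<M. (c n * of_real r ^ n) * (if int n - k = 0 then 1 else 0))"
      unfolding circle_mean_sum circle_mean_cmult using M(2) N
      by (intro sum.cong refl arg_cong2[where f="(*)"] circle_mean_cis) auto
    also have "\<dots> = (\<Sum>n<M. if n = nat k \<and> k \<ge> 0 then c n * of_real r ^ n else 0)"
      by (intro sum.cong) auto
    also have "\<dots> = (if k \<ge> 0 then c (nat k) * of_real r ^ nat k else 0)"
      using M(2) by (cases "k \<ge> 0") auto
    finally have P: "circle_mean N \<tau> (\<lambda>\<theta>. P (of_real r * cis \<theta>) * cis (- (of_int k * \<theta>))) = \<dots>" .
    have "circle_mean N \<tau> (\<lambda>\<theta>. h (of_real r * cis \<theta>) * cis (- (of_int k * \<theta>)))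
       = circle_mean N \<tau> (\<lambda>\<theta>. P (of_real r * cis \<theta>) * cis (- (of_int k * \<theta>)))
       + circle_mean N \<tau> (\<lambda>\<theta>. (h (of_real r * cis \<theta>) - P (of_real r * cis \<theta>)) * cis (- (of_int k * \<theta>)))"
      unfolding circle_mean_add[symmetric] by (simp add: algebra_simps)
    moreover have "cmod (circle_mean N \<tau> (\<lambda>\<theta>. (h (of_real r * cis \<theta>) - P (of_real r * cis \<theta>)) * cis (- (of_int k * \<theta>)))) \<le> T"
      using tail r T0 by (intro circle_mean_bound) (auto simp: norm_mult)
    ultimately show ?thesis using M(1) unfolding P c_def T_def by simp
  qed
  then show ?thesis unfolding eventually_sequentially by blast
qed

text \<open>On a circle \<open>p + cnj p\<close> is twice the nonnegative real part. Its coefficient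
  of index n is that of \<open>p\<close>, because \<open>p\<close> has no negative frequencies, and
  it is bounded by the mean of \<open>2 * Re p\<close>, which is the value at 0. Then r tends to
  1.\<close>

lemma caratheodory_coefficients:
  assumes p: "p holomorphic_on ball 0 1" and Re: "\<And>z. z \<in> ball 0 1 \<Longrightarrow> 0 \<le> Re (p z)" and n: "1 \<le> n"
  shows "cmod (taylor p n) \<le> 2 * Re (p 0)"
proof -
  have p0: "taylor p 0 = p 0" by (simp add: taylor_def)
  have le: "cmod (taylor p n) * r ^ n \<le> 2 * Re (p 0)" if r: "0 \<le> r" "r < 1" for r :: real
  proof (rule field_le_epsilon)
    fix e :: real assume "0 < e"
    then have e: "0 < e/4" by simp
    define F where "F = (\<lambda>k \<theta>. p (of_real r * cis \<theta>) * cis (- (of_int k * \<theta>)))"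
    have "\<forall>\<^sub>F N in sequentially. cmod (circle_mean N 0 (F (int n)) - taylor p n * of_real r ^ n) < e/4
       \<and> cmod (circle_mean N 0 (F (- int n))) < e/4 \<and> cmod (circle_mean N 0 (F 0) - p 0) < e/4"
      using circle_mean_taylor[OF p r e, of "int n"] circle_mean_taylor[OF p r e, of "- int n"]
        circle_mean_taylor[OF p r e, of 0]
      unfolding F_def by eventually_elim (use n in \<open>auto simp: p0\<close>)
    from eventually_happens'[OF sequentially_bot this]
    obtain N where N: "cmod (circle_mean N 0 (F (int n)) - taylor p n * of_real r ^ n) < e/4"
       "cmod (circle_mean N 0 (F (- int n))) < e/4" "cmod (circle_mean N 0 (F 0) - p 0) < e/4"
      by blast
    have in_ball: "of_real r * cis \<theta> \<in> ball 0 1" for \<theta> using r by (simp add: norm_mult)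
    have "circle_mean N 0 (F (int n)) + cnj (circle_mean N 0 (F (- int n)))
        = circle_mean N 0 (\<lambda>\<theta>. (p (of_real r * cis \<theta>) + cnj (p (of_real r * cis \<theta>))) * cis (- (of_int n * \<theta>)))"
      unfolding circle_mean_cnj[symmetric] circle_mean_add[symmetric]
      by (simp add: F_def cis_cnj algebra_simps)
    also have "cmod \<dots> \<le> (\<Sum>j<N. 2 * Re (p (of_real r * cis (0 + real j * (2*pi/N))))) / N"
    proof (rule norm_circle_mean_le)
      fix j
      show "cmod ((p (of_real r * cis (0 + real j * (2*pi/N))) + cnj (p (of_real r * cis (0 + real j * (2*pi/N))))) *
             cis (- (of_int n * (0 + real j * (2*pi/N))))) \<le> 2 * Re (p (of_real r * cis (0 + real j * (2*pi/N))))"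
        using Re[OF in_ball, of "0 + real j * (2*pi/N)"] by (simp add: norm_mult complex_add_cnj)
    qed
    also have "\<dots> = 2 * Re (circle_mean N 0 (F 0))"
      unfolding circle_mean_def F_def by (simp add: sum_distrib_left)
    also have "\<dots> \<le> 2 * (Re (p 0) + e/4)"
      using N(3) abs_Re_le_cmod[of "circle_mean N 0 (F 0) - p 0"] by simp
    finally have 1: "cmod (circle_mean N 0 (F (int n)) + cnj (circle_mean N 0 (F (- int n)))) \<le> 2 * Re (p 0) + e/2" by simp
    have "cmod (taylor p n) * r ^ n = cmod (taylor p n * of_real r ^ n)" using r by (simp add: norm_mult norm_power)
    also have "\<dots> \<le> cmod (circle_mean N 0 (F (int n)) + cnj (circle_mean N 0 (F (- int n)))) + (e/4 + e/4)"
    proof -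
      have "taylor p n * of_real r ^ n = (circle_mean N 0 (F (int n)) + cnj (circle_mean N 0 (F (- int n))))
         - (circle_mean N 0 (F (int n)) - taylor p n * of_real r ^ n) - cnj (circle_mean N 0 (F (- int n)))" by simp
      also have "cmod \<dots> \<le> cmod (circle_mean N 0 (F (int n)) + cnj (circle_mean N 0 (F (- int n))))
         + cmod (circle_mean N 0 (F (int n)) - taylor p n * of_real r ^ n) + cmod (cnj (circle_mean N 0 (F (- int n))))"
        by (meson norm_triangle_ineq4 order_trans add_right_mono)
      finally show ?thesis using N(1,2) by simp
    qed
    finally show "cmod (taylor p n) * r ^ n \<le> 2 * Re (p 0) + e" using 1 by simp
  qed
  have "((\<lambda>r. cmod (taylor p n) * r ^ n) \<longlongrightarrow> cmod (taylor p n) * 1 ^ n) (at_left 1)"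
    by (intro tendsto_intros)
  moreover have "\<forall>\<^sub>F r in at_left 1. cmod (taylor p n) * r ^ n \<le> 2 * Re (p 0)"
    unfolding eventually_at_left_field using le by (intro exI[of _ 0]) auto
  ultimately show ?thesis by (intro tendsto_upperbound) auto
qed

section \<open>A balanced direction for convex harmonic mappings\<close>

text \<open>\<open>B\<close> plays the part of arc length: being increasing and bounded it is Cauchy
  at 1, and it dominates the oscillation of \<open>f\<close>.\<close>

lemma limit_at_left_of_bounded_length:
  fixes f :: "real \<Rightarrow> complex" and B :: "real \<Rightarrow> real"
  assumes r: "r < 1" and B: "\<And>s t. r \<le> s \<Longrightarrow> s \<le> t \<Longrightarrow> t < 1 \<Longrightarrow> cmod (f t - f s) \<le> L * (B t - B s)"
    and mono: "\<And>s t. r \<le> s \<Longrightarrow> s \<le> t \<Longrightarrow> t < 1 \<Longrightarrow> B s \<le> B t"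
    and bdd: "\<And>t. r \<le> t \<Longrightarrow> t < 1 \<Longrightarrow> B t \<le> C" and L: "0 \<le> L"
  obtains W where "(f \<longlongrightarrow> W) (at_left 1)"
proof -
  define S where "S = Sup (B ` {r..<1})"
  have bdda: "bdd_above (B ` {r..<1})" using bdd by (auto intro!: bdd_aboveI[of _ C])
  have "cauchy_filter (filtermap f (at_left 1))"
    unfolding cauchy_filter_metric_filtermap
  proof (intro allI impI)
    fix e :: real assume e: "0 < e"
    define \<eta> where "\<eta> = e / (L + 1)"
    have \<eta>: "0 < \<eta>" "L * \<eta> < e" using e L by (auto simp: \<eta>_def field_simps)
    have "S - \<eta> < S" using \<eta> by simp
    then obtain s0 where s0: "s0 \<in> {r..<1}" "S - \<eta> < B s0"
      unfolding S_def using less_cSup_iff[OF _ bdda] r by auto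
    have close: "dist (f s) (f t) < e" if "s0 \<le> s" "s \<le> t" "t < 1" for s t
    proof -
      have "B t \<le> S" unfolding S_def using that s0 by (intro cSup_upper bdda) auto
      moreover have "B s0 \<le> B s" using mono[of s0 s] that s0 by auto
      ultimately have "B t - B s \<le> \<eta>" using s0 by simp
      then have "L * (B t - B s) \<le> L * \<eta>" using L by (rule mult_left_mono)
      then show ?thesis using B[of s t] that s0 \<eta> by (auto simp: dist_norm norm_minus_commute)
    qed
    have "dist (f s) (f t) < e" if "s0 < s" "s < 1" "s0 < t" "t < 1" for s t
      using close[of s t] close[of t s] that by (cases "s \<le> t") (auto simp: dist_commute)
    then show "\<exists>P. eventually P (at_left 1) \<and> (\<forall>x y. P x \<and> P y \<longrightarrow> dist (f x) (f y) < e)"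
      using s0 by (intro exI[of _ "\<lambda>s. s0 < s \<and> s < 1"]) (auto simp: eventually_at_left_field)
  qed
  moreover have "filtermap f (at_left 1) \<noteq> bot" by (simp add: filtermap_bot_iff)
  ultimately obtain W where "filtermap f (at_left 1) \<le> nhds W"
    using cauchy_filter_complete_converges[OF _ complete_UNIV, of "filtermap f (at_left 1)"] by auto
  then show thesis using that by (simp add: filterlim_def)
qed

text \<open>The polygon of radial limits at suitable equidistributed points of the circle is convex, and its
  discrete Fourier coefficients approximate the Taylor coefficients of both parts of \<open>G\<close>.\<close>

lemma approximate_balanced_direction:
  fixes G H K \<phi> :: "complex \<Rightarrow> complex" and e L :: real
  assumes hol: "\<phi> holomorphic_on ball 0 1" and inj: "inj_on \<phi> (ball 0 1)" and im: "\<phi> ` ball 0 1 \<subseteq> ball 0 1"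
    and H: "H holomorphic_on ball 0 1" and K: "K holomorphic_on ball 0 1"
    and G: "\<And>z. z \<in> ball 0 1 \<Longrightarrow> G z = H z + cnj (K z)"
    and injG: "inj_on G (ball 0 1)" and conv: "convex (G ` ball 0 1)"
    and L: "0 \<le> L" "\<And>z w. z \<in> ball 0 1 \<Longrightarrow> w \<in> ball 0 1 \<Longrightarrow> cmod (G z - G w) \<le> L * cmod (\<phi> z - \<phi> w)"
    and e: "0 < e" "e < 1"
  obtains N :: nat and \<psi> r :: real and Z :: "nat \<Rightarrow> complex" where "m \<le> N" "0 < N" "1 - e < r" "r < 1"
    "\<And>n. 1 \<le> n \<Longrightarrow> n \<le> m \<Longrightarrow>
       cmod (Z n - (cis (- \<psi>) * taylor H n + cis \<psi> * taylor K n) / 2 * of_real r ^ n) \<le> (L + 2) * e"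
    "\<And>n. N * \<bar>sin (n * pi / N)\<bar> * cmod (Z n) \<le> n * (N * \<bar>sin (pi / N)\<bar> * cmod (Z 1))"
proof -
  \<comment> \<open>The order of choices matters: \<open>r\<close> first, then \<open>N\<close>
    large enough for the means on the circle of radius \<open>r\<close>, and last the offset \<tau>.
    This is why \<open>near\<close> asks for all \<tau>.\<close>
  obtain r where r: "0 < r" "1 - e < r" "r < 1"
    and short: "\<And>N::nat. 0 < N \<Longrightarrow> \<exists>\<tau>. \<forall>\<rho>\<in>{r..<1}.
        (\<Sum>j<N. radial_length \<phi> r \<rho> (\<tau> + real j * (2*pi/N))) \<le> N * e"
    using equidistributed_short_radii[OF hol inj im, of "1 - e" e] e by auto
  define near where "near = (\<lambda>F N. \<forall>n\<in>{1..m}. \<forall>\<tau>.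
        cmod (circle_mean N \<tau> (\<lambda>\<theta>. F (of_real r * cis \<theta>) * cis (- (of_int (int n) * \<theta>))) - taylor F n * of_real r ^ n) < e
      \<and> cmod (circle_mean N \<tau> (\<lambda>\<theta>. F (of_real r * cis \<theta>) * cis (- (of_int (- int n) * \<theta>)))) < e)"
  have ev_near: "eventually (near F) sequentially" if F: "F holomorphic_on ball 0 1" for F
    unfolding near_def
  proof (intro eventually_ball_finite ballI)
    fix n assume n: "n \<in> {1..m}"
    show "\<forall>\<^sub>F N in sequentially. \<forall>\<tau>.
        cmod (circle_mean N \<tau> (\<lambda>\<theta>. F (of_real r * cis \<theta>) * cis (- (of_int (int n) * \<theta>))) - taylor F n * of_real r ^ n) < e
      \<and> cmod (circle_mean N \<tau> (\<lambda>\<theta>. F (of_real r * cis \<theta>) * cis (- (of_int (- int n) * \<theta>)))) < e"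
      using circle_mean_taylor[OF F less_imp_le[OF r(1)] r(3) e(1), of "int n"]
        circle_mean_taylor[OF F less_imp_le[OF r(1)] r(3) e(1), of "- int n"]
      by eventually_elim (use n in auto)
  qed auto
  have "\<forall>\<^sub>F N in sequentially. m < N" by (rule eventually_gt_at_top)
  with ev_near[OF H] ev_near[OF K] have "\<forall>\<^sub>F N in sequentially. m < N \<and> near H N \<and> near K N"
    by eventually_elim (intro conjI)
  from eventually_happens'[OF sequentially_bot this]
  obtain N where "m < N" and NH: "near H N" and NK: "near K N" by blast
  then have N: "0 < N" "m \<le> N" by auto
  obtain \<tau> where \<tau>: "\<And>\<rho>. \<rho> \<in> {r..<1} \<Longrightarrow> (\<Sum>j<N. radial_length \<phi> r \<rho> (\<tau> + real j * (2*pi/N))) \<le> N * e"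
    using short[OF N(1)] by blast
  define \<theta> where "\<theta> = (\<lambda>j::nat. \<tau> + real j * (2*pi/N))"
  have in_ball: "of_real s * cis t \<in> ball 0 1" if "0 \<le> s" "s < 1" for s t using that by (simp add: norm_mult)
  have lenG: "cmod (G (of_real t * cis u) - G (of_real s * cis u)) \<le> L * radial_length \<phi> s t u"
    if "r \<le> s" "s \<le> t" "t < 1" for s t u
    using L(2)[OF in_ball[of t u] in_ball[of s u]] that r
      mult_left_mono[OF dist_le_radial_length[OF hol, of s t u] L(1)] by auto
  have lim_ex: "\<exists>w. ((\<lambda>s. G (of_real s * cis (\<theta> j))) \<longlongrightarrow> w) (at_left 1)" for j
  proof -
    have per: "cis (\<theta> (i + N)) = cis (\<theta> i)" for i
    proof -
      have "\<theta> (i + N) = \<theta> i + 2*pi" using N by (simp add: \<theta>_def field_simps)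
      then show ?thesis by (simp add: cis.ctr)
    qed
    \<comment> \<open>Only the radii with index below \<open>N\<close> occur in the controlled sum,
      and each single length is bounded by the whole sum.\<close>
    obtain i where i: "i < N" "cis (\<theta> i) = cis (\<theta> j)"
      using periodic_ex_index[of "\<lambda>i. cis (\<theta> i)" N 0 j] per N by auto
    obtain w where "((\<lambda>s. G (of_real s * cis (\<theta> i))) \<longlongrightarrow> w) (at_left 1)"
    proof (rule limit_at_left_of_bounded_length[OF r(3), of "\<lambda>s. G (of_real s * cis (\<theta> i))" L "\<lambda>s. radial_length \<phi> r s (\<theta> i)" "N * e"])
      fix s t assume st: "r \<le> s" "s \<le> t" "t < 1"
      have comb: "radial_length \<phi> r t (\<theta> i) = radial_length \<phi> r s (\<theta> i) + radial_length \<phi> s t (\<theta> i)"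
        using radial_length_combine[OF hol, of r s t] st r by simp
      then show "cmod (G (of_real t * cis (\<theta> i)) - G (of_real s * cis (\<theta> i))) \<le> L * (radial_length \<phi> r t (\<theta> i) - radial_length \<phi> r s (\<theta> i))"
        using lenG[OF st] by simp
      show "radial_length \<phi> r s (\<theta> i) \<le> radial_length \<phi> r t (\<theta> i)"
        using comb radial_length_nonneg[OF hol] by simp
    next
      fix t assume t: "r \<le> t" "t < 1"
      have "radial_length \<phi> r t (\<theta> i) \<le> (\<Sum>j<N. radial_length \<phi> r t (\<theta> j))"
        using i by (intro member_le_sum) (auto intro: radial_length_nonneg[OF hol])
      also have "\<dots> \<le> N * e" using \<tau>[of t] t by (simp add: \<theta>_def)
      finally show "radial_length \<phi> r t (\<theta> i) \<le> N * e" .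
    qed (use L that in auto)
    then show ?thesis using i by auto
  qed
  define W where "W = (\<lambda>t. Lim (at_left 1) (\<lambda>s. G (of_real s * cis t)))"
  have lim: "((\<lambda>s. G (of_real s * cis (\<theta> j))) \<longlongrightarrow> W (\<theta> j)) (at_left 1)" for j
    using lim_ex[of j] tendsto_Lim[of "at_left (1::real)"] unfolding W_def by (metis trivial_limit_at_left_real)
  define x where "x = (\<lambda>j. W (\<theta> j))"
  have per: "x (j + N) = x j" for j
  proof -
    have "\<theta> (j + N) = \<theta> j + 2*pi" using N by (simp add: \<theta>_def field_simps)
    then have "cis (\<theta> (j + N)) = cis (\<theta> j)" by (simp add: cis.ctr)
    then show ?thesis by (simp add: x_def W_def)
  qed
  have contG: "continuous_on (ball 0 1) G"
  proof -
    have "continuous_on (ball 0 1) (\<lambda>z. H z + cnj (K z))"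
      using H K by (intro continuous_intros holomorphic_on_imp_continuous_on)
    then show ?thesis using G continuous_on_cong[OF refl, of "ball 0 1" G "\<lambda>z. H z + cnj (K z)"] by blast
  qed
  have cross: "crossing N x"
    unfolding crossing_def
  proof (intro allI impI)
    fix \<psi> and a b c d :: nat assume o: "a < b" "b < c" "c < d" "d < a + N"
    have lt: "\<theta> i < \<theta> j" if "i < j" for i j using that N by (auto simp: \<theta>_def divide_strict_right_mono)
    have "\<theta> d < \<theta> (a + N)" using o by (intro lt)
    also have "\<theta> (a + N) = \<theta> a + 2 * pi" using N by (simp add: \<theta>_def field_simps)
    finally have "\<theta> d < \<theta> a + 2 * pi" .
    from radial_limits_not_interlaced[OF contG injG conv lt[OF o(1)] lt[OF o(2)] lt[OF o(3)] this, of W "cis \<psi>"]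
    show "min (x b \<bullet> cis \<psi>) (x d \<bullet> cis \<psi>) \<le> max (x a \<bullet> cis \<psi>) (x c \<bullet> cis \<psi>)"
      using lim by (auto simp: x_def)
  qed
  obtain \<psi> where \<psi>: "\<And>n::nat. N * \<bar>sin (n * pi / N)\<bar> * cmod ((\<Sum>j<N. (x j \<bullet> cis \<psi>) *\<^sub>R cis (- (real n * (\<tau> + real j * (2*pi/N))))) / N)
     \<le> n * (N * \<bar>sin (pi / N)\<bar> * cmod ((\<Sum>j<N. (x j \<bullet> cis \<psi>) *\<^sub>R cis (- (\<tau> + real j * (2*pi/N)))) / N))"
    using crossing_coefficient_bound[OF per N(1) cross] by blast
  define Z where "Z = (\<lambda>n::nat. (\<Sum>j<N. (x j \<bullet> cis \<psi>) *\<^sub>R cis (- (real n * \<theta> j))) / N)"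
  have sumW: "(\<Sum>j<N. cmod (x j - G (of_real r * cis (\<theta> j)))) \<le> L * (N * e)"
  proof -
    have "((\<lambda>s. \<Sum>j<N. cmod (G (of_real s * cis (\<theta> j)) - G (of_real r * cis (\<theta> j)))) \<longlongrightarrow> (\<Sum>j<N. cmod (x j - G (of_real r * cis (\<theta> j))))) (at_left 1)"
      unfolding x_def by (intro tendsto_intros lim)
    moreover have "\<forall>\<^sub>F s in at_left 1. (\<Sum>j<N. cmod (G (of_real s * cis (\<theta> j)) - G (of_real r * cis (\<theta> j)))) \<le> L * (N * e)"
      unfolding eventually_at_left_field
    proof (intro exI[of _ r] conjI allI impI)
      fix s assume s: "r < s" "s < 1"
      have "(\<Sum>j<N. cmod (G (of_real s * cis (\<theta> j)) - G (of_real r * cis (\<theta> j)))) \<le> (\<Sum>j<N. L * radial_length \<phi> r s (\<theta> j))"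
        using s by (intro sum_mono lenG) auto
      also have "\<dots> = L * (\<Sum>j<N. radial_length \<phi> r s (\<theta> j))" by (simp add: sum_distrib_left)
      also have "\<dots> \<le> L * (N * e)" using \<tau>[of s] s L(1) by (intro mult_left_mono) (auto simp: \<theta>_def)
      finally show "(\<Sum>j<N. cmod (G (of_real s * cis (\<theta> j)) - G (of_real r * cis (\<theta> j)))) \<le> L * (N * e)" .
    qed (use r in auto)
    ultimately show ?thesis by (intro tendsto_upperbound) auto
  qed
  show thesis
  proof (rule that[of N r Z \<psi>])
    fix n assume n: "1 \<le> n" "n \<le> m"
    define F where "F = (\<lambda>f k t. f (of_real r * cis t) * cis (- (of_int k * t)))"
    define Y where "Y = circle_mean N \<tau> (\<lambda>t. (G (of_real r * cis t) \<bullet> cis \<psi>) *\<^sub>R cis (- (real n * t)))"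
    have nH: "cmod (circle_mean N \<tau> (F H (int n)) - taylor H n * of_real r ^ n) < e" "cmod (circle_mean N \<tau> (F H (- int n))) < e"
     and nK: "cmod (circle_mean N \<tau> (F K (int n)) - taylor K n * of_real r ^ n) < e" "cmod (circle_mean N \<tau> (F K (- int n))) < e"
      using NH NK n unfolding near_def F_def by auto
    have "cmod (Z n - Y) = cmod (circle_mean N \<tau> (\<lambda>t. (W t \<bullet> cis \<psi> - G (of_real r * cis t) \<bullet> cis \<psi>) *\<^sub>R cis (- (real n * t))))"
      unfolding Z_def Y_def circle_mean_def x_def \<theta>_def
      by (simp add: diff_divide_distrib[symmetric] sum_subtractf[symmetric] scaleR_diff_left)
    also have "\<dots> \<le> (\<Sum>j<N. cmod (W (\<tau> + real j * (2*pi/N)) - G (of_real r * cis (\<tau> + real j * (2*pi/N))))) / N"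
    proof (rule norm_circle_mean_le)
      fix j
      show "cmod ((W (\<tau> + real j * (2*pi/N)) \<bullet> cis \<psi> - G (of_real r * cis (\<tau> + real j * (2*pi/N))) \<bullet> cis \<psi>) *\<^sub>R cis (- (real n * (\<tau> + real j * (2*pi/N)))))
         \<le> cmod (W (\<tau> + real j * (2*pi/N)) - G (of_real r * cis (\<tau> + real j * (2*pi/N))))"
        using Cauchy_Schwarz_ineq2[of _ "cis \<psi>"] by (simp add: inner_diff_left[symmetric])
    qed
    also have "\<dots> \<le> L * e" using sumW N by (simp add: x_def \<theta>_def field_simps)
    finally have ZY: "cmod (Z n - Y) \<le> L * e" .
    \<comment> \<open>The inner product with \<open>cis \<psi>\<close> is a real part, so
      \<open>H\<close> and \<open>K\<close> enter both plainly and conjugated. The conjugated terms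
      have means of frequency -n, which nearly vanish for power series; the plain ones give the
      Taylor coefficients.\<close>
    have "Y = circle_mean N \<tau> (\<lambda>t. (cis (- \<psi>) / 2) * F H (int n) t + (cis (- \<psi>) / 2) * cnj (F K (- int n) t)
           + ((cis \<psi> / 2) * F K (int n) t + (cis \<psi> / 2) * cnj (F H (- int n) t)))"
      unfolding Y_def
    proof (intro arg_cong[of _ _ "circle_mean N \<tau>"] ext)
      fix t
      have g: "G (of_real r * cis t) = H (of_real r * cis t) + cnj (K (of_real r * cis t))"
        using r by (intro G in_ball) auto
      have inn: "of_real (w \<bullet> cis \<psi>) = (cis (- \<psi>) * w + cis \<psi> * cnj w) / 2" for w
        by (simp add: complex_eq_iff inner_complex_def)
      show "(G (of_real r * cis t) \<bullet> cis \<psi>) *\<^sub>R cis (- (real n * t)) =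
         (cis (- \<psi>) / 2) * F H (int n) t + (cis (- \<psi>) / 2) * cnj (F K (- int n) t)
           + ((cis \<psi> / 2) * F K (int n) t + (cis \<psi> / 2) * cnj (F H (- int n) t))"
        unfolding scaleR_conv_of_real inn g F_def by (simp add: cis_cnj field_simps)
    qed
    then have Y: "Y = (cis (- \<psi>) / 2) * circle_mean N \<tau> (F H (int n)) + (cis (- \<psi>) / 2) * cnj (circle_mean N \<tau> (F K (- int n)))
           + ((cis \<psi> / 2) * circle_mean N \<tau> (F K (int n)) + (cis \<psi> / 2) * cnj (circle_mean N \<tau> (F H (- int n))))"
      by (simp only: circle_mean_add circle_mean_cmult circle_mean_cnj)
    have "Y - (cis (- \<psi>) * taylor H n + cis \<psi> * taylor K n) / 2 * of_real r ^ n =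
        (cis (- \<psi>) / 2) * (circle_mean N \<tau> (F H (int n)) - taylor H n * of_real r ^ n)
      + (cis (- \<psi>) / 2) * cnj (circle_mean N \<tau> (F K (- int n)))
      + ((cis \<psi> / 2) * (circle_mean N \<tau> (F K (int n)) - taylor K n * of_real r ^ n)
      + (cis \<psi> / 2) * cnj (circle_mean N \<tau> (F H (- int n))))"
      unfolding Y by (simp add: algebra_simps add_divide_distrib)
    also have "cmod \<dots> \<le> (e/2 + e/2) + (e/2 + e/2)"
      using nH nK by (intro norm_triangle_mono) (simp_all add: norm_mult norm_divide)
    finally have "cmod (Y - (cis (- \<psi>) * taylor H n + cis \<psi> * taylor K n) / 2 * of_real r ^ n) \<le> 2 * e" by simp
    with ZY have "cmod ((Z n - Y) + (Y - (cis (- \<psi>) * taylor H n + cis \<psi> * taylor K n) / 2 * of_real r ^ n)) \<le> L * e + 2 * e"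
      by (rule norm_triangle_mono)
    then show "cmod (Z n - (cis (- \<psi>) * taylor H n + cis \<psi> * taylor K n) / 2 * of_real r ^ n) \<le> (L + 2) * e"
      by (simp add: algebra_simps)
  next
    fix n :: nat
    show "N * \<bar>sin (n * pi / N)\<bar> * cmod (Z n) \<le> n * (N * \<bar>sin (pi / N)\<bar> * cmod (Z 1))"
      using \<psi>[of n] by (simp add: Z_def \<theta>_def)
  qed (use N r in auto)
qed

text \<open>\<open>u\<close> is the direction of the two parallel support lines. The comparison is
  with index 1 and not with the number 1, because composing with a Riemann map changes the leading
  coefficient.\<close>

definition balanced :: "(nat \<Rightarrow> complex) \<Rightarrow> (nat \<Rightarrow> complex) \<Rightarrow> bool" where
  "balanced a b \<longleftrightarrow> (\<exists>u. cmod u = 1 \<and> (\<forall>n\<ge>1. cmod (cnj u * a n + u * b n) \<le> cmod (cnj u * a 1 + u * b 1)))"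

text \<open>The map \<phi> has finite Dirichlet integral, and the Lipschitz condition transfers the
  resulting short radii to \<open>G\<close>. Letting the error tend to 0, the directions
  \<open>cis (\<psi> k)\<close> have a convergent subsequence, while the radii tend to 1 and the
  numbers of vertices to infinity.\<close>

lemma balanced_parts:
  fixes G H K \<phi> :: "complex \<Rightarrow> complex" and L :: real
  assumes hol: "\<phi> holomorphic_on ball 0 1" and inj: "inj_on \<phi> (ball 0 1)" and im: "\<phi> ` ball 0 1 \<subseteq> ball 0 1"
    and H: "H holomorphic_on ball 0 1" and K: "K holomorphic_on ball 0 1"
    and G: "\<And>z. z \<in> ball 0 1 \<Longrightarrow> G z = H z + cnj (K z)"
    and injG: "inj_on G (ball 0 1)" and conv: "convex (G ` ball 0 1)"
    and L: "0 \<le> L" "\<And>z w. z \<in> ball 0 1 \<Longrightarrow> w \<in> ball 0 1 \<Longrightarrow> cmod (G z - G w) \<le> L * cmod (\<phi> z - \<phi> w)"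
  shows "balanced (taylor H) (taylor K)"
proof -
  define e where "e = (\<lambda>k::nat. 1 / (real k + 2))"
  have e: "0 < e k" "e k < 1" for k by (auto simp: e_def)
  have "\<exists>(N::nat) \<psi> r (Z :: nat \<Rightarrow> complex). k \<le> N \<and> 0 < N \<and> 1 - e k < r \<and> r < 1 \<and>
    (\<forall>n. 1 \<le> n \<longrightarrow> n \<le> k \<longrightarrow>
       cmod (Z n - (cis (- \<psi>) * taylor H n + cis \<psi> * taylor K n) / 2 * of_real r ^ n) \<le> (L + 2) * e k) \<and>
    (\<forall>n::nat. N * \<bar>sin (n * pi / N)\<bar> * cmod (Z n) \<le> n * (N * \<bar>sin (pi / N)\<bar> * cmod (Z 1)))" for k :: nat
    by (rule approximate_balanced_direction[OF hol inj im H K G injG conv L e, of k k]) blast+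
  then obtain N :: "nat \<Rightarrow> nat" and \<psi> r and Z :: "nat \<Rightarrow> nat \<Rightarrow> complex" where
    N: "\<And>k. k \<le> N k" "\<And>k. 0 < N k" and r: "\<And>k. 1 - e k < r k" "\<And>k. r k < 1"
    and near: "\<And>k n. 1 \<le> n \<Longrightarrow> n \<le> k \<Longrightarrow>
       cmod (Z k n - (cis (- \<psi> k) * taylor H n + cis (\<psi> k) * taylor K n) / 2 * of_real (r k) ^ n) \<le> (L + 2) * e k"
    and ineq: "\<And>k (n::nat). N k * \<bar>sin (n * pi / N k)\<bar> * cmod (Z k n) \<le> n * (N k * \<bar>sin (pi / N k)\<bar> * cmod (Z k 1))"
    by metis
  have "compact (sphere (0::complex) 1)" by simp
  moreover have "\<forall>k. cis (\<psi> k) \<in> sphere 0 1" by simp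
  ultimately obtain u \<sigma> where u: "u \<in> sphere 0 1" and \<sigma>: "strict_mono \<sigma>"
    and lim_u: "((\<lambda>k. cis (\<psi> k)) \<circ> \<sigma>) \<longlonglongrightarrow> u"
    unfolding compact_def by metis
  have \<sigma>_top: "filterlim \<sigma> at_top sequentially" by (rule filterlim_subseq[OF \<sigma>])
  have lim_u: "(\<lambda>k. cis (\<psi> (\<sigma> k))) \<longlonglongrightarrow> u" using lim_u by (simp add: o_def)
  have e0: "e \<longlonglongrightarrow> 0" unfolding e_def by real_asymp
  have "r \<longlonglongrightarrow> 1"
  proof (rule real_tendsto_sandwich)
    show "(\<lambda>k. 1 - e k) \<longlonglongrightarrow> 1" using tendsto_diff[OF tendsto_const e0, of 1] by simp
  qed (use r in \<open>auto intro!: always_eventually less_imp_le\<close>)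
  then have r1: "(\<lambda>k. r (\<sigma> k)) \<longlonglongrightarrow> 1" by (rule filterlim_compose[OF _ \<sigma>_top])
  have e0\<sigma>: "(\<lambda>k. e (\<sigma> k)) \<longlonglongrightarrow> 0" by (rule filterlim_compose[OF e0 \<sigma>_top])
  have limZ: "(\<lambda>k. Z (\<sigma> k) n) \<longlonglongrightarrow> (cnj u * taylor H n + u * taylor K n) / 2" if n: "1 \<le> n" for n
  proof -
    define X where "X = (\<lambda>k. (cis (- \<psi> (\<sigma> k)) * taylor H n + cis (\<psi> (\<sigma> k)) * taylor K n) / 2 * of_real (r (\<sigma> k)) ^ n)"
    have "(\<lambda>k. cnj (cis (\<psi> (\<sigma> k)))) \<longlonglongrightarrow> cnj u" by (intro tendsto_intros lim_u)
    then have "(\<lambda>k. cis (- \<psi> (\<sigma> k))) \<longlonglongrightarrow> cnj u" by (simp add: cis_cnj)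
    then have "X \<longlonglongrightarrow> (cnj u * taylor H n + u * taylor K n) / 2 * of_real 1 ^ n"
      unfolding X_def by (intro tendsto_intros lim_u r1) auto
    then have X: "X \<longlonglongrightarrow> (cnj u * taylor H n + u * taylor K n) / 2" by simp
    have "\<forall>\<^sub>F k in sequentially. n \<le> \<sigma> k" using \<sigma>_top by (simp add: filterlim_at_top)
    then have "\<forall>\<^sub>F k in sequentially. cmod (Z (\<sigma> k) n - X k) \<le> (L + 2) * e (\<sigma> k)"
      by eventually_elim (use near n in \<open>simp add: X_def\<close>)
    moreover have "(\<lambda>k. (L + 2) * e (\<sigma> k)) \<longlonglongrightarrow> 0" using tendsto_mult_left[OF e0\<sigma>, of "L + 2"] by simp
    ultimately have "(\<lambda>k. Z (\<sigma> k) n - X k) \<longlonglongrightarrow> 0" by (rule Lim_null_comparison)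
    from tendsto_add[OF this X] show ?thesis by simp
  qed
  have N_top: "filterlim (\<lambda>k. real (N (\<sigma> k))) at_top sequentially"
  proof (rule filterlim_at_top_mono)
    show "filterlim (\<lambda>k. real (\<sigma> k)) at_top sequentially"
      by (rule filterlim_compose[OF filterlim_real_sequentially \<sigma>_top])
  qed (use N in \<open>auto intro!: always_eventually\<close>)
  \<comment> \<open>This limit removes the discretization: the factor becomes n pi, and the n
    cancels against the one on the other side.\<close>
  have sinlim: "(\<lambda>k. N (\<sigma> k) * \<bar>sin (n * pi / N (\<sigma> k))\<bar>) \<longlonglongrightarrow> n * pi" if "1 \<le> n" for n :: nat
  proof -
    have "n * pi > 0" using that by simp
    then have "((\<lambda>x::real. x * \<bar>sin (n * pi / x)\<bar>) \<longlongrightarrow> n * pi) at_top" by real_asymp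
    from filterlim_compose[OF this N_top] show ?thesis .
  qed
  have "cmod (cnj u * taylor H n + u * taylor K n) \<le> cmod (cnj u * taylor H 1 + u * taylor K 1)" if n: "1 \<le> n" for n
  proof -
    have "n * pi * cmod ((cnj u * taylor H n + u * taylor K n) / 2) \<le> n * (real 1 * pi * cmod ((cnj u * taylor H 1 + u * taylor K 1) / 2))"
    proof (rule LIMSEQ_le)
      show "(\<lambda>k. N (\<sigma> k) * \<bar>sin (n * pi / N (\<sigma> k))\<bar> * cmod (Z (\<sigma> k) n)) \<longlonglongrightarrow> n * pi * cmod ((cnj u * taylor H n + u * taylor K n) / 2)"
        by (intro tendsto_mult sinlim tendsto_norm limZ n)
      show "(\<lambda>k. n * (N (\<sigma> k) * \<bar>sin (real 1 * pi / N (\<sigma> k))\<bar> * cmod (Z (\<sigma> k) 1))) \<longlonglongrightarrow> n * (real 1 * pi * cmod ((cnj u * taylor H 1 + u * taylor K 1) / 2))"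
        by (intro tendsto_mult tendsto_const sinlim tendsto_norm limZ) auto
    qed (use ineq in auto)
    then show ?thesis using n by (simp add: norm_divide)
  qed
  then show ?thesis using u unfolding balanced_def by auto
qed

lemma balanced_limit:
  assumes bal: "\<And>k. balanced (a k) (b k)"
    and a: "\<And>n. (\<lambda>k. a k n) \<longlonglongrightarrow> a' n" and b: "\<And>n. (\<lambda>k. b k n) \<longlonglongrightarrow> b' n"
  shows "balanced a' b'"
proof -
  obtain u where u: "\<And>k::nat. cmod (u k) = 1"
    "\<And>k n. 1 \<le> n \<Longrightarrow> cmod (cnj (u k) * a k n + u k * b k n) \<le> cmod (cnj (u k) * a k 1 + u k * b k 1)"
    using bal unfolding balanced_def by metis
  have "compact (sphere (0::complex) 1)" by simp
  moreover have "\<forall>k. u k \<in> sphere 0 1" using u by simp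
  ultimately obtain v \<sigma> where v: "v \<in> sphere 0 1" and \<sigma>: "strict_mono \<sigma>" and lim: "(u \<circ> \<sigma>) \<longlonglongrightarrow> v"
    unfolding compact_def by metis
  have sub: "filterlim \<sigma> at_top sequentially" by (rule filterlim_subseq[OF \<sigma>])
  have lim: "(\<lambda>k. u (\<sigma> k)) \<longlonglongrightarrow> v" using lim by (simp add: o_def)
  have conv: "(\<lambda>k. cmod (cnj (u (\<sigma> k)) * a (\<sigma> k) n + u (\<sigma> k) * b (\<sigma> k) n)) \<longlonglongrightarrow> cmod (cnj v * a' n + v * b' n)" for n
    by (intro tendsto_intros lim filterlim_compose[OF a sub] filterlim_compose[OF b sub])
  have "cmod (cnj v * a' n + v * b' n) \<le> cmod (cnj v * a' 1 + v * b' 1)" if "1 \<le> n" for n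
    by (rule LIMSEQ_le[OF conv conv]) (use u(2)[OF that] in blast)
  then show ?thesis using v unfolding balanced_def by auto
qed

section \<open>Riemann maps near the identity and removal of the boundary regularity\<close>

lemma holomorphic_Lipschitz_cball:
  assumes "h holomorphic_on ball 0 1" "s < 1"
  obtains B where "0 \<le> B" "\<And>z w. z \<in> cball 0 s \<Longrightarrow> w \<in> cball 0 s \<Longrightarrow> cmod (h z - h w) \<le> B * cmod (z - w)"
proof -
  have sub: "cball 0 s \<subseteq> ball (0::complex) 1" using assms by auto
  have "continuous_on (ball 0 1) (deriv h)"
    using assms by (intro holomorphic_on_imp_continuous_on holomorphic_deriv) auto
  then have "compact (deriv h ` cball 0 s)"
    using sub by (intro compact_continuous_image) (auto intro: continuous_on_subset)
  then have "bounded (deriv h ` cball 0 s)" by (rule compact_imp_bounded)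
  then obtain B where "\<forall>w\<in>deriv h ` cball 0 s. cmod w \<le> B" unfolding bounded_iff by blast
  then have B: "\<And>z. z \<in> cball 0 s \<Longrightarrow> cmod (deriv h z) \<le> B" by blast
  show thesis
  proof (rule that[of "max B 0"])
    fix z w :: complex assume zw: "z \<in> cball 0 s" "w \<in> cball 0 s"
    show "cmod (h z - h w) \<le> max B 0 * cmod (z - w)"
    proof (rule field_differentiable_bound[OF convex_cball _ _ zw])
      fix x :: complex assume "x \<in> cball 0 s"
      then show "(h has_field_derivative deriv h x) (at x within cball 0 s)"
        using sub by (intro has_field_derivative_at_within[OF holomorphic_derivI[OF assms(1)]]) auto
    qed (use B in \<open>auto simp: le_max_iff_disj\<close>)
  qed auto
qed

text \<open>Write \<phi> z = z q(z) with |q| \<le> 1. Then p = 1 - q has nonnegative real part and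
  p(0) = 1 - c, so its coefficients are at most 2 (1 - c), and for |z| \<le> 1/2 the geometric
  series doubles this.\<close>

lemma Schwarz_deviation:
  assumes hol: "\<phi> holomorphic_on ball 0 1" and im: "\<phi> ` ball 0 1 \<subseteq> ball 0 1" and 0: "\<phi> 0 = 0"
    and c: "deriv \<phi> 0 = of_real c" and z: "cmod z \<le> 1/2"
  shows "cmod (\<phi> z - z) \<le> 4 * (1 - c)"
proof -
  obtain q where q: "q holomorphic_on ball 0 1" "\<And>z. cmod z < 1 \<Longrightarrow> \<phi> z = z * q z" "deriv \<phi> 0 = q 0"
    using Schwarz3[OF hol 0] by metis
  have lt: "cmod (\<phi> z) < 1" if "cmod z < 1" for z using im that by (auto simp: image_subset_iff)
  have le1: "cmod (q z) \<le> 1" if "z \<in> ball 0 1" for z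
  proof (cases "z = 0")
    case True
    then show ?thesis using Schwarz_Lemma(2)[OF hol 0 lt, of 0] q(3) by simp
  next
    case False
    have "cmod z * cmod (q z) \<le> cmod z * 1"
      using Schwarz_Lemma(1)[OF hol 0 lt, of z] that q(2)[of z] by (simp add: norm_mult)
    then show ?thesis using False by (subst (asm) mult_le_cancel_left) auto
  qed
  define p where "p = (\<lambda>z. 1 - q z)"
  have p: "p holomorphic_on ball 0 1" unfolding p_def using q(1) by (intro holomorphic_intros)
  have Rep: "0 \<le> Re (p z)" if "z \<in> ball 0 1" for z
    using le1[OF that] complex_Re_le_cmod[of "q z"] by (simp add: p_def)
  have p0: "p 0 = of_real (1 - c)" using q(3) c by (simp add: p_def)
  have c1: "0 \<le> 1 - c" using Rep[of 0] p0 by simp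
  have co: "cmod (taylor p n) \<le> 2 * (1 - c)" for n
  proof (cases "n = 0")
    case True then show ?thesis using p0 c1 by (simp add: taylor_def del: of_real_diff)
  next
    case False
    then show ?thesis using caratheodory_coefficients[OF p Rep, of n] p0 by (simp del: of_real_diff)
  qed
  have z1: "z \<in> ball 0 1" using z by simp
  have s: "(\<lambda>n. taylor p n * z ^ n) sums p z" by (rule taylor_sums[OF p z1])
  have g: "(\<lambda>n. 2 * (1 - c) * (1/2) ^ n) sums (2 * (1 - c) * (1 / (1 - 1/2)))"
    by (intro sums_mult geometric_sums) auto
  have "cmod (p z) \<le> 2 * (1 - c) * (1 / (1 - 1/2))"
  proof (rule norm_sums_le[OF s g])
    fix n
    show "cmod (taylor p n * z ^ n) \<le> 2 * (1 - c) * (1/2) ^ n"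
      unfolding norm_mult norm_power using co z c1 by (intro mult_mono power_mono) auto
  qed
  then have "cmod (p z) \<le> 4 * (1 - c)" by simp
  moreover have "\<phi> z - z = - (z * p z)" using q(2)[of z] z by (simp add: p_def algebra_simps)
  moreover have "cmod z * cmod (p z) \<le> 1 * cmod (p z)" using z by (intro mult_right_mono) auto
  ultimately show ?thesis by (simp add: norm_mult)
qed

text \<open>Exhaustion of a convex image by the interiors of the convex hulls of \<open>f ` cball 0 R\<close>, together with
  Riemann maps of their preimages.\<close>

lemma convex_exhaustion:
  fixes f :: "complex \<Rightarrow> complex"
  assumes cont: "continuous_on (ball 0 1) f" and inj: "inj_on f (ball 0 1)"
    and conv: "convex (f ` ball 0 1)" and R: "0 < R" "R < 1"
  obtains \<phi> s c where "\<phi> holomorphic_on ball 0 1" "inj_on \<phi> (ball 0 1)" "\<phi> ` ball 0 1 \<subseteq> cball 0 s" "s < 1"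
    "\<phi> 0 = 0" "deriv \<phi> 0 = of_real c" "R \<le> c" "convex ((f \<circ> \<phi>) ` ball 0 1)"
proof -
  define C where "C = convex hull (f ` cball 0 R)"
  have sub: "cball 0 R \<subseteq> ball (0::complex) 1" using R by auto
  have "compact (f ` cball 0 R)"
    using sub cont by (intro compact_continuous_image) (auto intro: continuous_on_subset)
  then have compC: "compact C" unfolding C_def by (rule compact_convex_hull)
  have C_sub: "C \<subseteq> f ` ball 0 1" unfolding C_def using sub conv by (intro hull_minimal) auto
  obtain g where hom: "homeomorphism (ball 0 1) (f ` ball 0 1) f g"
    using invariance_of_domain_homeomorphism[OF open_ball cont order_refl inj] .
  then have gf: "\<And>z. z \<in> ball 0 1 \<Longrightarrow> g (f z) = z" and fg: "\<And>w. w \<in> f ` ball 0 1 \<Longrightarrow> f (g w) = w"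
    and gim: "g ` f ` ball 0 1 = ball 0 1" and contg: "continuous_on (f ` ball 0 1) g"
    by (auto simp: homeomorphism_def)
  define D where "D = g ` interior C"
  have intC: "interior C \<subseteq> f ` ball 0 1" using C_sub interior_subset by blast
  have D_ball: "D \<subseteq> ball 0 1" unfolding D_def using intC gim by blast
  have fD: "f ` D = interior C" unfolding D_def image_image using intC fg
    by (auto simp: image_def subset_iff)
  have homD: "homeomorphism D (interior C) f g"
    using fD intC fg gf D_ball cont contg
    unfolding homeomorphism_def D_def by (auto intro: continuous_on_subset)
  have injg: "inj_on g (interior C)" using fg intC by (metis inj_on_inverseI subsetD)
  have openD: "open D" unfolding D_def
    by (rule invariance_of_domain[OF continuous_on_subset[OF contg intC] open_interior injg])
  have "convex (interior C)" unfolding C_def by (intro convex_interior convex_convex_hull)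
  then have sc: "simply_connected D"
    using homD homeomorphic_simply_connected_eq[of D "interior C"] convex_imp_simply_connected
    unfolding homeomorphic_def by blast
  have ballD: "ball 0 R \<subseteq> D"
  proof
    fix z :: complex assume z: "z \<in> ball 0 R"
    have "open (f ` ball 0 R)"
      using R by (intro invariance_of_domain continuous_on_subset[OF cont] inj_on_subset[OF inj]) auto
    moreover have "f ` ball 0 R \<subseteq> C" unfolding C_def by (meson ball_subset_cball hull_subset image_mono order_trans)
    ultimately have "f z \<in> interior C" using z interior_maximal by blast
    moreover have "z \<in> ball 0 1" using z R by auto
    ultimately show "z \<in> D" unfolding D_def using gf by (metis image_eqI)
  qed
  have 0: "0 \<in> D" using ballD R by auto
  have "D \<noteq> UNIV" using D_ball by (metis UNIV_I mem_ball_0 norm_one order_less_irrefl subsetD)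
  then obtain F G where F: "F holomorphic_on D" and G: "G holomorphic_on ball 0 1"
    and FG: "\<And>z. z \<in> D \<Longrightarrow> F z \<in> ball 0 1 \<and> G (F z) = z" "\<And>z. z \<in> ball 0 1 \<Longrightarrow> G z \<in> D \<and> F (G z) = z"
    using Riemann_mapping_theorem[of D] openD sc 0 by blast
  have F0: "F 0 \<in> ball 0 1" using FG 0 by blast
  \<comment> \<open>An automorphism of the disc that moves \<open>F 0\<close> to the origin, so that
    the Riemann map fixes 0.\<close>
  obtain m m' where m: "m (F 0) = 0" "m holomorphic_on ball 0 1" "m ` ball 0 1 \<subseteq> ball 0 1"
     "m' holomorphic_on ball 0 1" "m' ` ball 0 1 \<subseteq> ball 0 1"
     "\<And>z. z \<in> ball 0 1 \<Longrightarrow> m (m' z) = z" "\<And>z. z \<in> ball 0 1 \<Longrightarrow> m' (m z) = z"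
    using ball_biholomorphism_exists[OF F0] by metis
  define \<phi>0 where "\<phi>0 = G \<circ> m'"
  define \<psi>0 where "\<psi>0 = m \<circ> F"
  have h\<phi>0: "\<phi>0 holomorphic_on ball 0 1" unfolding \<phi>0_def
    using m G by (intro holomorphic_on_compose) (auto intro: holomorphic_on_subset)
  have h\<psi>0: "\<psi>0 holomorphic_on D" unfolding \<psi>0_def
    using m F FG by (intro holomorphic_on_compose) (auto intro: holomorphic_on_subset)
  have inv1: "\<phi>0 z \<in> D" "\<psi>0 (\<phi>0 z) = z" if "z \<in> ball 0 1" for z
    using that m FG unfolding \<phi>0_def \<psi>0_def by (auto simp: image_subset_iff)
  have inv2: "\<psi>0 z \<in> ball 0 1" "\<phi>0 (\<psi>0 z) = z" if "z \<in> D" for z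
    using that m FG unfolding \<phi>0_def \<psi>0_def by (auto simp: image_subset_iff)
  have \<psi>00: "\<psi>0 0 = 0" by (simp add: \<psi>0_def m)
  have \<phi>00: "\<phi>0 0 = 0" using inv2(2)[OF 0] \<psi>00 by simp
  have d\<phi>: "(\<phi>0 has_field_derivative deriv \<phi>0 0) (at 0)" by (rule holomorphic_derivI[OF h\<phi>0]) auto
  have d\<psi>: "(\<psi>0 has_field_derivative deriv \<psi>0 0) (at 0)" by (rule holomorphic_derivI[OF h\<psi>0 openD 0])
  have chain: "deriv \<phi>0 0 * deriv \<psi>0 0 = 1"
  proof -
    have "(\<phi>0 \<circ> \<psi>0 has_field_derivative deriv \<phi>0 0 * deriv \<psi>0 0) (at 0)"
      using d\<phi> d\<psi> \<psi>00 by (intro DERIV_chain) auto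
    moreover have "(\<phi>0 \<circ> \<psi>0 has_field_derivative 1) (at 0)"
      by (rule has_field_derivative_transform_within_open[OF DERIV_ident openD 0]) (use inv2 in auto)
    ultimately show ?thesis by (rule DERIV_unique)
  qed
  \<comment> \<open>Schwarz's lemma for the inverse map on the disc of radius \<open>R\<close>,
    which lies in \<open>D\<close>; it bounds the derivative of the Riemann map from below by
    \<open>R\<close>.\<close>
  have bound: "R * cmod (deriv \<psi>0 0) \<le> 1"
  proof -
    define \<eta> where "\<eta> = (\<lambda>z. \<psi>0 (of_real R * z))"
    have in_D: "of_real R * z \<in> D" if "cmod z < 1" for z
      using that R ballD mult_strict_left_mono[of "cmod z" 1 R] by (auto simp: norm_mult)
    have h\<eta>: "\<eta> holomorphic_on ball 0 1"
      using holomorphic_on_compose_gen[OF _ h\<psi>0, of "\<lambda>z. of_real R * z" "ball 0 1"] in_D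
      unfolding \<eta>_def o_def by (force intro!: holomorphic_intros)
    have "(\<eta> has_field_derivative deriv \<psi>0 0 * of_real R) (at 0)"
      unfolding \<eta>_def by (rule DERIV_chain2) (use d\<psi> in \<open>auto intro!: derivative_eq_intros\<close>)
    then have "deriv \<eta> 0 = deriv \<psi>0 0 * of_real R" by (rule DERIV_imp_deriv)
    moreover have "cmod (deriv \<eta> 0) \<le> 1"
      by (rule Schwarz_Lemma(2)[OF h\<eta>, of 0]) (use in_D inv2(1) \<psi>00 in \<open>auto simp: \<eta>_def\<close>)
    ultimately show ?thesis using R by (simp add: norm_mult mult.commute)
  qed
  define c :: real where "c = cmod (deriv \<phi>0 0)"
  have c: "R \<le> c"
  proof -
    have "c * cmod (deriv \<psi>0 0) = 1" unfolding c_def using arg_cong[OF chain, of cmod] by (simp add: norm_mult)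
    then have "R * cmod (deriv \<psi>0 0) \<le> c * cmod (deriv \<psi>0 0)" "cmod (deriv \<psi>0 0) \<noteq> 0" using bound by auto
    then show ?thesis by (simp add: mult_le_cancel_right)
  qed
  \<comment> \<open>A rotation of the variable makes the derivative at 0 positive.\<close>
  define \<kappa> where "\<kappa> = of_real c / deriv \<phi>0 0"
  have \<kappa>: "cmod \<kappa> = 1" "deriv \<phi>0 0 * \<kappa> = of_real c" using c R by (auto simp: \<kappa>_def c_def norm_divide)
  define \<phi> where "\<phi> = (\<lambda>z. \<phi>0 (\<kappa> * z))"
  have rot: "\<kappa> * z \<in> ball 0 1 \<longleftrightarrow> z \<in> ball 0 1" for z using \<kappa> by (simp add: norm_mult)
  have \<phi>_ball: "\<phi> ` ball 0 1 = D"
  proof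
    show "\<phi> ` ball 0 1 \<subseteq> D" using inv1(1) rot by (auto simp: \<phi>_def)
    show "D \<subseteq> \<phi> ` ball 0 1"
    proof
      fix w assume w: "w \<in> D"
      have "\<phi> (\<psi>0 w / \<kappa>) = w" using inv2[OF w] \<kappa> by (auto simp: \<phi>_def)
      moreover have "\<psi>0 w / \<kappa> \<in> ball 0 1" using inv2(1)[OF w] \<kappa> by (simp add: norm_divide)
      ultimately show "w \<in> \<phi> ` ball 0 1" by (metis image_eqI)
    qed
  qed
  \<comment> \<open>The preimage of the hull stays away from the unit circle. This gives
    \<open>s < 1\<close> and thus Lipschitz constants for the parts of \<open>f\<close> on the image
    of \<phi>.\<close>
  have "compact (g ` C)" using compC contg C_sub by (intro compact_continuous_image) (auto intro: continuous_on_subset)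
  moreover have "g ` C \<subseteq> ball 0 1" using C_sub gim by blast
  ultimately obtain s where s: "s < 1" "g ` C \<subseteq> cball 0 s"
  proof (cases "g ` C = {}")
    case False
    have "continuous_on (g ` C) norm" by (intro continuous_intros)
    then obtain x where x: "x \<in> g ` C" "\<forall>y\<in>g ` C. norm y \<le> norm x"
      using continuous_attains_sup[OF \<open>compact (g ` C)\<close> False] by metis
    then show thesis using \<open>g ` C \<subseteq> ball 0 1\<close> by (intro that[of "norm x"]) auto
  qed (use that[of 0] in auto)
  show thesis
  proof (rule that[of \<phi> s c])
    have "(\<lambda>z. \<kappa> * z) ` ball 0 1 \<subseteq> ball 0 1" using rot by blast
    moreover have "(\<lambda>z. \<kappa> * z) holomorphic_on ball 0 1" by (intro holomorphic_intros)
    ultimately show "\<phi> holomorphic_on ball 0 1"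
      using holomorphic_on_compose_gen[OF _ h\<phi>0, of "\<lambda>z. \<kappa> * z" "ball 0 1"]
      unfolding \<phi>_def o_def by blast
    show "inj_on \<phi> (ball 0 1)"
    proof (rule inj_onI)
      fix z w assume zw: "z \<in> ball 0 1" "w \<in> ball 0 1" "\<phi> z = \<phi> w"
      then have "\<kappa> * z = \<kappa> * w" using inv1(2)[of "\<kappa> * z"] inv1(2)[of "\<kappa> * w"] rot by (auto simp: \<phi>_def)
      then show "z = w" using \<kappa> by auto
    qed
    show "\<phi> ` ball 0 1 \<subseteq> cball 0 s" unfolding \<phi>_ball D_def using s interior_subset by blast
    show "\<phi> 0 = 0" by (simp add: \<phi>_def \<phi>00)
    have "(\<phi> has_field_derivative deriv \<phi>0 0 * \<kappa>) (at 0)"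
      unfolding \<phi>_def by (rule DERIV_chain2) (use d\<phi> in \<open>auto intro!: derivative_eq_intros\<close>)
    then show "deriv \<phi> 0 = of_real c" using \<kappa> by (simp add: DERIV_imp_deriv)
    show "convex ((f \<circ> \<phi>) ` ball 0 1)"
      using \<open>convex (interior C)\<close> unfolding image_comp[symmetric] \<phi>_ball fD .
  qed (use c s in auto)
qed

text \<open>Precomposition with a holomorphic map keeps the decomposition: the parts of f \<circ>
  \<phi> are h \<circ> \<phi> and g \<circ> \<phi>. Each map of the exhaustion thus falls under
  \<open>balanced_parts\<close>, and the Taylor coefficients of these parts tend to those of h and
  g.\<close>

theorem balanced_convex_harmonic:
  assumes h: "h holomorphic_on ball 0 1" and g: "g holomorphic_on ball 0 1"
    and f: "\<And>z. z \<in> ball 0 1 \<Longrightarrow> f z = h z + cnj (g z)"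
    and inj: "inj_on f (ball 0 1)" and conv: "convex (f ` ball 0 1)"
  shows "balanced (taylor h) (taylor g)"
proof -
  have cont: "continuous_on (ball 0 1) f"
  proof -
    have "continuous_on (ball 0 1) (\<lambda>z. h z + cnj (g z))"
      using h g by (intro continuous_intros holomorphic_on_imp_continuous_on)
    then show ?thesis using f continuous_on_cong[OF refl, of "ball 0 1" f "\<lambda>z. h z + cnj (g z)"] by blast
  qed
  define R where "R = (\<lambda>k::nat. 1 - 1 / (real k + 2))"
  have R: "0 < R k" "R k < 1" for k by (auto simp: R_def field_simps)
  have "\<exists>\<phi> s c. \<phi> holomorphic_on ball 0 1 \<and> inj_on \<phi> (ball 0 1) \<and> \<phi> ` ball 0 1 \<subseteq> cball 0 s \<and> s < 1 \<and>
    \<phi> 0 = 0 \<and> deriv \<phi> 0 = of_real c \<and> R k \<le> c \<and> convex ((f \<circ> \<phi>) ` ball 0 1)" for k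
    by (rule convex_exhaustion[OF cont inj conv R(1)[of k] R(2)[of k]]) blast
  then obtain \<phi> s c where \<phi>: "\<And>k. \<phi> k holomorphic_on ball 0 1" "\<And>k. inj_on (\<phi> k) (ball 0 1)"
    "\<And>k. \<phi> k ` ball 0 1 \<subseteq> cball 0 (s k)" "\<And>k. s k < 1" "\<And>k. \<phi> k 0 = 0"
    "\<And>k. deriv (\<phi> k) 0 = of_real (c k)" "\<And>k. R k \<le> c k" "\<And>k. convex ((f \<circ> \<phi> k) ` ball 0 1)"
    by metis
  have \<phi>_ball: "\<phi> k ` ball 0 1 \<subseteq> ball 0 1" for k using \<phi>(3,4)[of k] by fastforce
  have hol_comp: "(q \<circ> \<phi> k) holomorphic_on ball 0 1" if "q holomorphic_on ball 0 1" for q k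
    by (rule holomorphic_on_compose[OF \<phi>(1) holomorphic_on_subset[OF that \<phi>_ball]])
  have bal: "balanced (taylor (h \<circ> \<phi> k)) (taylor (g \<circ> \<phi> k))" for k
  proof -
    obtain Bh where Bh: "0 \<le> Bh" "\<And>z w. z \<in> cball 0 (s k) \<Longrightarrow> w \<in> cball 0 (s k) \<Longrightarrow> cmod (h z - h w) \<le> Bh * cmod (z - w)"
      using holomorphic_Lipschitz_cball[OF h \<phi>(4)[of k]] by metis
    obtain Bg where Bg: "0 \<le> Bg" "\<And>z w. z \<in> cball 0 (s k) \<Longrightarrow> w \<in> cball 0 (s k) \<Longrightarrow> cmod (g z - g w) \<le> Bg * cmod (z - w)"
      using holomorphic_Lipschitz_cball[OF g \<phi>(4)[of k]] by metis
    show ?thesis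
    proof (rule balanced_parts[OF \<phi>(1,2) \<phi>_ball hol_comp[OF h] hol_comp[OF g] _ _ \<phi>(8)])
      fix z :: complex assume "z \<in> ball 0 1"
      then have "\<phi> k z \<in> ball 0 1" using \<phi>_ball by blast
      then show "(f \<circ> \<phi> k) z = (h \<circ> \<phi> k) z + cnj ((g \<circ> \<phi> k) z)" by (simp add: f)
    next
      show "inj_on (f \<circ> \<phi> k) (ball 0 1)" by (rule comp_inj_on[OF \<phi>(2) inj_on_subset[OF inj \<phi>_ball]])
    next
      fix z w :: complex assume zw: "z \<in> ball 0 1" "w \<in> ball 0 1"
      then have s: "\<phi> k z \<in> cball 0 (s k)" "\<phi> k w \<in> cball 0 (s k)" and b: "\<phi> k z \<in> ball 0 1" "\<phi> k w \<in> ball 0 1"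
        using \<phi>(3) \<phi>_ball by blast+
      have "(f \<circ> \<phi> k) z - (f \<circ> \<phi> k) w = (h (\<phi> k z) - h (\<phi> k w)) + cnj (g (\<phi> k z) - g (\<phi> k w))"
        using f[OF b(1)] f[OF b(2)] by simp
      also have "cmod \<dots> \<le> Bh * cmod (\<phi> k z - \<phi> k w) + Bg * cmod (\<phi> k z - \<phi> k w)"
        using Bh(2)[OF s] Bg(2)[OF s] by (intro norm_triangle_mono) (auto simp del: complex_cnj_diff)
      finally show "cmod ((f \<circ> \<phi> k) z - (f \<circ> \<phi> k) w) \<le> (Bh + Bg) * cmod (\<phi> k z - \<phi> k w)"
        by (simp add: algebra_simps)
    qed (use Bh Bg in auto)
  qed
  have dev: "cmod (\<phi> k z - z) \<le> 4 * (1 / (real k + 2))" if "z \<in> ball 0 (1/2)" for k z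
    using Schwarz_deviation[OF \<phi>(1) \<phi>_ball \<phi>(5) \<phi>(6), of z k] \<phi>(7)[of k] that by (auto simp: R_def)
  have small: "cmod (\<phi> k z) \<le> 1/2" if "z \<in> ball 0 (1/2)" for k z
  proof -
    have "cmod (\<phi> k z) \<le> cmod z"
      by (rule Schwarz_Lemma(1)[OF \<phi>(1) \<phi>(5)]) (use \<phi>_ball[of k] that in \<open>auto simp: image_subset_iff\<close>)
    then show ?thesis using that by auto
  qed
  \<comment> \<open>Coefficients at 0 only see a neighbourhood of 0, so uniform convergence on the
    half disc, where the deviation from the identity is controlled, is enough.\<close>
  have conv_t: "(\<lambda>k. taylor (q \<circ> \<phi> k) n) \<longlonglongrightarrow> taylor q n" if q: "q holomorphic_on ball 0 1" for q n
  proof -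
    have half: "1/2 < (1::real)" by simp
    obtain B where B: "0 \<le> B" "\<And>z w. z \<in> cball 0 (1/2) \<Longrightarrow> w \<in> cball 0 (1/2) \<Longrightarrow> cmod (q z - q w) \<le> B * cmod (z - w)"
      using holomorphic_Lipschitz_cball[OF q half] by metis
    have "uniform_limit (ball 0 (1/2)) (\<lambda>k. q \<circ> \<phi> k) q sequentially"
    proof (rule uniform_limitI)
      fix e :: real assume e: "0 < e"
      have "(\<lambda>k::nat. B * (4 * (1 / (real k + 2)))) \<longlonglongrightarrow> 0" by real_asymp
      then have "\<forall>\<^sub>F k::nat in sequentially. B * (4 * (1 / (real k + 2))) < e" using e by (rule order_tendstoD)
      then show "\<forall>\<^sub>F k in sequentially. \<forall>z\<in>ball 0 (1/2). dist ((q \<circ> \<phi> k) z) (q z) < e"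
      proof eventually_elim
        case (elim k)
        show ?case
        proof
          fix z :: complex assume z: "z \<in> ball 0 (1/2)"
          have "cmod (q (\<phi> k z) - q z) \<le> B * cmod (\<phi> k z - z)" using small[OF z, of k] z by (intro B) auto
          also have "\<dots> \<le> B * (4 * (1 / (real k + 2)))" using dev[OF z] B(1) by (intro mult_left_mono)
          finally show "dist ((q \<circ> \<phi> k) z) (q z) < e" using elim by (simp add: dist_norm)
        qed
      qed
    qed
    moreover have "(q \<circ> \<phi> k) holomorphic_on ball 0 (1/2)" for k
      by (rule holomorphic_on_subset[OF hol_comp[OF q]]) auto
    ultimately have "(\<lambda>k. (deriv ^^ n) (q \<circ> \<phi> k) 0) \<longlonglongrightarrow> (deriv ^^ n) q 0"
      by (intro higher_deriv_complex_uniform_limit[where A="ball 0 (1/2)"]) auto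
    then show ?thesis unfolding taylor_def by (intro tendsto_intros) auto
  qed
  show ?thesis by (rule balanced_limit[OF bal conv_t[OF h] conv_t[OF g]])
qed

section \<open>Coefficient bounds\<close>

lemma taylor_unique:
  assumes r: "0 < r" and s: "\<And>z. z \<in> ball 0 r \<Longrightarrow> (\<lambda>n. c n * z ^ n) sums f z"
  shows "taylor f n = c n" and "f holomorphic_on ball 0 r"
proof -
  show hol: "f holomorphic_on ball 0 r" using power_series_holomorphic[of 0 r c f] s by simp
  have "ereal r \<le> conv_radius c"
  proof (rule conv_radius_geI_ex)
    fix t :: real assume "0 < t" "ereal t < ereal r"
    then show "\<exists>z. norm z = t \<and> summable (\<lambda>n. c n * z ^ n)"
      using s[of "of_real t"] by (intro exI[of _ "of_real t"]) (auto simp: sums_iff)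
  qed
  then have "conv_radius c > 0" using r by (metis ereal_less(2) less_le_trans)
  then have "fps_conv_radius (Abs_fps c) > 0" by (simp add: fps_conv_radius_def)
  have "f has_fps_expansion Abs_fps c"
  proof (rule has_fps_expansionI)
    have "\<forall>\<^sub>F u in nhds 0. u \<in> ball 0 r" using r by (intro eventually_nhds_in_open) auto
    then show "\<forall>\<^sub>F u in nhds 0. (\<lambda>n. fps_nth (Abs_fps c) n * u ^ n) sums f u"
      by eventually_elim (use s in simp)
  qed
  from fps_nth_fps_expansion[OF this, of n] show "taylor f n = c n"
    by (simp add: taylor_def)
qed

lemma taylor_mult:
  assumes f: "f holomorphic_on ball 0 1" and g: "g holomorphic_on ball 0 1"
  shows "taylor (\<lambda>z. f z * g z) n = (\<Sum>i\<le>n. taylor f i * taylor g (n - i))"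
proof (rule taylor_unique(1)[of 1])
  fix z :: complex assume z: "z \<in> ball 0 1"
  have abs: "summable (\<lambda>n. norm (taylor q n * z ^ n))" if q: "q holomorphic_on ball 0 1" for q
  proof (rule powser_insidea)
    define t where "t = (1 + cmod z) / 2"
    show "summable (\<lambda>n. taylor q n * of_real t ^ n)"
      using taylor_sums[OF q, of "of_real t"] z by (auto simp: sums_iff t_def simp del: of_real_add of_real_divide)
    show "norm z < norm (of_real t :: complex)" using z by (auto simp: t_def simp del: of_real_add of_real_divide)
  qed
  have "(\<lambda>k. \<Sum>i\<le>k. (taylor f i * z ^ i) * (taylor g (k - i) * z ^ (k - i))) sums
        ((\<Sum>k. taylor f k * z ^ k) * (\<Sum>k. taylor g k * z ^ k))"
    by (rule Cauchy_product_sums[OF abs[OF f] abs[OF g]])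
  moreover have "(\<Sum>i\<le>k. (taylor f i * z ^ i) * (taylor g (k - i) * z ^ (k - i))) = (\<Sum>i\<le>k. taylor f i * taylor g (k - i)) * z ^ k" for k
    unfolding sum_distrib_right by (intro sum.cong refl) (simp add: power_add[symmetric] algebra_simps)
  ultimately show "(\<lambda>n. (\<Sum>i\<le>n. taylor f i * taylor g (n - i)) * z ^ n) sums (f z * g z)"
    using taylor_sums[OF f z] taylor_sums[OF g z] by (simp add: sums_iff)
qed simp

lemma taylor_deriv: "taylor (deriv f) n = of_nat (Suc n) * taylor f (Suc n)"
  unfolding taylor_def by (simp add: funpow_Suc_right del: funpow.simps of_nat_Suc)

lemma taylor_cong:
  assumes "f holomorphic_on ball 0 1" "\<And>z. z \<in> ball 0 1 \<Longrightarrow> f z = g z"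
  shows "taylor f n = taylor g n"
proof -
  have "taylor g n = taylor f n"
    by (rule taylor_unique(1)[of 1]) (use taylor_sums[OF assms(1)] assms(2) in auto)
  then show ?thesis by simp
qed

text \<open>With \<open>\<kappa> = u / cnj u\<close> and \<open>w = g'/h'\<close> one has \<open>h' = (h' + \<kappa> g') / (1 + \<kappa> w)\<close>, where the Taylor
  coefficients of the numerator are at most \<open>n + 1\<close> by balancedness and those of \<open>1 / (1 + \<kappa> w)\<close> are at most \<open>1\<close>
  because its real part is at least \<open>1/2\<close>.\<close>

theorem convex_harmonic_coefficient_bounds:
  assumes h: "h holomorphic_on ball 0 1" and g: "g holomorphic_on ball 0 1"
    and f: "\<And>z. z \<in> ball 0 1 \<Longrightarrow> f z = h z + cnj (g z)"
    and inj: "inj_on f (ball 0 1)" and conv: "convex (f ` ball 0 1)"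
    and lt: "\<And>z. z \<in> ball 0 1 \<Longrightarrow> cmod (deriv g z) < cmod (deriv h z)"
    and dh: "deriv h 0 = 1" and dg: "deriv g 0 = 0" and n: "1 \<le> n"
  shows "cmod (taylor h n) \<le> (real n + 1) / 2" and "cmod (taylor g n) \<le> (real n - 1) / 2"
proof -
  obtain u where u: "cmod u = 1" and bal: "\<And>n. 1 \<le> n \<Longrightarrow> cmod (cnj u * taylor h n + u * taylor g n) \<le> cmod (cnj u * taylor h 1 + u * taylor g 1)"
    using balanced_convex_harmonic[OF h g f inj conv] unfolding balanced_def by blast
  have h1: "taylor h 1 = 1" and g1: "taylor g 1 = 0" using dh dg by (simp_all add: taylor_def)
  define \<kappa> where "\<kappa> = u / cnj u"
  have \<kappa>: "cmod \<kappa> = 1" "cnj u * \<kappa> = u" using u by (auto simp: \<kappa>_def norm_divide)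
  have one: "cmod (taylor h n + \<kappa> * taylor g n) \<le> 1" if "1 \<le> n" for n
  proof -
    have "cnj u * taylor h n + u * taylor g n = cnj u * (taylor h n + \<kappa> * taylor g n)"
      using \<kappa>(2) by (simp add: algebra_simps flip: mult.assoc)
    then show ?thesis using bal[OF that] u h1 g1 by (simp add: norm_mult)
  qed
  define h' where "h' = deriv h"
  define g' where "g' = deriv g"
  have hol: "h' holomorphic_on ball 0 1" "g' holomorphic_on ball 0 1"
    unfolding h'_def g'_def using h g by (auto intro: holomorphic_deriv)
  have h'0: "h' z \<noteq> 0" if "z \<in> ball 0 1" for z using lt[OF that] by (auto simp: h'_def)
  define w where "w = (\<lambda>z. \<kappa> * (g' z / h' z))"
  have w: "w holomorphic_on ball 0 1" unfolding w_def using hol h'0 by (intro holomorphic_intros) auto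
  have wlt: "cmod (w z) < 1" if "z \<in> ball 0 1" for z
    using lt[OF that] h'0[OF that] \<kappa> by (simp add: w_def norm_mult norm_divide h'_def g'_def)
  have w0: "w 0 = 0" by (simp add: w_def g'_def dg)
  have nz: "1 + w z \<noteq> 0" if "z \<in> ball 0 1" for z
    using wlt[OF that] by (metis add_eq_0_iff2 norm_minus_cancel norm_one order_less_irrefl)
  define q where "q = (\<lambda>z. 1 / (1 + w z))"
  have q: "q holomorphic_on ball 0 1" unfolding q_def using w nz by (intro holomorphic_intros) auto
  \<comment> \<open>Subtracting 1/2 keeps the real part nonnegative and makes the value at 0 equal
    to 1/2, so the Caratheodory bound is exactly 1.\<close>
  define p where "p = (\<lambda>z. q z - 1/2)"
  have p: "p holomorphic_on ball 0 1" unfolding p_def using q by (intro holomorphic_intros) auto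
  have Rep: "0 \<le> Re (p z)" if z: "z \<in> ball 0 1" for z
  proof -
    have "p z = (1 - w z) / (1 + w z) / 2" using nz[OF z] by (simp add: p_def q_def field_simps)
    then have "Re (p z) = Re ((1 - w z) / (1 + w z)) / 2" by (simp only: Re_divide_numeral)
    also have "\<dots> = Re ((1 - w z) * cnj (1 + w z)) / (cmod (1 + w z))\<^sup>2 / 2"
      unfolding complex_div_cnj[of "1 - w z"] by (simp flip: of_real_power)
    also have "Re ((1 - w z) * cnj (1 + w z)) = 1 - (cmod (w z))\<^sup>2"
      unfolding cmod_power2 by (simp add: algebra_simps power2_eq_square)
    finally show ?thesis using wlt[OF z] by (simp add: power_le_one)
  qed
  have pp: "taylor p n = taylor q n" if "1 \<le> n" for n
  proof -
    have "taylor q n = (if n = 0 then 1/2 else 0) + taylor p n"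
    proof (rule taylor_unique(1)[of 1])
      fix z :: complex assume z: "z \<in> ball 0 1"
      have "(\<lambda>n. (if n = 0 then 1/2 else 0) * z ^ n) sums (1/2)"
        using sums_single[of 0 "\<lambda>_. 1/2 :: complex"] by (rule sums_cong[THEN iffD1, rotated]) auto
      from sums_add[OF this taylor_sums[OF p z]]
      show "(\<lambda>n. ((if n = 0 then 1/2 else 0) + taylor p n) * z ^ n) sums q z" by (simp add: p_def algebra_simps)
    qed simp
    then show ?thesis using that by simp
  qed
  have q1: "cmod (taylor q n) \<le> 1" for n
  proof (cases "n = 0")
    case True then show ?thesis by (simp add: taylor_def q_def w0)
  next
    case False
    then show ?thesis using caratheodory_coefficients[OF p Rep, of n] pp[of n] by (simp add: p_def q_def w0)
  qed
  define F where "F = (\<lambda>z. h' z + \<kappa> * g' z)"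
  have F: "F holomorphic_on ball 0 1" unfolding F_def using hol by (intro holomorphic_intros)
  have tF: "taylor F n = taylor h' n + \<kappa> * taylor g' n" for n
  proof (rule taylor_unique(1)[of 1])
    fix z :: complex assume z: "z \<in> ball 0 1"
    from sums_add[OF taylor_sums[OF hol(1) z] sums_mult[OF taylor_sums[OF hol(2) z], of \<kappa>]]
    show "(\<lambda>n. (taylor h' n + \<kappa> * taylor g' n) * z ^ n) sums F z" by (simp add: F_def algebra_simps)
  qed simp
  have Fle: "cmod (taylor F n) \<le> real (Suc n)" for n
  proof -
    have "taylor F n = of_nat (Suc n) * (taylor h (Suc n) + \<kappa> * taylor g (Suc n))"
      unfolding tF h'_def g'_def taylor_deriv by (simp add: algebra_simps)
    also have "cmod \<dots> = real (Suc n) * cmod (taylor h (Suc n) + \<kappa> * taylor g (Suc n))"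
      by (simp only: norm_mult norm_of_nat)
    also have "\<dots> \<le> real (Suc n) * 1" using one[of "Suc n"] by (intro mult_left_mono) auto
    finally show ?thesis by simp
  qed
  have gauss: "(\<Sum>i\<le>m. real (Suc i)) = (real m + 1) * (real m + 2) / 2" for m
    by (induction m) (auto simp: field_simps)
  obtain m where m: "n = Suc m" using n by (cases n) auto
  have "taylor h' m = taylor (\<lambda>z. F z * q z) m"
  proof (rule taylor_cong[OF hol(1)])
    fix z :: complex assume z: "z \<in> ball 0 1"
    have "F z = h' z * (1 + w z)" using h'0[OF z] by (simp add: F_def w_def field_simps)
    then show "h' z = F z * q z" using nz[OF z] by (simp add: q_def)
  qed
  also have "\<dots> = (\<Sum>i\<le>m. taylor F i * taylor q (m - i))" by (rule taylor_mult[OF F q])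
  also have "cmod \<dots> \<le> (\<Sum>i\<le>m. real (Suc i) * 1)"
    unfolding norm_mult by (intro sum_norm_le order_trans[OF eq_refl[OF norm_mult]] mult_mono Fle q1) auto
  finally have "cmod (taylor h' m) \<le> (real m + 1) * (real m + 2) / 2" using gauss[of m] by simp
  moreover have "cmod (taylor h' m) = (real m + 1) * cmod (taylor h n)"
    unfolding h'_def taylor_deriv m norm_mult norm_of_nat by simp
  ultimately have "(real m + 1) * cmod (taylor h n) \<le> (real m + 1) * ((real m + 2) / 2)"
    by (simp only: times_divide_eq_right)
  then have "cmod (taylor h n) \<le> (real m + 2) / 2" by (rule mult_left_le_imp_le) simp
  then show "cmod (taylor h n) \<le> (real n + 1) / 2" by (simp add: m)
  \<comment> \<open>The analogous factorization is \<kappa> g' = F (1 - q). As q(0) = 1, the second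
    factor has no constant term, so the largest summand m+1 drops out of the triangular sum.\<close>
  have "taylor (\<lambda>z. \<kappa> * g' z) m = taylor (\<lambda>z. F z * (1 - q z)) m"
  proof (rule taylor_cong)
    show "(\<lambda>z. \<kappa> * g' z) holomorphic_on ball 0 1" using hol by (intro holomorphic_intros)
    fix z :: complex assume z: "z \<in> ball 0 1"
    have "F z = h' z * (1 + w z)" using h'0[OF z] by (simp add: F_def w_def field_simps)
    moreover have "1 - q z = w z / (1 + w z)" using nz[OF z] by (simp add: q_def field_simps)
    ultimately show "\<kappa> * g' z = F z * (1 - q z)" using nz[OF z] h'0[OF z] by (simp add: w_def)
  qed
  also have "\<dots> = (\<Sum>i\<le>m. taylor F i * taylor (\<lambda>z. 1 - q z) (m - i))"
    using q by (intro taylor_mult F holomorphic_intros)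
  also have "cmod \<dots> \<le> (\<Sum>i\<le>m. if i < m then real (Suc i) else 0)"
  proof (rule sum_norm_le)
    fix i assume "i \<in> {..m}"
    have t1: "taylor (\<lambda>z. 1 - q z) k = (if k = 0 then 1 else 0) - taylor q k" for k
    proof (rule taylor_unique(1)[of 1])
      fix z :: complex assume z: "z \<in> ball 0 1"
      have "(\<lambda>n. (if n = 0 then 1 else 0) * z ^ n) sums 1"
        using sums_single[of 0 "\<lambda>_. 1 :: complex"] by (rule sums_cong[THEN iffD1, rotated]) auto
      from sums_diff[OF this taylor_sums[OF q z]]
      show "(\<lambda>n. ((if n = 0 then 1 else 0) - taylor q n) * z ^ n) sums (1 - q z)" by (simp add: algebra_simps)
    qed simp
    show "cmod (taylor F i * taylor (\<lambda>z. 1 - q z) (m - i)) \<le> (if i < m then real (Suc i) else 0)"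
    proof (cases "i < m")
      case True
      then have "cmod (taylor (\<lambda>z. 1 - q z) (m - i)) \<le> 1" using q1[of "m - i"] unfolding t1 by simp
      then have "cmod (taylor F i) * cmod (taylor (\<lambda>z. 1 - q z) (m - i)) \<le> real (Suc i) * 1"
        by (intro mult_mono Fle) auto
      then show ?thesis using True by (simp add: norm_mult)
    next
      case False
      then have "m - i = 0" by simp
      then have "taylor (\<lambda>z. 1 - q z) (m - i) = 0" unfolding t1 by (simp add: taylor_def q_def w0)
      then show ?thesis by simp
    qed
  qed
  also have "\<dots> = (real m + 1) * real m / 2"
  proof -
    have "(\<Sum>i\<le>m. if i < m then real (Suc i) else 0) = (\<Sum>i\<le>m. real (Suc i)) - real (Suc m)"
      by (simp add: lessThan_Suc_atMost[symmetric])
    then show ?thesis unfolding gauss by (simp add: field_simps)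
  qed
  finally have "cmod (taylor (\<lambda>z. \<kappa> * g' z) m) \<le> (real m + 1) * real m / 2" .
  moreover have "taylor (\<lambda>z. \<kappa> * g' z) m = \<kappa> * taylor g' m"
  proof (rule taylor_unique(1)[of 1])
    fix z :: complex assume z: "z \<in> ball 0 1"
    from sums_mult[OF taylor_sums[OF hol(2) z], of \<kappa>]
    show "(\<lambda>n. \<kappa> * taylor g' n * z ^ n) sums (\<kappa> * g' z)" by (simp add: algebra_simps)
  qed simp
  ultimately have "cmod (taylor g' m) \<le> (real m + 1) * (real m / 2)" using \<kappa> by (simp add: norm_mult)
  moreover have "cmod (taylor g' m) = (real m + 1) * cmod (taylor g n)"
    unfolding g'_def taylor_deriv m norm_mult norm_of_nat by simp
  ultimately have "(real m + 1) * cmod (taylor g n) \<le> (real m + 1) * (real m / 2)" by simp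
  then have "cmod (taylor g n) \<le> real m / 2" by (rule mult_left_le_imp_le) simp
  then show "cmod (taylor g n) \<le> (real n - 1) / 2" by (simp add: m)
qed

section \<open>Convexity of curves and of harmonic mappings\<close>

text \<open>The inner normal at \<open>\<theta>\<close> attains its minimum over the curve only at \<open>\<theta>\<close>: the height over the tangent line
  increases until the tangent has turned by \<open>pi\<close> and decreases afterwards.\<close>

lemma convex_curve_of_increasing_tangent:
  fixes \<gamma> T :: "real \<Rightarrow> complex" and \<phi> R d :: "real \<Rightarrow> real"
  assumes der: "\<And>\<theta>. (\<gamma> has_vector_derivative T \<theta>) (at \<theta>)"
    and T: "\<And>\<theta>. T \<theta> = of_real (R \<theta>) * cis (\<phi> \<theta>)" and R: "\<And>\<theta>. 0 < R \<theta>"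
    and d: "\<And>\<theta>. (\<phi> has_real_derivative d \<theta>) (at \<theta>)" "\<And>\<theta>. 0 < d \<theta>"
    and turn: "\<And>\<theta>. \<phi> (\<theta> + 2*pi) = \<phi> \<theta> + 2*pi" and per: "\<And>\<theta>. \<gamma> (\<theta> + 2*pi) = \<gamma> \<theta>"
  shows "convex_curve (range \<gamma>)"
proof -
  have mono: "\<phi> s < \<phi> t" if "s < t" for s t
    by (rule DERIV_pos_imp_increasing[OF that]) (use d in blast)
  have cont\<phi>: "continuous_on A \<phi>" for A
    using d(1) by (meson DERIV_continuous continuous_at_imp_continuous_on)
  have turn_nat: "\<phi> (\<theta> + real n * (2*pi)) = \<phi> \<theta> + real n * (2*pi)" for \<theta> n
  proof (induction n)
    case (Suc n)
    have "\<theta> + real (Suc n) * (2*pi) = (\<theta> + real n * (2*pi)) + 2*pi" by (simp add: algebra_simps)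
    then show ?case using turn[of "\<theta> + real n * (2*pi)"] Suc by (simp add: algebra_simps)
  qed simp
  \<comment> \<open>The angle gains 2 pi per turn, so every direction is an inner normal at some
    parameter.\<close>
  have surj: "\<exists>\<theta>. \<phi> \<theta> = \<psi>" for \<psi>
  proof -
    obtain n :: nat where n: "\<bar>\<psi> - \<phi> 0\<bar> / (2*pi) < real n" using reals_Archimedean2 by blast
    then have n: "\<bar>\<psi> - \<phi> 0\<bar> < real n * (2*pi)" by (simp add: field_simps)
    have "\<phi> (- (real n * (2*pi))) = \<phi> 0 - real n * (2*pi)" using turn_nat[of "- (real n * (2*pi))" n] by simp
    moreover have "\<phi> (real n * (2*pi)) = \<phi> 0 + real n * (2*pi)" using turn_nat[of 0 n] by simp
    ultimately have "\<exists>x\<ge>- (real n * (2*pi)). x \<le> real n * (2*pi) \<and> \<phi> x = \<psi>"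
      using n by (intro IVT') (auto intro: cont\<phi>)
    then show ?thesis by blast
  qed
  have height: "0 < (\<gamma> \<theta> - \<gamma> \<theta>0) \<bullet> (\<i> * cis (\<phi> \<theta>0))" if "\<theta>0 < \<theta>" "\<theta> < \<theta>0 + 2*pi" for \<theta> \<theta>0
  proof -
    define l where "l = (\<lambda>t. (\<gamma> t - \<gamma> \<theta>0) \<bullet> (\<i> * cis (\<phi> \<theta>0)))"
    have l_der: "(l has_real_derivative R t * sin (\<phi> t - \<phi> \<theta>0)) (at t)" for t
    proof -
      have "((\<lambda>t. \<gamma> t - \<gamma> \<theta>0) has_vector_derivative T t) (at t)"
        using der by (auto intro!: derivative_eq_intros)
      then have "(l has_vector_derivative T t \<bullet> (\<i> * cis (\<phi> \<theta>0))) (at t)"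
        unfolding l_def by (rule bounded_linear.has_vector_derivative[OF bounded_linear_inner_left])
      moreover have "T t \<bullet> (\<i> * cis (\<phi> \<theta>0)) = R t * sin (\<phi> t - \<phi> \<theta>0)"
        unfolding T by (simp add: inner_complex_def sin_diff algebra_simps)
      ultimately show ?thesis by (simp add: has_real_derivative_iff_has_vector_derivative)
    qed
    have cl: "continuous_on A l" for A
      using l_der by (meson DERIV_continuous continuous_at_imp_continuous_on)
    \<comment> \<open>The parameter where the tangent has turned by pi, at which the height stops
      growing.\<close>
    have "\<exists>x\<ge>\<theta>0. x \<le> \<theta>0 + 2*pi \<and> \<phi> x = \<phi> \<theta>0 + pi"
      by (intro IVT') (auto simp: turn intro: cont\<phi>)
    then obtain \<theta>1 where \<theta>1: "\<theta>0 \<le> \<theta>1" "\<theta>1 \<le> \<theta>0 + 2*pi" "\<phi> \<theta>1 = \<phi> \<theta>0 + pi" by blast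
    show ?thesis
    proof (cases "\<theta> \<le> \<theta>1")
      case True
      have "l \<theta>0 < l \<theta>"
      proof (rule DERIV_pos_imp_increasing_open[OF that(1)])
        fix t assume t: "\<theta>0 < t" "t < \<theta>"
        have "0 < sin (\<phi> t - \<phi> \<theta>0)"
          using mono[OF t(1)] mono[of t \<theta>1] t True \<theta>1 by (intro sin_gt_zero) auto
        then have "0 < R t * sin (\<phi> t - \<phi> \<theta>0)" using R by simp
        with l_der show "\<exists>y. (l has_real_derivative y) (at t) \<and> 0 < y" by blast
      qed (rule cl)
      then show ?thesis by (simp add: l_def)
    next
      case False
      have "l (\<theta>0 + 2*pi) < l \<theta>"
      proof (rule DERIV_neg_imp_decreasing_open[OF that(2)])
        fix t assume t: "\<theta> < t" "t < \<theta>0 + 2*pi"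
        have "sin (\<phi> t - \<phi> \<theta>0) < 0"
          using mono[of \<theta>1 t] mono[OF t(2)] t False \<theta>1 turn[of \<theta>0] by (intro sin_lt_zero) auto
        then have "R t * sin (\<phi> t - \<phi> \<theta>0) < 0" using R by (simp add: mult_pos_neg)
        with l_der show "\<exists>y. (l has_real_derivative y) (at t) \<and> y < 0" by blast
      qed (rule cl)
      then show ?thesis by (simp add: l_def per)
    qed
  qed
  have per_int: "\<exists>t. \<theta>0 \<le> t \<and> t < \<theta>0 + 2*pi \<and> \<gamma> t = \<gamma> \<theta>" for \<theta> \<theta>0
  proof -
    have per_nat: "\<gamma> (\<theta> + real n * (2*pi)) = \<gamma> \<theta>" for \<theta> n
    proof (induction n)
      case (Suc n)
      have "\<theta> + real (Suc n) * (2*pi) = (\<theta> + real n * (2*pi)) + 2*pi" by (simp add: algebra_simps)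
      then show ?case using per[of "\<theta> + real n * (2*pi)"] Suc by (simp add: algebra_simps)
    qed simp
    define k where "k = \<lfloor>(\<theta> - \<theta>0) / (2*pi)\<rfloor>"
    have k: "of_int k * (2*pi) \<le> \<theta> - \<theta>0" "\<theta> - \<theta>0 < (of_int k + 1) * (2*pi)"
      unfolding k_def using floor_divide_lower[of "2*pi" "\<theta> - \<theta>0"] floor_divide_upper[of "2*pi" "\<theta> - \<theta>0"] by auto
    have "\<gamma> (\<theta> - of_int k * (2*pi)) = \<gamma> \<theta>"
    proof (cases "k \<ge> 0")
      case True
      then show ?thesis using per_nat[of "\<theta> - of_int k * (2*pi)" "nat k"] by simp
    next
      case False
      then show ?thesis using per_nat[of \<theta> "nat (- k)"] by simp
    qed
    then show ?thesis using k by (intro exI[of _ "\<theta> - of_int k * (2*pi)"]) (auto simp: algebra_simps)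
  qed
  have strict: "(\<i> * cis (\<phi> \<theta>0)) \<bullet> \<gamma> \<theta>0 < (\<i> * cis (\<phi> \<theta>0)) \<bullet> \<gamma> \<theta>" if "\<gamma> \<theta> \<noteq> \<gamma> \<theta>0" for \<theta> \<theta>0
  proof -
    obtain t where t: "\<theta>0 \<le> t" "t < \<theta>0 + 2*pi" "\<gamma> t = \<gamma> \<theta>" using per_int by blast
    then have "\<theta>0 < t" using that by (cases "t = \<theta>0") auto
    from height[OF this t(2)] show ?thesis using t(3) by (simp add: inner_diff_left inner_commute)
  qed
  define K where "K = convex hull (range \<gamma>)"
  have cont\<gamma>: "continuous_on A \<gamma>" for A
    using der by (meson continuous_at_imp_continuous_on has_vector_derivative_continuous)
  have "range \<gamma> = \<gamma> ` {0..2*pi}"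
  proof (intro equalityI subsetI)
    fix x assume "x \<in> range \<gamma>"
    then obtain \<theta> where "x = \<gamma> \<theta>" by blast
    moreover obtain t where "0 \<le> t" "t < 0 + 2*pi" "\<gamma> t = \<gamma> \<theta>" using per_int by blast
    ultimately show "x \<in> \<gamma> ` {0..2*pi}" by (intro image_eqI[of _ _ t]) auto
  qed auto
  then have "compact (range \<gamma>)" using compact_continuous_image[OF cont\<gamma> compact_Icc] by metis
  then have compK: "compact K" unfolding K_def by (rule compact_convex_hull)
  have convK: "convex K" unfolding K_def by (rule convex_convex_hull)
  have normal: "\<exists>\<theta>0 c. 0 < c \<and> a = c *\<^sub>R (\<i> * cis (\<phi> \<theta>0))" if "a \<noteq> 0" for a
  proof -
    obtain \<theta>0 where "\<phi> \<theta>0 = Arg a - pi/2" using surj by blast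
    then have "\<i> * cis (\<phi> \<theta>0) = cis (Arg a)" by (simp add: complex_eq_iff cos_diff sin_diff)
    moreover have "a = cmod a *\<^sub>R cis (Arg a)" using rcis_cmod_Arg[of a] by (simp add: rcis_def scaleR_conv_of_real)
    ultimately show ?thesis using that by (metis zero_less_norm_iff)
  qed
  have ne: "interior K \<noteq> {}"
  proof
    assume "interior K = {}"
    then obtain a b where ab: "a \<noteq> 0" "K \<subseteq> {x. a \<bullet> x = b}"
      using empty_interior_subset_hyperplane[OF convK] by blast
    obtain \<theta>0 c where c: "0 < c" "a = c *\<^sub>R (\<i> * cis (\<phi> \<theta>0))" using normal[OF ab(1)] by blast
    have inK: "\<gamma> \<theta> \<in> K" for \<theta> unfolding K_def by (simp add: hull_inc)
    define n where "n = \<i> * cis (\<phi> \<theta>0)"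
    \<comment> \<open>\<open>\<theta>0 + 1\<close> is just some parameter strictly inside the
      period, where the height is positive.\<close>
    have "a \<bullet> \<gamma> (\<theta>0 + 1) = b" "a \<bullet> \<gamma> \<theta>0 = b" using subsetD[OF ab(2) inK] by auto
    then have "c * ((\<gamma> (\<theta>0 + 1) - \<gamma> \<theta>0) \<bullet> n) = 0"
      unfolding c(2) n_def[symmetric] inner_commute[of _ n] by (simp add: inner_diff_right right_diff_distrib)
    moreover have "1 < 2 * pi" using pi_gt3 by simp
    then have "0 < (\<gamma> (\<theta>0 + 1) - \<gamma> \<theta>0) \<bullet> n" unfolding n_def by (intro height) auto
    ultimately show False using c(1) by simp
  qed
  have half: "(\<i> * cis (\<phi> \<theta>0)) \<bullet> \<gamma> \<theta>0 \<le> (\<i> * cis (\<phi> \<theta>0)) \<bullet> x" if "x \<in> K" for x \<theta>0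
  proof -
    have "K \<subseteq> {x. (\<i> * cis (\<phi> \<theta>0)) \<bullet> x \<ge> (\<i> * cis (\<phi> \<theta>0)) \<bullet> \<gamma> \<theta>0}"
      unfolding K_def
    proof (intro hull_minimal convex_halfspace_ge)
      show "range \<gamma> \<subseteq> {x. (\<i> * cis (\<phi> \<theta>0)) \<bullet> x \<ge> (\<i> * cis (\<phi> \<theta>0)) \<bullet> \<gamma> \<theta>0}"
      proof (clarify)
        fix \<theta>
        show "(\<i> * cis (\<phi> \<theta>0)) \<bullet> \<gamma> \<theta>0 \<le> (\<i> * cis (\<phi> \<theta>0)) \<bullet> \<gamma> \<theta>"
          using strict[of \<theta> \<theta>0] by (cases "\<gamma> \<theta> = \<gamma> \<theta>0") auto
      qed
    qed
    then show ?thesis using that by blast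
  qed
  have "range \<gamma> = K - interior K"
  proof (intro equalityI subsetI)
    fix x assume "x \<in> range \<gamma>"
    then obtain \<theta>0 where x: "x = \<gamma> \<theta>0" by blast
    have "K \<subseteq> {y. (\<i> * cis (\<phi> \<theta>0)) \<bullet> y \<ge> (\<i> * cis (\<phi> \<theta>0)) \<bullet> x}" using half unfolding x by blast
    from interior_mono[OF this] have "interior K \<subseteq> {y. (\<i> * cis (\<phi> \<theta>0)) \<bullet> y > (\<i> * cis (\<phi> \<theta>0)) \<bullet> x}"
      by (subst (asm) interior_halfspace_ge) auto
    moreover have "x \<in> K" unfolding K_def x by (simp add: hull_inc)
    ultimately show "x \<in> K - interior K" by blast
  next
    fix x assume x: "x \<in> K - interior K"
    then have xK: "x \<in> K" and "x \<notin> rel_interior K" using rel_interior_nonempty_interior[OF ne] by auto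
    obtain a where a: "a \<noteq> 0" "\<And>y. y \<in> K \<Longrightarrow> a \<bullet> x \<le> a \<bullet> y"
      using supporting_hyperplane_rel_boundary[OF convK xK \<open>x \<notin> rel_interior K\<close>] by metis
    obtain \<theta>0 c where c: "0 < c" "a = c *\<^sub>R (\<i> * cis (\<phi> \<theta>0))" using normal[OF a(1)] by blast
    define n where "n = \<i> * cis (\<phi> \<theta>0)"
    have "\<gamma> \<theta>0 \<in> K" unfolding K_def by (simp add: hull_inc)
    then have le: "n \<bullet> x \<le> n \<bullet> \<gamma> \<theta>0" using a(2)[of "\<gamma> \<theta>0"] c by (simp add: n_def)
    \<comment> \<open>The open half plane together with the single point of contact is convex and
      contains the curve, hence contains \<open>K\<close>. So the support line touches
      \<open>K\<close> only at that point of the curve.\<close>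
    have "convex ({y. n \<bullet> y > n \<bullet> \<gamma> \<theta>0} \<union> {\<gamma> \<theta>0})"
      unfolding convex_alt
    proof (intro ballI allI impI)
      fix y z u assume yz: "y \<in> {y. n \<bullet> y > n \<bullet> \<gamma> \<theta>0} \<union> {\<gamma> \<theta>0}" "z \<in> {y. n \<bullet> y > n \<bullet> \<gamma> \<theta>0} \<union> {\<gamma> \<theta>0}"
        and u: "0 \<le> u \<and> u \<le> (1::real)"
      define p where "p = n \<bullet> y - n \<bullet> \<gamma> \<theta>0"
      define q where "q = n \<bullet> z - n \<bullet> \<gamma> \<theta>0"
      have pq: "p > 0 \<or> y = \<gamma> \<theta>0" "q > 0 \<or> z = \<gamma> \<theta>0" "p \<ge> 0" "q \<ge> 0" using yz by (auto simp: p_def q_def)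
      have eq: "n \<bullet> ((1 - u) *\<^sub>R y + u *\<^sub>R z) - n \<bullet> \<gamma> \<theta>0 = (1 - u) * p + u * q"
        by (simp add: p_def q_def algebra_simps inner_add_right)
      have ge: "0 \<le> (1 - u) * p" "0 \<le> u * q" using u pq by auto
      show "(1 - u) *\<^sub>R y + u *\<^sub>R z \<in> {y. n \<bullet> y > n \<bullet> \<gamma> \<theta>0} \<union> {\<gamma> \<theta>0}"
      proof (cases "(1 - u) * p = 0 \<and> u * q = 0")
        case True
        then have "(u = 1 \<or> y = \<gamma> \<theta>0) \<and> (u = 0 \<or> z = \<gamma> \<theta>0)" using pq by auto
        then have "(1 - u) *\<^sub>R y + u *\<^sub>R z = \<gamma> \<theta>0" by (auto simp: algebra_simps)
        then show ?thesis by simp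
      next
        case False
        then have "0 < (1 - u) * p + u * q" using ge by (auto simp: less_le add_nonneg_eq_0_iff)
        then show ?thesis using eq by simp
      qed
    qed
    then have "K \<subseteq> {y. n \<bullet> y > n \<bullet> \<gamma> \<theta>0} \<union> {\<gamma> \<theta>0}"
      unfolding K_def using strict by (intro hull_minimal) (auto simp: n_def)
    then show "x \<in> range \<gamma>" using x le by auto
  qed
  also have "\<dots> = frontier (interior K)"
    unfolding frontier_def convex_closure_interior[OF convK ne]
    using compK by (simp add: closure_closed compact_imp_closed)
  finally show ?thesis
    unfolding convex_curve_def using ne convK compK
    by (intro exI[of _ "interior K"])
       (auto intro: convex_interior bounded_subset[OF compact_imp_bounded interior_subset])
qed

section \<open>Injectivity and turning of the tangent from coefficient sums\<close>

lemma inj_on_near_identity: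
  assumes H: "\<And>z. z \<in> S \<Longrightarrow> (H has_field_derivative H' z) (at z)" and K: "\<And>z. z \<in> S \<Longrightarrow> (K has_field_derivative K' z) (at z)"
    and conv: "convex S" and c: "\<And>z. z \<in> S \<Longrightarrow> cmod (H' z - 1) \<le> c" "\<And>z. z \<in> S \<Longrightarrow> cmod (K' z) \<le> d" and cd: "c + d < 1"
  shows "inj_on (\<lambda>z. H z + cnj (K z)) S"
proof (rule inj_onI, rule ccontr)
  fix z w assume zw: "z \<in> S" "w \<in> S" "H z + cnj (K z) = H w + cnj (K w)" "z \<noteq> w"
  have "cmod ((H z - z) - (H w - w)) \<le> c * cmod (z - w)"
    by (rule field_differentiable_bound[OF conv _ c(1) zw(1,2)])
       (auto intro!: derivative_eq_intros has_field_derivative_at_within[OF H])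
  moreover have "cmod (K z - K w) \<le> d * cmod (z - w)"
    by (rule field_differentiable_bound[OF conv has_field_derivative_at_within[OF K] c(2) zw(1,2)])
  moreover have "z - w = - ((H z - z) - (H w - w)) - cnj (K z - K w)"
    using zw(3) by (simp add: algebra_simps)
  then have "cmod (z - w) \<le> cmod ((H z - z) - (H w - w)) + cmod (K z - K w)"
    by (metis complex_mod_cnj norm_minus_cancel norm_triangle_ineq4)
  ultimately have "1 * cmod (z - w) \<le> (c + d) * cmod (z - w)" by (simp add: algebra_simps)
  then show False using zw(4) cd by (simp add: mult_le_cancel_right)
qed

text \<open>On circles about 0 this is -i times the derivative with respect to the angle; it
  multiplies the n-th coefficient by n.\<close>

definition euler :: "(complex \<Rightarrow> complex) \<Rightarrow> complex \<Rightarrow> complex" where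
  "euler F z = z * deriv F z"

lemma holomorphic_euler:
  assumes "F holomorphic_on ball 0 1" shows "euler F holomorphic_on ball 0 1"
  unfolding euler_def using assms by (intro holomorphic_intros holomorphic_deriv) auto

lemma taylor_euler:
  assumes F: "F holomorphic_on ball 0 1"
  shows "taylor (euler F) n = of_nat n * taylor F n"
proof (rule taylor_unique(1)[of 1])
  fix z :: complex assume z: "z \<in> ball 0 1"
  have "deriv F holomorphic_on ball 0 1" using F by (intro holomorphic_deriv) auto
  from sums_mult[OF taylor_sums[OF this z], of z]
  have "(\<lambda>n. of_nat (Suc n) * taylor F (Suc n) * z ^ Suc n) sums euler F z"
    unfolding taylor_deriv euler_def by (simp add: algebra_simps del: of_nat_Suc)
  then show "(\<lambda>n. of_nat n * taylor F n * z ^ n) sums euler F z"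
    by (subst (asm) sums_Suc_iff) simp
qed simp

lemma summable_taylor_norm:
  assumes F: "F holomorphic_on ball 0 1" and r: "0 \<le> r" "r < 1"
  shows "summable (\<lambda>n. cmod (taylor F n) * r ^ n)"
proof -
  define t where "t = (1 + r) / 2"
  have t: "r < t" "t < 1" "0 \<le> t" using r by (auto simp: t_def)
  have "summable (\<lambda>n. taylor F n * of_real t ^ n)"
    using taylor_sums[OF F, of "of_real t"] t by (auto simp: sums_iff)
  then have "summable (\<lambda>n. norm (taylor F n * of_real r ^ n))"
    by (rule powser_insidea) (use r t in auto)
  then show ?thesis using r by (simp add: norm_mult norm_power)
qed

lemma sums_first_term_bound:
  fixes c :: "nat \<Rightarrow> complex"
  assumes s: "c sums S" and c0: "c 0 = 0" and le: "\<And>n. cmod (c (n + 2)) \<le> d n" and d: "summable d"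
  shows "cmod (S - c 1) \<le> suminf d"
proof -
  have "(\<lambda>n. c (n + 2)) sums (S - c 1)"
    using sums_split_initial_segment[OF s, of 2] c0 by (simp add: numeral_2_eq_2)
  from norm_sums_le[OF this summable_sums[OF d] le] show ?thesis .
qed

text \<open>A number has positive real part exactly if it is closer to 1 than to -1; apply this to
  Y/X - \<alpha> and multiply by |X|. In this form both sides can be estimated by series, without a
  quotient.\<close>

lemma Re_quotient_gt:
  fixes \<alpha> :: real
  assumes "X \<noteq> 0" "cmod (Y - of_real (1 + \<alpha>) * X) < cmod (Y + of_real (1 - \<alpha>) * X)"
  shows "\<alpha> < Re (Y / X)"
proof -
  define w where "w = Y / X - of_real \<alpha>"
  have "Y - of_real (1 + \<alpha>) * X = X * (w - 1)" "Y + of_real (1 - \<alpha>) * X = X * (w + 1)"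
    using assms(1) by (auto simp: w_def field_simps)
  then have "cmod (w - 1) < cmod (w + 1)"
    using assms by (simp only: norm_mult) (simp add: mult_less_cancel_left_pos)
  then have "(cmod (w - 1))\<^sup>2 < (cmod (w + 1))\<^sup>2" by (intro power_strict_mono) auto
  then have "0 < Re w" unfolding cmod_power2 by (simp add: power2_eq_square algebra_simps)
  then show ?thesis by (simp add: w_def)
qed

text \<open>The weight of order \<open>\<alpha>\<close>: full convexity on \<open>|z| = r\<close> follows if the weighted coefficients of index at least
  \<open>2\<close> sum up to less than the weight of the leading term \<open>z\<close>.\<close>

definition weighted_tail :: "real \<Rightarrow> (nat \<Rightarrow> complex) \<Rightarrow> (nat \<Rightarrow> complex) \<Rightarrow> real \<Rightarrow> real" where
  "weighted_tail \<alpha> a b r = (\<Sum>n. (real (n+2) * (real (n+2) - \<alpha>) * cmod (a (n+2)) + real (n+2) * (real (n+2) + \<alpha>) * cmod (b (n+2))) * r ^ (n+2))"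

lemma summable_weights:
  assumes r: "0 \<le> r" "r < 1" and F: "F holomorphic_on ball 0 1"
  shows "summable (\<lambda>n. (x * (real (n+2))\<^sup>2 + y * real (n+2)) * cmod (taylor F (n+2)) * r ^ (n+2))"
proof -
  have 1: "summable (\<lambda>n. real n * cmod (taylor F n) * r ^ n)"
    using summable_taylor_norm[OF holomorphic_euler[OF F] r] by (simp add: taylor_euler[OF F] norm_mult)
  have 2: "summable (\<lambda>n. (real n)\<^sup>2 * cmod (taylor F n) * r ^ n)"
    using summable_taylor_norm[OF holomorphic_euler[OF holomorphic_euler[OF F]] r]
    by (simp add: taylor_euler[OF F] taylor_euler[OF holomorphic_euler[OF F]] norm_mult power2_eq_square mult.assoc)
  have "summable (\<lambda>n. x * ((real n)\<^sup>2 * cmod (taylor F n) * r ^ n) + y * (real n * cmod (taylor F n) * r ^ n))"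
    by (intro summable_add summable_mult 1 2)
  then have "summable (\<lambda>n. (x * (real n)\<^sup>2 + y * real n) * cmod (taylor F n) * r ^ n)"
    by (simp add: algebra_simps)
  then show ?thesis using summable_iff_shift[of "\<lambda>n. (x * (real n)\<^sup>2 + y * real n) * cmod (taylor F n) * r ^ n" 2] by blast
qed

text \<open>One estimate for all the combinations of first and second angular derivatives needed
  below. Nonnegative weights are required so that the norm of each term is the weight times the norm
  of the coefficient.\<close>

lemma weighted_bound:
  assumes z: "cmod z < 1" and F: "F holomorphic_on ball 0 1"
    and pos: "\<And>n. 2 \<le> n \<Longrightarrow> 0 \<le> x * (real n)\<^sup>2 + y * real n"
  shows "cmod ((of_real x * euler (euler F) z + of_real y * euler F z) - of_real (x + y) * taylor F 1 * z)
     \<le> (\<Sum>n. (x * (real (n+2))\<^sup>2 + y * real (n+2)) * cmod (taylor F (n+2)) * cmod z ^ (n+2))"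
proof -
  define c where "c = (\<lambda>n. of_real (x * (real n)\<^sup>2 + y * real n) * taylor F n * z ^ n)"
  have zb: "z \<in> ball 0 1" using z by simp
  have "(\<lambda>n. of_real x * (taylor (euler (euler F)) n * z ^ n) + of_real y * (taylor (euler F) n * z ^ n)) sums
     (of_real x * euler (euler F) z + of_real y * euler F z)"
    by (intro sums_add sums_mult taylor_sums[OF _ zb] holomorphic_euler F)
  then have s: "c sums (of_real x * euler (euler F) z + of_real y * euler F z)"
    by (simp add: c_def taylor_euler[OF F] taylor_euler[OF holomorphic_euler[OF F]] algebra_simps power2_eq_square)
  have "cmod ((of_real x * euler (euler F) z + of_real y * euler F z) - c 1)
     \<le> (\<Sum>n. (x * (real (n+2))\<^sup>2 + y * real (n+2)) * cmod (taylor F (n+2)) * cmod z ^ (n+2))"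
  proof (rule sums_first_term_bound[OF s])
    fix n
    show "cmod (c (n+2)) \<le> (x * (real (n+2))\<^sup>2 + y * real (n+2)) * cmod (taylor F (n+2)) * cmod z ^ (n+2)"
      unfolding c_def norm_mult norm_power using pos[of "n+2"] by (simp del: of_real_add of_real_mult of_real_power)
  qed (use summable_weights[OF _ z F] in \<open>auto simp: c_def\<close>)
  then show ?thesis by (simp add: c_def)
qed

context
  fixes H K :: "complex \<Rightarrow> complex" and \<alpha> :: real
  assumes H: "H holomorphic_on ball 0 1" and K: "K holomorphic_on ball 0 1"
    and a1: "taylor H 1 = 1" and b1: "taylor K 1 = 0" and \<alpha>: "0 \<le> \<alpha>" "\<alpha> < 1"
begin

lemma weighted_tail_eq:
  assumes r: "0 \<le> r" "r < 1"
  shows "weighted_tail \<alpha> (taylor H) (taylor K) r =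
     (\<Sum>n. (1 * (real (n+2))\<^sup>2 + (- \<alpha>) * real (n+2)) * cmod (taylor H (n+2)) * r ^ (n+2)) +
     (\<Sum>n. (1 * (real (n+2))\<^sup>2 + \<alpha> * real (n+2)) * cmod (taylor K (n+2)) * r ^ (n+2))"
  unfolding weighted_tail_def suminf_add[OF summable_weights[OF r H] summable_weights[OF r K]]
  by (intro arg_cong[of _ _ suminf] ext) (simp add: algebra_simps power2_eq_square)

text \<open>The two norm estimates add up to twice the weighted tail.\<close>

lemma circle_estimates:
  assumes z: "0 < cmod z" "cmod z < 1"
    and tail: "weighted_tail \<alpha> (taylor H) (taylor K) (cmod z) < (1 - \<alpha>) * cmod z"
  defines "X \<equiv> euler H z - cnj (euler K z)" and "Y \<equiv> euler (euler H) z + cnj (euler (euler K) z)"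
  shows "cmod (X / z - 1) < 1" and "\<alpha> < Re (Y / X)"
    and "(\<Sum>n. real (n+2) * cmod (taylor H (n+2)) * cmod z ^ (n+2)) + (\<Sum>n. real (n+2) * cmod (taylor K (n+2)) * cmod z ^ (n+2)) < cmod z"
proof -
  define r where "r = cmod z"
  have r: "0 < r" "0 \<le> r" "r < 1" using z by (auto simp: r_def)
  define \<Sigma> where "\<Sigma> = (\<lambda>F x y. \<Sum>n. (x * (real (n+2))\<^sup>2 + y * real (n+2)) * cmod (taylor F (n+2)) * r ^ (n+2))"
  have add: "\<Sigma> F x y + \<Sigma> F x' y' = \<Sigma> F (x + x') (y + y')" if "F holomorphic_on ball 0 1" for F x y x' y'
    unfolding \<Sigma>_def suminf_add[OF summable_weights[OF r(2,3) that] summable_weights[OF r(2,3) that]]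
    by (intro arg_cong[of _ _ suminf] ext) (simp add: algebra_simps)
  have mult: "\<Sigma> F (c * x) (c * y) = c * \<Sigma> F x y" if "F holomorphic_on ball 0 1" for F c x y
    unfolding \<Sigma>_def suminf_mult[OF summable_weights[OF r(2,3) that], symmetric]
    by (intro arg_cong[of _ _ suminf] ext) (simp add: algebra_simps)
  have mono: "\<Sigma> F x y \<le> \<Sigma> F x' y'"
    if "F holomorphic_on ball 0 1" "\<And>n. 2 \<le> n \<Longrightarrow> x * (real n)\<^sup>2 + y * real n \<le> x' * (real n)\<^sup>2 + y' * real n" for F x y x' y'
    unfolding \<Sigma>_def using r
    by (intro suminf_le summable_weights that(1) mult_right_mono that(2)) auto
  have tail': "\<Sigma> H 1 (- \<alpha>) + \<Sigma> K 1 \<alpha> < (1 - \<alpha>) * r"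
    using tail weighted_tail_eq[OF r(2,3)] unfolding r_def[symmetric] \<Sigma>_def by simp
  have sq: "2 * real n \<le> (real n)\<^sup>2" if "2 \<le> n" for n using that by (simp add: power2_eq_square)
  have bound: "cmod ((of_real x * euler (euler F) z + of_real y * euler F z) - of_real (x + y) * taylor F 1 * z) \<le> \<Sigma> F x y"
    if "F holomorphic_on ball 0 1" "\<And>n. 2 \<le> n \<Longrightarrow> 0 \<le> x * (real n)\<^sup>2 + y * real n" for F x y
    using weighted_bound[OF z(2) that] unfolding \<Sigma>_def r_def by blast
  \<comment> \<open>From n = 2 on, (1-\<alpha>) n is at most either second-order weight, so the tail
    divided by 1-\<alpha> controls the first-order sums.\<close>
  have linear: "\<Sigma> H 0 1 + \<Sigma> K 0 1 < r"
  proof -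
    have "(1 - \<alpha>) * real n \<le> 1 * (real n)\<^sup>2 + (- \<alpha>) * real n" if "2 \<le> n" for n
      using sq[OF that] unfolding left_diff_distrib mult_minus_left by linarith
    then have "(1 - \<alpha>) * \<Sigma> H 0 1 \<le> \<Sigma> H 1 (- \<alpha>)"
      unfolding mult[OF H, symmetric] by (intro mono[OF H]) auto
    moreover have "(1 - \<alpha>) * real n \<le> 1 * (real n)\<^sup>2 + \<alpha> * real n" if "2 \<le> n" for n
    proof -
      have "(1 - \<alpha>) * real n \<le> 2 * real n" "0 \<le> \<alpha> * real n" using \<alpha> by (auto intro!: mult_right_mono)
      then show ?thesis using sq[OF that] by linarith
    qed
    then have "(1 - \<alpha>) * \<Sigma> K 0 1 \<le> \<Sigma> K 1 \<alpha>"
      unfolding mult[OF K, symmetric] by (intro mono[OF K]) auto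
    ultimately have "(1 - \<alpha>) * (\<Sigma> H 0 1 + \<Sigma> K 0 1) < (1 - \<alpha>) * r" using tail' by (simp add: distrib_left)
    then show ?thesis using \<alpha> by (simp add: mult_less_cancel_left_pos)
  qed
  then show "(\<Sum>n. real (n+2) * cmod (taylor H (n+2)) * cmod z ^ (n+2)) + (\<Sum>n. real (n+2) * cmod (taylor K (n+2)) * cmod z ^ (n+2)) < cmod z"
    by (simp add: \<Sigma>_def r_def)
  have "cmod (X - z) \<le> \<Sigma> H 0 1 + \<Sigma> K 0 1"
  proof -
    have "X - z = (euler H z - z) - cnj (euler K z)" by (simp add: X_def)
    also have "cmod \<dots> \<le> cmod (euler H z - z) + cmod (cnj (euler K z))" by (rule norm_triangle_ineq4)
    finally show ?thesis using bound[OF H, of 0 1] bound[OF K, of 0 1] a1 b1 by simp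
  qed
  then have Xz: "cmod (X - z) < cmod z" using linear by (simp add: r_def)
  have "X / z - 1 = (X - z) / z" using z by (auto simp: field_simps)
  then show "cmod (X / z - 1) < 1" using Xz z by (simp add: norm_divide)
  have X0: "X \<noteq> 0" using Xz by auto
  have low: "(2 - \<alpha>) * r - (\<Sigma> H 1 (1 - \<alpha>) + \<Sigma> K 1 (\<alpha> - 1)) \<le> cmod (Y + of_real (1 - \<alpha>) * X)"
  proof -
    define U where "U = euler (euler H) z + of_real (1 - \<alpha>) * euler H z - of_real (2 - \<alpha>) * z"
    \<comment> \<open>\<open>X\<close> contains the coanalytic part with a minus sign; hence the
      linear weight of \<open>K\<close> is opposite to that of \<open>H\<close>.\<close>
    define V where "V = euler (euler K) z + of_real (\<alpha> - 1) * euler K z"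
    have "cmod U \<le> \<Sigma> H 1 (1 - \<alpha>)"
      using bound[OF H, of 1 "1 - \<alpha>"] \<alpha> a1 unfolding U_def by simp
    moreover have "0 \<le> 1 * (real n)\<^sup>2 + (\<alpha> - 1) * real n" if "2 \<le> n" for n
    proof -
      have "0 \<le> \<alpha> * real n" using \<alpha> by simp
      then show ?thesis using sq[OF that] by (simp add: algebra_simps)
    qed
    then have "cmod V \<le> \<Sigma> K 1 (\<alpha> - 1)"
      using bound[OF K, of 1 "\<alpha> - 1"] b1 unfolding V_def by simp
    moreover have "Y + of_real (1 - \<alpha>) * X = of_real (2 - \<alpha>) * z + (U + cnj V)"
      unfolding X_def Y_def U_def V_def by (simp add: algebra_simps)
    moreover have "cmod (of_real (2 - \<alpha>) * z) = (2 - \<alpha>) * r" using \<alpha> by (simp add: norm_mult r_def del: of_real_diff)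
    moreover have "cmod (of_real (2 - \<alpha>) * z) - cmod (U + cnj V) \<le> cmod (of_real (2 - \<alpha>) * z + (U + cnj V))"
      by (rule norm_diff_ineq)
    moreover have "cmod (U + cnj V) \<le> cmod U + cmod V" using norm_triangle_ineq[of U "cnj V"] by simp
    ultimately show ?thesis by simp
  qed
  have high: "cmod (Y - of_real (1 + \<alpha>) * X) \<le> \<alpha> * r + (\<Sigma> H 1 (- 1 - \<alpha>) + \<Sigma> K 1 (1 + \<alpha>))"
  proof -
    define U where "U = euler (euler H) z + of_real (- 1 - \<alpha>) * euler H z - of_real (- \<alpha>) * z"
    define V where "V = euler (euler K) z + of_real (1 + \<alpha>) * euler K z"
    have "0 \<le> 1 * (real n)\<^sup>2 + (- 1 - \<alpha>) * real n" if "2 \<le> n" for n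
    proof -
      have "(1 + \<alpha>) * real n \<le> 2 * real n" using \<alpha> by (intro mult_right_mono) auto
      then show ?thesis using sq[OF that] by (simp add: algebra_simps)
    qed
    then have "cmod U \<le> \<Sigma> H 1 (- 1 - \<alpha>)"
      using bound[OF H, of 1 "- 1 - \<alpha>"] a1 unfolding U_def by simp
    moreover have "cmod V \<le> \<Sigma> K 1 (1 + \<alpha>)"
      using bound[OF K, of 1 "1 + \<alpha>"] \<alpha> b1 unfolding V_def by simp
    moreover have "Y - of_real (1 + \<alpha>) * X = of_real (- \<alpha>) * z + (U + cnj V)"
      unfolding X_def Y_def U_def V_def by (simp add: algebra_simps)
    moreover have "cmod (of_real (- \<alpha>) * z) = \<alpha> * r" using \<alpha> by (simp add: norm_mult r_def)
    moreover have "cmod (of_real (- \<alpha>) * z + (U + cnj V)) \<le> cmod (of_real (- \<alpha>) * z) + cmod (U + cnj V)"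
      by (rule norm_triangle_ineq)
    moreover have "cmod (U + cnj V) \<le> cmod U + cmod V" using norm_triangle_ineq[of U "cnj V"] by simp
    ultimately show ?thesis by simp
  qed
  \<comment> \<open>The leading terms differ by (2-\<alpha>)r - \<alpha> r = 2(1-\<alpha>)r and the
    error sums add up to twice the tail, so the comparison is exactly the assumed
    inequality.\<close>
  have "\<Sigma> H 1 (1 - \<alpha>) + \<Sigma> H 1 (- 1 - \<alpha>) = 2 * \<Sigma> H 1 (- \<alpha>)"
    using add[OF H, of 1 "1 - \<alpha>" 1 "- 1 - \<alpha>"] mult[OF H, of 2 1 "- \<alpha>"] by simp
  moreover have "\<Sigma> K 1 (\<alpha> - 1) + \<Sigma> K 1 (1 + \<alpha>) = 2 * \<Sigma> K 1 \<alpha>"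
    using add[OF K, of 1 "\<alpha> - 1" 1 "1 + \<alpha>"] mult[OF K, of 2 1 \<alpha>] by simp
  ultimately have "cmod (Y - of_real (1 + \<alpha>) * X) < cmod (Y + of_real (1 - \<alpha>) * X)"
    using low high tail' by (simp add: algebra_simps)
  then show "\<alpha> < Re (Y / X)" by (rule Re_quotient_gt[OF X0])
qed

end

text \<open>The tangent at angle t is i X with derivative -Y, so its argument has derivative
  Re(Y/X), which exceeds \<alpha> by \<open>circle_estimates\<close>. As X/z stays within distance 1
  of 1, that argument is globally defined and grows by exactly 2 pi per turn. The first-order sums
  make the map a perturbation of the identity with Lipschitz constant below 1, hence
  injective.\<close>

theorem fully_convex_of_weighted_tail:
  assumes H: "H holomorphic_on ball 0 1" and K: "K holomorphic_on ball 0 1"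
    and a1: "taylor H 1 = 1" and b1: "taylor K 1 = 0" and K0: "K 0 = 0" and \<alpha>: "0 \<le> \<alpha>" "\<alpha> < 1"
    and \<rho>: "\<rho> \<le> 1" and f: "\<And>z. z \<in> ball 0 1 \<Longrightarrow> f z = H z + cnj (K z)"
    and tail: "\<And>r. 0 < r \<Longrightarrow> r < \<rho> \<Longrightarrow> weighted_tail \<alpha> (taylor H) (taylor K) r < (1 - \<alpha>) * r"
  shows "inj_on f (ball 0 \<rho>)" and "fully_convex_of_order \<alpha> \<rho> f"
proof -
  note est = circle_estimates[OF H K a1 b1 \<alpha>]
  have deriv_bound: "cmod (deriv F x - taylor F 1) \<le> (\<Sum>n. real (n+2) * cmod (taylor F (n+2)) * r ^ (n+2)) / r"
    if F: "F holomorphic_on ball 0 1" and r: "0 < r" "r < 1" and x: "cmod x \<le> r" for F x r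
  proof -
    have F': "deriv F holomorphic_on ball 0 1" using F by (intro holomorphic_deriv) auto
    have "x \<in> ball 0 1" using x r by simp
    from sums_split_initial_segment[OF taylor_sums[OF F' this], of 1]
    have s: "(\<lambda>n. of_nat (n+2) * taylor F (n+2) * x ^ (n+1)) sums (deriv F x - taylor F 1)"
      by (simp add: taylor_deriv)
    have sm: "summable (\<lambda>n. real (n+2) * cmod (taylor F (n+2)) * r ^ (n+2))"
      using summable_weights[OF less_imp_le[OF r(1)] r(2) F, of 0 1] by simp
    have eq: "real (n+2) * cmod (taylor F (n+2)) * r ^ (n+1) = real (n+2) * cmod (taylor F (n+2)) * r ^ (n+2) / r" for n
      using r by simp
    have "cmod (deriv F x - taylor F 1) \<le> (\<Sum>n. real (n+2) * cmod (taylor F (n+2)) * r ^ (n+1))"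
    proof (rule norm_sums_le[OF s])
      show "(\<lambda>n. real (n+2) * cmod (taylor F (n+2)) * r ^ (n+1)) sums (\<Sum>n. real (n+2) * cmod (taylor F (n+2)) * r ^ (n+1))"
        unfolding eq by (intro summable_sums summable_divide sm)
      show "cmod (of_nat (n+2) * taylor F (n+2) * x ^ (n+1)) \<le> real (n+2) * cmod (taylor F (n+2)) * r ^ (n+1)" for n
        unfolding norm_mult norm_power norm_of_nat using x by (intro mult_left_mono power_mono) auto
    qed
    also have "\<dots> = (\<Sum>n. real (n+2) * cmod (taylor F (n+2)) * r ^ (n+2)) / r"
      unfolding eq by (intro suminf_divide sm)
    finally show ?thesis .
  qed
  show inj: "inj_on f (ball 0 \<rho>)"
  proof (rule inj_onI)
    fix z w assume zw: "z \<in> ball 0 \<rho>" "w \<in> ball 0 \<rho>" "f z = f w"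
    \<comment> \<open>Halfway between the larger modulus and \<rho>: positive even when both points
      are 0, and still below \<rho>, where the tail estimate applies.\<close>
    define r where "r = (max (cmod z) (cmod w) + \<rho>) / 2"
    have pos: "0 < \<rho>" using zw(1) by (auto intro: le_less_trans[OF norm_ge_zero])
    have r: "0 < r" "r < \<rho>" "cmod z \<le> r" "cmod w \<le> r"
      using zw pos unfolding r_def by (auto simp: max_def add_nonneg_pos)
    have sub: "cball 0 r \<subseteq> ball (0::complex) 1" using r \<rho> by auto
    define c where "c = (\<Sum>n. real (n+2) * cmod (taylor H (n+2)) * r ^ (n+2)) / r"
    define d where "d = (\<Sum>n. real (n+2) * cmod (taylor K (n+2)) * r ^ (n+2)) / r"
    have "inj_on (\<lambda>z. H z + cnj (K z)) (cball 0 r)"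
    proof (rule inj_on_near_identity[where H' = "deriv H" and K' = "deriv K" and c = c and d = d])
      fix x :: complex assume x: "x \<in> cball 0 r"
      then have "x \<in> ball 0 1" using sub by blast
      then show "(H has_field_derivative deriv H x) (at x)" "(K has_field_derivative deriv K x) (at x)"
        using holomorphic_derivI[OF H open_ball] holomorphic_derivI[OF K open_ball] by blast+
      show "cmod (deriv H x - 1) \<le> c"
        using deriv_bound[OF H, of r x] x r \<rho> a1 by (simp add: c_def)
      show "cmod (deriv K x) \<le> d"
        using deriv_bound[OF K, of r x] x r \<rho> b1 by (simp add: d_def)
    next
      have "r * c + r * d < r"
        using est(3)[of "of_real r"] tail[of r] r \<rho> unfolding c_def d_def by simp
      then have "r * (c + d) < r * 1" by (simp add: algebra_simps)
      then show "c + d < 1" using r by (simp add: mult_less_cancel_left_pos)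
    qed simp
    moreover have "H z + cnj (K z) = H w + cnj (K w)"
      using zw(3) f[of z] f[of w] r \<rho> by auto
    ultimately show "z = w" using r by (auto dest: inj_onD)
  qed
  have "harmonic_parts \<rho> f H K"
    unfolding harmonic_parts_def using \<rho> K0 f
    by (auto intro: holomorphic_on_subset[OF H] holomorphic_on_subset[OF K])
  then have hd: "harmonic_in_disk \<rho> f" unfolding harmonic_in_disk_def by blast
  have circle: "convex_curve (f ` sphere 0 r) \<and>
        (\<exists>\<phi>. \<forall>\<theta>. T \<theta> \<noteq> 0 \<and> T \<theta> = of_real (norm (T \<theta>)) * cis (\<phi> \<theta>) \<and>
                 (\<exists>d>\<alpha>. (\<phi> has_real_derivative d) (at \<theta>)))"
    if r: "0 < r" "r < \<rho>" and T: "T = (\<lambda>\<theta>. vector_derivative (\<lambda>t. f (of_real r * cis t)) (at \<theta>))" for r T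
  proof -
    have der_cis: "((\<lambda>t. cis (c * t)) has_vector_derivative of_real c * \<i> * cis (c * t)) (at t)" for c t
    proof -
      have "((\<lambda>t. c * t) has_derivative (\<lambda>u. c * u)) (at t)" by (auto intro!: derivative_eq_intros)
      from has_derivative_cis[OF this] show ?thesis
        by (simp add: has_vector_derivative_def scaleR_conv_of_real algebra_simps)
    qed
    define Z where "Z = (\<lambda>t. of_real r * cis t)"
    have Z: "cmod (Z t) = r" "Z t \<in> ball 0 1" "Z t \<noteq> 0" for t using r \<rho> by (auto simp: Z_def norm_mult)
    have derZ: "(Z has_vector_derivative \<i> * Z t) (at t)" for t
      using has_vector_derivative_mult_right[OF der_cis[of 1 t], of "of_real r"] by (simp add: Z_def algebra_simps)
    have derF: "((\<lambda>t. F (Z t)) has_vector_derivative \<i> * euler F (Z t)) (at t)" if F: "F holomorphic_on ball 0 1" for F t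
    proof -
      have "(F has_field_derivative deriv F (Z t)) (at (Z t))"
        by (rule holomorphic_derivI[OF F _ Z(2)]) simp
      from field_vector_diff_chain_at[OF derZ this] show ?thesis by (simp add: o_def euler_def mult_ac)
    qed
    define X where "X = (\<lambda>t. euler H (Z t) - cnj (euler K (Z t)))"
    define Y where "Y = (\<lambda>t. euler (euler H) (Z t) + cnj (euler (euler K) (Z t)))"
    have estX: "cmod (X t / Z t - 1) < 1" and estY: "\<alpha> < Re (Y t / X t)" for t
      using est(1,2)[of "Z t"] tail[OF r] r \<rho> Z unfolding X_def Y_def by auto
    have f_eq: "(\<lambda>t. f (Z t)) = (\<lambda>t. H (Z t) + cnj (K (Z t)))" using f Z(2) by (intro ext) blast
    have der\<gamma>: "((\<lambda>t. f (Z t)) has_vector_derivative \<i> * X t) (at t)" for t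
    proof -
      have "((\<lambda>t. H (Z t) + cnj (K (Z t))) has_vector_derivative \<i> * euler H (Z t) + cnj (\<i> * euler K (Z t))) (at t)"
        by (intro has_vector_derivative_add derF[OF H] bounded_linear.has_vector_derivative[OF bounded_linear_cnj] derF[OF K])
      then show ?thesis unfolding f_eq X_def by (simp add: algebra_simps)
    qed
    have TX: "T t = \<i> * X t" for t
      unfolding T using vector_derivative_at[OF der\<gamma>[of t]] by (simp add: Z_def)
    have derX: "(X has_vector_derivative \<i> * Y t) (at t)" for t
    proof -
      have "(X has_vector_derivative \<i> * euler (euler H) (Z t) - cnj (\<i> * euler (euler K) (Z t))) (at t)"
        unfolding X_def
        by (intro has_vector_derivative_diff derF holomorphic_euler H K bounded_linear.has_vector_derivative[OF bounded_linear_cnj])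
      then show ?thesis unfolding Y_def by (simp add: algebra_simps)
    qed
    \<comment> \<open>\<open>E\<close> is X/Z, the tangent with the rotation of the circle removed.
      It stays in the right half plane, so the principal logarithm is smooth along it and returns to
      its value after one turn.\<close>
    define E where "E = (\<lambda>t. X t * cis (- t) / of_real r)"
    have E_eq: "E t = X t / Z t" for t
      by (simp add: E_def Z_def cis_divide[symmetric] divide_simps flip: cis_inverse)
    have ReE: "0 < Re (E t)" for t
      using estX[of t] abs_Re_le_cmod[of "X t / Z t - 1"] by (simp add: E_eq)
    have X0: "X t \<noteq> 0" for t using ReE[of t] by (auto simp: E_eq)
    have derE: "(E has_vector_derivative E t * (\<i> * (Y t / X t) - \<i>)) (at t)" for t
    proof -
      have c: "((\<lambda>t. cis (- t) / of_real r) has_vector_derivative - \<i> * cis (- t) / of_real r) (at t)"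
        using has_vector_derivative_mult_right[OF der_cis[of "- 1" t], of "1 / of_real r"] by simp
      have "((\<lambda>t. X t * (cis (- t) / of_real r)) has_vector_derivative X t * (- \<i> * cis (- t) / of_real r) + \<i> * Y t * (cis (- t) / of_real r)) (at t)"
        by (rule has_vector_derivative_mult[OF derX c])
      moreover have "X t * (- \<i> * cis (- t) / of_real r) + \<i> * Y t * (cis (- t) / of_real r) = E t * (\<i> * (Y t / X t) - \<i>)"
        using X0[of t] r by (simp add: E_def field_simps)
      ultimately show ?thesis by (simp add: E_def)
    qed
    \<comment> \<open>The tangent is i Z E, so its argument is the sum of pi/2, the angle t and the
      argument of \<open>E\<close>.\<close>
    define \<phi> where "\<phi> = (\<lambda>t. t + pi/2 + Im (Ln (E t)))"
    have der\<phi>: "(\<phi> has_real_derivative Re (Y t / X t)) (at t)" for t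
    proof -
      have "E t \<notin> \<real>\<^sub>\<le>\<^sub>0" using ReE[of t] by (auto simp: complex_nonpos_Reals_iff)
      then have "(Ln has_field_derivative inverse (E t)) (at (E t))" by (rule has_field_derivative_Ln)
      then have "(Ln \<circ> E has_vector_derivative E t * (\<i> * (Y t / X t) - \<i>) * inverse (E t)) (at t)"
        by (rule field_vector_diff_chain_at[OF derE])
      moreover have "E t * (\<i> * (Y t / X t) - \<i>) * inverse (E t) = \<i> * (Y t / X t) - \<i>"
        using ReE[of t] by (subst divide_inverse[symmetric]) (rule nonzero_mult_div_cancel_left, auto)
      ultimately have "((\<lambda>t. Ln (E t)) has_vector_derivative \<i> * (Y t / X t) - \<i>) (at t)"
        by (simp only: o_def)
      from bounded_linear.has_vector_derivative[OF bounded_linear_Im this]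
      have "((\<lambda>t. Im (Ln (E t))) has_real_derivative Re (Y t / X t) - 1) (at t)"
        by (simp add: has_real_derivative_iff_has_vector_derivative del: times_divide_eq_right)
      moreover have "((\<lambda>t. t + pi/2) has_real_derivative 1) (at t)" by (auto intro!: derivative_eq_intros)
      ultimately show ?thesis unfolding \<phi>_def using DERIV_add by fastforce
    qed
    have polar: "T t = of_real (r * cmod (E t)) * cis (\<phi> t)" for t
    proof -
      have "E t \<noteq> 0" using ReE[of t] by auto
      then have "E t = exp (Ln (E t))" by simp
      also have "\<dots> = of_real (cmod (E t)) * cis (Im (Ln (E t)))"
        using \<open>E t \<noteq> 0\<close> by (subst exp_eq_polar) simp
      finally have E: "E t = of_real (cmod (E t)) * cis (Im (Ln (E t)))" .
      have "T t = \<i> * (Z t * E t)" using Z(3) by (simp add: TX E_eq)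
      also have "\<dots> = \<i> * (of_real r * cis t * (of_real (cmod (E t)) * cis (Im (Ln (E t)))))"
        by (subst E) (simp add: Z_def)
      also have "\<dots> = of_real (r * cmod (E t)) * (\<i> * (cis t * cis (Im (Ln (E t)))))" by simp
      also have "\<i> * (cis t * cis (Im (Ln (E t)))) = cis (\<phi> t)"
        unfolding cis_mult \<phi>_def by (simp add: complex_eq_iff cos_add sin_add algebra_simps)
      finally show ?thesis .
    qed
    have Rpos: "0 < r * cmod (E t)" for t
    proof -
      have "E t \<noteq> 0" using ReE[of t] by auto
      then show ?thesis using r by simp
    qed
    have nT: "cmod (T t) = r * cmod (E t)" for t unfolding polar using r by (simp add: norm_mult)
    have Zper: "Z (t + 2*pi) = Z t" for t by (simp add: Z_def cis.ctr)
    have "convex_curve (range (\<lambda>t. f (Z t)))"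
    proof (rule convex_curve_of_increasing_tangent)
      fix t
      show "((\<lambda>t. f (Z t)) has_vector_derivative T t) (at t)" using der\<gamma> by (simp add: TX)
      show "T t = of_real (r * cmod (E t)) * cis (\<phi> t)" by (rule polar)
      show "0 < r * cmod (E t)" by (rule Rpos)
      show "(\<phi> has_real_derivative Re (Y t / X t)) (at t)" by (rule der\<phi>)
      show "0 < Re (Y t / X t)" using estY[of t] \<alpha> by simp
      show "\<phi> (t + 2*pi) = \<phi> t + 2*pi" by (simp add: \<phi>_def E_eq X_def Zper)
      show "f (Z (t + 2*pi)) = f (Z t)" by (simp add: Zper)
    qed
    moreover have "range (\<lambda>t. f (Z t)) = f ` sphere 0 r"
    proof -
      have "range Z = sphere 0 r"
      proof (intro equalityI subsetI)
        fix z :: complex assume "z \<in> sphere 0 r"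
        then have "z = Z (Arg z)" using rcis_cmod_Arg[of z] by (simp add: Z_def rcis_def)
        then show "z \<in> range Z" by blast
      qed (auto simp: Z)
      then show ?thesis by (metis image_image)
    qed
    moreover have "T \<theta> \<noteq> 0 \<and> T \<theta> = of_real (norm (T \<theta>)) * cis (\<phi> \<theta>) \<and> (\<exists>d>\<alpha>. (\<phi> has_real_derivative d) (at \<theta>))" for \<theta>
      using nT[of \<theta>] Rpos[of \<theta>] polar[of \<theta>] der\<phi>[of \<theta>] estY[of \<theta>] by auto
    ultimately show ?thesis by metis
  qed
  show "fully_convex_of_order \<alpha> \<rho> f"
    unfolding fully_convex_of_order_def Let_def
  proof (intro conjI hd allI impI)
    fix r assume r: "0 < r \<and> r < \<rho>"
    then show "inj_on f (sphere 0 r)" by (intro inj_on_subset[OF inj]) auto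
    show "convex_curve (f ` sphere 0 r)" using circle[of r, OF _ _ refl] r by blast
    show "\<exists>\<phi>. \<forall>\<theta>. vector_derivative (\<lambda>t. f (of_real r * cis t)) (at \<theta>) \<noteq> 0 \<and>
       vector_derivative (\<lambda>t. f (of_real r * cis t)) (at \<theta>) =
         of_real (norm (vector_derivative (\<lambda>t. f (of_real r * cis t)) (at \<theta>))) * cis (\<phi> \<theta>) \<and>
       (\<exists>d>\<alpha>. (\<phi> has_real_derivative d) (at \<theta>))" using circle[of r, OF _ _ refl] r by blast
  qed
qed

section \<open>Generating functions of n^2 and n^4\<close>

lemma euler_quotient:
  assumes p: "\<And>z. (p has_field_derivative p' z) (at z)" and z: "z \<in> ball 0 1"
  shows "euler (\<lambda>z. p z / (1 - z) ^ k) z = z * (p' z * (1 - z) + of_nat k * p z) / (1 - z) ^ Suc k"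
proof -
  have nz: "1 - z \<noteq> 0" using z by auto
  have "((\<lambda>z. p z / (1 - z) ^ k) has_field_derivative (p' z * (1 - z) + of_nat k * p z) / (1 - z) ^ Suc k) (at z)"
  proof (cases k)
    case 0
    then show ?thesis using p[of z] nz by simp
  next
    case (Suc m)
    have q: "((\<lambda>z. (1 - z) ^ k) has_field_derivative of_nat k * (- 1 * (1 - z) ^ m)) (at z)"
    proof -
      have "((\<lambda>z. 1 - z) has_field_derivative - 1) (at z)" by (auto intro!: derivative_eq_intros)
      from DERIV_power[OF this, of k] show ?thesis unfolding Suc by (simp del: of_nat_Suc power_Suc)
    qed
    have "((\<lambda>z. p z / (1 - z) ^ k) has_field_derivative
       (p' z * (1 - z) ^ k - p z * (of_nat k * (- 1 * (1 - z) ^ m))) / ((1 - z) ^ k * (1 - z) ^ k)) (at z)"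
      by (rule DERIV_divide[OF p q]) (use nz in simp)
    moreover have "(p' z * (1 - z) ^ k - p z * (of_nat k * (- 1 * (1 - z) ^ m))) / ((1 - z) ^ k * (1 - z) ^ k)
       = (p' z * (1 - z) + of_nat k * p z) / (1 - z) ^ Suc k"
      using nz unfolding Suc by (simp add: divide_simps) (simp add: algebra_simps)
    ultimately show ?thesis by simp
  qed
  then show ?thesis unfolding euler_def by (simp add: DERIV_imp_deriv)
qed

text \<open>Applying \<open>euler\<close> repeatedly to the geometric series multiplies its
  coefficients by n each time. The numerators in \<open>G\<close> are the Eulerian polynomials times
  z; \<open>G\<close> serves for k \<le> 4 only, larger indices merely repeating the last
  numerator.\<close>

lemma power_series_moments:
  fixes r :: real
  assumes r: "0 \<le> r" "r < 1"
  shows "(\<lambda>n. real n ^ 2 * r ^ n) sums (r * (1 + r) / (1 - r) ^ 3)"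
    and "(\<lambda>n. real n ^ 4 * r ^ n) sums (r * (1 + r) * (1 + 10 * r + r\<^sup>2) / (1 - r) ^ 5)"
proof -
  define G :: "nat \<Rightarrow> complex \<Rightarrow> complex" where
    "G = (\<lambda>k z. (if k = 0 then 1 else if k = 1 then z else if k = 2 then z * (1 + z)
        else if k = 3 then z * (1 + 4 * z + z\<^sup>2) else z * (1 + z) * (1 + 10 * z + z\<^sup>2)) / (1 - z) ^ Suc k)"
  have hol: "G k holomorphic_on ball 0 1" for k
    unfolding G_def by (cases "k = 0"; cases "k = 1"; cases "k = 2"; cases "k = 3"; force intro!: holomorphic_intros)
  have step: "euler (G k) z = G (Suc k) z" if "k < 4" "z \<in> ball 0 1" for k z
  proof -
    consider "k = 0" | "k = 1" | "k = 2" | "k = 3" using \<open>k < 4\<close> by linarith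
    then show ?thesis
    proof cases
      case 1
      have "euler (\<lambda>z. 1 / (1 - z) ^ 1) z = z * (0 * (1 - z) + of_nat 1 * 1) / (1 - z) ^ Suc 1"
        by (rule euler_quotient[OF _ that(2)]) (auto intro!: derivative_eq_intros)
      then show ?thesis by (simp add: 1 G_def)
    next
      case 2
      have "euler (\<lambda>z. z / (1 - z) ^ 2) z = z * (1 * (1 - z) + of_nat 2 * z) / (1 - z) ^ Suc 2"
        by (rule euler_quotient[OF _ that(2)]) (auto intro!: derivative_eq_intros)
      then show ?thesis by (simp add: 2 G_def numeral_2_eq_2 numeral_3_eq_3)
    next
      case 3
      have "euler (\<lambda>z. z * (1 + z) / (1 - z) ^ 3) z = z * ((1 + 2 * z) * (1 - z) + of_nat 3 * (z * (1 + z))) / (1 - z) ^ Suc 3"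
        by (rule euler_quotient[OF _ that(2)]) (auto intro!: derivative_eq_intros)
      also have "(1 + 2 * z) * (1 - z) + of_nat 3 * (z * (1 + z)) = 1 + 4 * z + z\<^sup>2" by (simp add: algebra_simps power2_eq_square)
      finally show ?thesis by (simp add: 3 G_def eval_nat_numeral)
    next
      case 4
      have "euler (\<lambda>z. z * (1 + 4 * z + z\<^sup>2) / (1 - z) ^ 4) z = z * ((1 + 8 * z + 3 * z\<^sup>2) * (1 - z) + of_nat 4 * (z * (1 + 4 * z + z\<^sup>2))) / (1 - z) ^ Suc 4"
        by (rule euler_quotient[OF _ that(2)]) (auto intro!: derivative_eq_intros simp: algebra_simps power2_eq_square)
      also have "(1 + 8 * z + 3 * z\<^sup>2) * (1 - z) + of_nat 4 * (z * (1 + 4 * z + z\<^sup>2)) = (1 + z) * (1 + 10 * z + z\<^sup>2)"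
        by (simp add: algebra_simps power2_eq_square)
      finally show ?thesis by (simp add: 4 G_def eval_nat_numeral mult.assoc)
    qed
  qed
  have t0: "taylor (G 0) n = 1" for n
  proof (rule taylor_unique(1)[of 1])
    fix z :: complex assume "z \<in> ball 0 1"
    then show "(\<lambda>n. 1 * z ^ n) sums G 0 z" using geometric_sums[of z] by (simp add: G_def)
  qed simp
  have t: "taylor (G k) n = of_nat n ^ k" if "k \<le> 4" for k n
    using that
  proof (induction k)
    case (Suc k)
    have "taylor (G (Suc k)) n = taylor (euler (G k)) n"
      using Suc.prems step by (intro taylor_cong[OF hol]) auto
    also have "\<dots> = of_nat n * of_nat n ^ k" using Suc by (simp add: taylor_euler[OF hol])
    finally show ?case by simp
  qed (simp add: t0)
  have in_ball: "complex_of_real r \<in> ball 0 1" using r by simp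
  have s2: "complex_of_real (real n ^ 2 * r ^ n) = taylor (G 2) n * of_real r ^ n"
    and s4: "complex_of_real (real n ^ 4 * r ^ n) = taylor (G 4) n * of_real r ^ n" for n by (simp_all add: t)
  have v2: "complex_of_real (r * (1 + r) / (1 - r) ^ 3) = G 2 (of_real r)" by (simp add: G_def eval_nat_numeral)
  have v4: "complex_of_real (r * (1 + r) * (1 + 10 * r + r\<^sup>2) / (1 - r) ^ 5) = G 4 (of_real r)"
    by (simp add: G_def eval_nat_numeral)
  have "(\<lambda>n. complex_of_real (real n ^ 2 * r ^ n)) sums complex_of_real (r * (1 + r) / (1 - r) ^ 3)"
    unfolding s2 v2 by (rule taylor_sums[OF hol in_ball])
  then show "(\<lambda>n. real n ^ 2 * r ^ n) sums (r * (1 + r) / (1 - r) ^ 3)" by (simp only: sums_of_real_iff)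
  have "(\<lambda>n. complex_of_real (real n ^ 4 * r ^ n)) sums complex_of_real (r * (1 + r) * (1 + 10 * r + r\<^sup>2) / (1 - r) ^ 5)"
    unfolding s4 v4 by (rule taylor_sums[OF hol in_ball])
  then show "(\<lambda>n. real n ^ 4 * r ^ n) sums (r * (1 + r) * (1 + 10 * r + r\<^sup>2) / (1 - r) ^ 5)" by (simp only: sums_of_real_iff)
qed

section \<open>The radius and the convolution\<close>

definition s0_poly :: "real \<Rightarrow> real \<Rightarrow> real" where
  "s0_poly \<alpha> r = 2 * (1 - \<alpha>) * (1 - r) ^ 5 + \<alpha> * (1 + r) * (1 - r)\<^sup>2 - (1 + r) * (r\<^sup>2 + 4 * r + 1)"

lemma s0_poly_strict_antimono:
  assumes \<alpha>: "0 \<le> \<alpha>" "\<alpha> < 1" and r: "0 \<le> r" "r < s" "s \<le> 1"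
  shows "s0_poly \<alpha> s < s0_poly \<alpha> r"
proof -
  have "(1 - s) ^ 5 \<le> (1 - r) ^ 5" using r by (intro power_mono) auto
  then have 1: "2 * (1 - \<alpha>) * (1 - s) ^ 5 \<le> 2 * (1 - \<alpha>) * (1 - r) ^ 5" using \<alpha> by (intro mult_left_mono) auto
  have "r\<^sup>2 \<le> s\<^sup>2" "s\<^sup>2 \<le> 1" "r\<^sup>2 \<le> 1" using r by (auto intro!: power_mono power_le_one)
  \<comment> \<open>The factor (1+s)(1-s)^2 is written as (1-s^2)(1-s), a product of two nonnegative
    decreasing functions.\<close>
  then have "(1 - s\<^sup>2) * (1 - s) \<le> (1 - r\<^sup>2) * (1 - r)" using r by (intro mult_mono) auto
  then have "\<alpha> * ((1 - s\<^sup>2) * (1 - s)) \<le> \<alpha> * ((1 - r\<^sup>2) * (1 - r))" using \<alpha> by (intro mult_left_mono) auto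
  then have 2: "\<alpha> * (1 + s) * (1 - s)\<^sup>2 \<le> \<alpha> * (1 + r) * (1 - r)\<^sup>2" by (simp add: algebra_simps power2_eq_square)
  have "(1 + r) * (r\<^sup>2 + 4 * r + 1) < (1 + s) * (s\<^sup>2 + 4 * s + 1)"
  proof (rule mult_strict_mono)
    show "r\<^sup>2 + 4 * r + 1 < s\<^sup>2 + 4 * s + 1" using r \<open>r\<^sup>2 \<le> s\<^sup>2\<close> by linarith
  qed (use r in auto)
  then show ?thesis unfolding s0_poly_def using 1 2 by linarith
qed

lemma s0_unique_root:
  assumes \<alpha>: "0 \<le> \<alpha>" "\<alpha> < 1"
  shows "\<exists>!r. r \<in> {0<..<1} \<and> s0_equation \<alpha> r"
proof -
  have eq: "s0_equation \<alpha> r \<longleftrightarrow> s0_poly \<alpha> r = 0" for r by (simp add: s0_equation_def s0_poly_def)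
  have p0: "s0_poly \<alpha> 0 = 1 - \<alpha>" and p1: "s0_poly \<alpha> 1 = - 12" by (simp_all add: s0_poly_def)
  have "\<exists>r\<ge>0. r \<le> 1 \<and> s0_poly \<alpha> r = 0"
    by (rule IVT2') (use \<alpha> p0 p1 in \<open>auto simp: s0_poly_def intro!: continuous_intros\<close>)
  then obtain r where r: "0 \<le> r" "r \<le> 1" "s0_poly \<alpha> r = 0" by blast
  have "r \<noteq> 0" "r \<noteq> 1" using r p0 p1 \<alpha> by auto
  with r have "r \<in> {0<..<1}" by auto
  moreover have "s = r" if "s \<in> {0<..<1}" "s0_poly \<alpha> s = 0" for s
    using s0_poly_strict_antimono[OF \<alpha>, of r s] s0_poly_strict_antimono[OF \<alpha>, of s r] r that by (cases s r rule: linorder_cases) auto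
  ultimately show ?thesis unfolding eq using r by blast
qed

lemma s0_properties:
  assumes \<alpha>: "0 \<le> \<alpha>" "\<alpha> < 1"
  shows "0 < s0 \<alpha>" "s0 \<alpha> < 1" "s0_poly \<alpha> (s0 \<alpha>) = 0"
  using theI'[OF s0_unique_root[OF \<alpha>]] unfolding s0_def[symmetric] by (auto simp: s0_equation_def s0_poly_def)

lemma s0_poly_pos:
  assumes "0 \<le> \<alpha>" "\<alpha> < 1" "0 \<le> r" "r < s0 \<alpha>"
  shows "0 < s0_poly \<alpha> r"
  using s0_poly_strict_antimono[of \<alpha> r "s0 \<alpha>"] s0_properties[of \<alpha>] assms by auto

lemma s0_zero_approx: "\<bar>s0 0 - 0.0712543\<bar> \<le> 0.00000005"
proof -
  \<comment> \<open>The two rationals are 0.0712543 minus and plus 0.00000005; the polynomial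
    changes sign between them, and it is decreasing.\<close>
  have lo: "0 < s0_poly 0 0.07125425" and hi: "s0_poly 0 0.07125435 < 0"
    by (simp_all add: s0_poly_def power2_eq_square eval_nat_numeral)
  have "0.07125425 \<le> s0 0"
    using s0_poly_strict_antimono[of 0 "s0 0" "0.07125425"] s0_properties[of 0] lo by (cases "s0 0 < 0.07125425") auto
  moreover have "s0 0 \<le> 0.07125435"
    using s0_poly_strict_antimono[of 0 "0.07125435" "s0 0"] s0_properties[of 0] hi by (cases "0.07125435 < s0 0") auto
  ultimately show ?thesis by (auto simp: abs_if)
qed

text \<open>With the extremal coefficients the weights simplify to (n^4 + (1-2\<alpha>)n^2)/2. The
  term n = 1 of the full series equals (1-\<alpha>)r, so the claim becomes S < 2(1-\<alpha>)r for
  the full sum S. In closed form 2(1-\<alpha>)r - S is r times \<open>s0_poly \<alpha> r\<close>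
  divided by (1-r)^5, which is positive below the root.\<close>

lemma weighted_tail_products:
  assumes \<alpha>: "0 \<le> \<alpha>" "\<alpha> < 1" and r: "0 < r" "r < s0 \<alpha>"
    and a: "\<And>n. 1 \<le> n \<Longrightarrow> cmod (a n) \<le> ((real n + 1) / 2)\<^sup>2"
    and b: "\<And>n. 1 \<le> n \<Longrightarrow> cmod (b n) \<le> ((real n - 1) / 2)\<^sup>2"
  shows "weighted_tail \<alpha> a b r < (1 - \<alpha>) * r"
proof -
  have r1: "r < 1" using r s0_properties[OF \<alpha>] by simp
  define w where "w = (\<lambda>n. ((real n) ^ 4 + (1 - 2 * \<alpha>) * (real n)\<^sup>2) / 2 * r ^ n)"
  define S where "S = (r * (1 + r) * (1 + 10 * r + r\<^sup>2) / (1 - r) ^ 5 + (1 - 2 * \<alpha>) * (r * (1 + r) / (1 - r) ^ 3)) / 2"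
  have "(\<lambda>n. (real n ^ 4 * r ^ n + (1 - 2 * \<alpha>) * (real n ^ 2 * r ^ n)) / 2) sums S"
    unfolding S_def by (intro sums_divide sums_add sums_mult power_series_moments less_imp_le[OF r(1)] r1)
  then have w: "w sums S" by (simp add: w_def algebra_simps add_divide_distrib)
  have "w 0 + w 1 = (1 - \<alpha>) * r" by (simp add: w_def)
  with sums_split_initial_segment[OF w, of 2] have w2: "(\<lambda>n. w (n + 2)) sums (S - (1 - \<alpha>) * r)"
    by (simp add: numeral_2_eq_2)
  define v where "v = (\<lambda>n. (real (n+2) * (real (n+2) - \<alpha>) * cmod (a (n+2)) + real (n+2) * (real (n+2) + \<alpha>) * cmod (b (n+2))) * r ^ (n+2))"
  have le: "v n \<le> w (n + 2)" for n
  proof -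
    define m where "m = real (n + 2)"
    have m: "2 \<le> m" by (simp add: m_def)
    have "m * (m - \<alpha>) * cmod (a (n+2)) + m * (m + \<alpha>) * cmod (b (n+2)) \<le> m * (m - \<alpha>) * ((m + 1) / 2)\<^sup>2 + m * (m + \<alpha>) * ((m - 1) / 2)\<^sup>2"
      using a[of "n+2"] b[of "n+2"] m \<alpha> unfolding m_def by (intro add_mono mult_left_mono mult_nonneg_nonneg) auto
    also have "\<dots> = (m ^ 4 + (1 - 2 * \<alpha>) * m\<^sup>2) / 2"
      by (simp add: power2_eq_square power4_eq_xxxx field_simps)
    finally show ?thesis unfolding v_def w_def m_def[symmetric] using r by (intro mult_right_mono) auto
  qed
  have nn: "0 \<le> v n" for n
    unfolding v_def using \<alpha> r by (intro mult_nonneg_nonneg add_nonneg_nonneg) auto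
  have "summable v"
    by (rule summable_comparison_test'[OF sums_summable[OF w2], of 0]) (use nn le in \<open>simp only: real_norm_def abs_of_nonneg\<close>)
  then have "suminf v \<le> (\<Sum>n. w (n + 2))" by (intro suminf_le le sums_summable[OF w2])
  then have "weighted_tail \<alpha> a b r \<le> S - (1 - \<alpha>) * r"
    using sums_unique[OF w2] by (simp add: weighted_tail_def v_def)
  moreover have "S < 2 * (1 - \<alpha>) * r"
  proof -
    have p: "0 < s0_poly \<alpha> r" using s0_poly_pos[OF \<alpha> _ r(2)] r by simp
    have d: "0 < 1 - r" using r1 by simp
    have "x / (1 - r) ^ 3 = x * (1 - r)\<^sup>2 / (1 - r) ^ 5" for x
    proof -
      have eq: "(1 - r) ^ 5 = (1 - r) ^ 3 * (1 - r)\<^sup>2" by (simp flip: power_add)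
      have "(1 - r)\<^sup>2 \<noteq> 0" using d by simp
      from nonzero_mult_divide_mult_cancel_right[OF this, of x "(1 - r) ^ 3"] show ?thesis by (simp only: eq)
    qed
    then have "S = (r * (1 + r) * (1 + 10 * r + r\<^sup>2) + (1 - 2 * \<alpha>) * (r * (1 + r) * (1 - r)\<^sup>2)) / (1 - r) ^ 5 / 2"
      unfolding S_def by (simp only: add_divide_distrib times_divide_eq_right)
    also have "r * (1 + r) * (1 + 10 * r + r\<^sup>2) + (1 - 2 * \<alpha>) * (r * (1 + r) * (1 - r)\<^sup>2)
        = 2 * (2 * (1 - \<alpha>) * r * (1 - r) ^ 5 - r * s0_poly \<alpha> r)"
      unfolding s0_poly_def by (simp add: algebra_simps power2_eq_square)
    also have "2 * (2 * (1 - \<alpha>) * r * (1 - r) ^ 5 - r * s0_poly \<alpha> r) / (1 - r) ^ 5 / 2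
        = 2 * (1 - \<alpha>) * r - r * s0_poly \<alpha> r / (1 - r) ^ 5"
      using d by (simp add: diff_divide_distrib)
    also have "\<dots> < 2 * (1 - \<alpha>) * r" using p d r by simp
    finally show ?thesis .
  qed
  moreover have "2 * (1 - \<alpha>) * r = (1 - \<alpha>) * r + (1 - \<alpha>) * r" by simp
  ultimately show ?thesis by linarith
qed

lemma class_KH0_coefficients:
  assumes "f \<in> class_KH0"
  shows "analytic_coeff f 0 = 0" "analytic_coeff f 1 = 1" "coanalytic_coeff f 0 = 0" "coanalytic_coeff f 1 = 0"
    and "\<And>n. 1 \<le> n \<Longrightarrow> cmod (analytic_coeff f n) \<le> (real n + 1) / 2"
    and "\<And>n. 1 \<le> n \<Longrightarrow> cmod (coanalytic_coeff f n) \<le> (real n - 1) / 2"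
proof -
  have inj: "inj_on f (ball 0 1)" and conv: "convex (f ` ball 0 1)" and wb: "wirtinger_bar f 0 = 0"
    using assms by (auto simp: class_KH0_def class_SH_def)
  obtain h g where hg: "harmonic_parts 1 f h g" and h0: "h 0 = 0" and dh: "deriv h 0 = 1"
    and lt: "\<And>z. z \<in> ball 0 1 \<Longrightarrow> norm (deriv g z) < norm (deriv h z)"
    using assms by (auto simp: class_KH0_def class_SH_def)
  then have h: "h holomorphic_on ball 0 1" and g: "g holomorphic_on ball 0 1" and g0: "g 0 = 0"
    and f: "\<And>z. z \<in> ball 0 1 \<Longrightarrow> f z = h z + cnj (g z)"
    by (auto simp: harmonic_parts_def)
  \<comment> \<open>The differential of f at 0 is v + cnj (b v) with b = g'(0), so its Wirtinger
    derivative is the conjugate of b.\<close>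
  have dg: "deriv g 0 = 0"
  proof -
    have "(h has_field_derivative 1) (at 0)" using holomorphic_derivI[OF h, of 0] dh by simp
    moreover have "(*) (1::complex) = (\<lambda>v. v)" by (simp add: fun_eq_iff)
    ultimately have 1: "(h has_derivative (\<lambda>v. v)) (at 0)" by (simp only: has_field_derivative_def)
    have "(g has_derivative (*) (deriv g 0)) (at 0)"
      using holomorphic_derivI[OF g, of 0] by (simp add: has_field_derivative_def)
    from has_derivative_add[OF 1 bounded_linear.has_derivative[OF bounded_linear_cnj this]]
    have "(f has_derivative (\<lambda>v. v + cnj (deriv g 0 * v))) (at 0)"
      by (rule has_derivative_transform_within_open[of _ _ _ _ "ball 0 1"]) (use f in auto)
    from frechet_derivative_at[OF this]
    have "frechet_derivative f (at 0) = (\<lambda>v. v + cnj (deriv g 0 * v))" by simp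
    then show ?thesis using wb by (simp add: wirtinger_bar_def algebra_simps)
  qed
  \<comment> \<open>The coefficients are defined through arbitrarily selected parts; uniqueness of
    the decomposition makes these agree with h and g on the disc.\<close>
  define h' where "h' = (SOME h. \<exists>g. harmonic_parts 1 f h g)"
  define g' where "g' = (SOME g. \<exists>h. harmonic_parts 1 f h g)"
  have "\<exists>g. harmonic_parts 1 f h' g" unfolding h'_def using hg by (intro someI[of "\<lambda>h. \<exists>g. harmonic_parts 1 f h g"]) blast
  then have "h z = h' z" if "z \<in> ball 0 1" for z using harmonic_parts_unique(1)[OF hg _ that] by blast
  then have a: "analytic_coeff f n = taylor h n" for n
    using taylor_cong[OF h, of h' n] by (simp add: analytic_coeff_def taylor_def h'_def)
  have "\<exists>h. harmonic_parts 1 f h g'" unfolding g'_def using hg by (intro someI[of "\<lambda>g. \<exists>h. harmonic_parts 1 f h g"]) blast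
  then have "g z = g' z" if "z \<in> ball 0 1" for z using harmonic_parts_unique(2)[OF hg _ that] by blast
  then have b: "coanalytic_coeff f n = taylor g n" for n
    using taylor_cong[OF g, of g' n] by (simp add: coanalytic_coeff_def taylor_def g'_def)
  show "analytic_coeff f 0 = 0" "analytic_coeff f 1 = 1" "coanalytic_coeff f 0 = 0" "coanalytic_coeff f 1 = 0"
    unfolding a b using h0 g0 dh dg by (simp_all add: taylor_def)
  show "cmod (analytic_coeff f n) \<le> (real n + 1) / 2" "cmod (coanalytic_coeff f n) \<le> (real n - 1) / 2" if "1 \<le> n" for n
    unfolding a b using convex_harmonic_coefficient_bounds[OF h g f inj conv lt dh dg that] by auto
qed

lemma power_series_square_bound:
  assumes "\<And>n. cmod (c n) \<le> (real n)\<^sup>2" "z \<in> ball 0 1"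
  shows "(\<lambda>n. c n * z ^ n) sums (\<Sum>n. c n * z ^ n)"
proof (rule summable_sums[OF summable_comparison_test'[where N = 0]])
  show "summable (\<lambda>n. real n ^ 2 * cmod z ^ n)" using power_series_moments(1)[of "cmod z"] assms(2) by (auto intro: sums_summable)
  show "norm (c n * z ^ n) \<le> real n ^ 2 * cmod z ^ n" for n
    unfolding norm_mult norm_power using assms(1) by (intro mult_right_mono) auto
qed

theorem convolution_fully_convex:
  assumes fK: "f \<in> class_KH0" and gK: "g \<in> class_KH0" and \<alpha>: "0 \<le> \<alpha>" "\<alpha> < 1"
  shows "inj_on (harmonic_convolution f g) (ball 0 (s0 \<alpha>))"
    and "fully_convex_of_order \<alpha> (s0 \<alpha>) (harmonic_convolution f g)"
proof -
  define a where "a = (\<lambda>n. analytic_coeff f n * analytic_coeff g n)"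
  define b where "b = (\<lambda>n. coanalytic_coeff f n * coanalytic_coeff g n)"
  define H where "H = (\<lambda>z. \<Sum>n. a n * z ^ n)"
  define K where "K = (\<lambda>z. \<Sum>n. b n * z ^ n)"
  have ale: "cmod (a n) \<le> ((real n + 1) / 2)\<^sup>2" and ble: "cmod (b n) \<le> ((real n - 1) / 2)\<^sup>2" if "1 \<le> n" for n
    unfolding a_def b_def norm_mult power2_eq_square
    by (intro mult_mono class_KH0_coefficients fK gK that; use that in simp)+
  have ab0: "a 0 = 0" "b 0 = 0" and a1: "a 1 = 1" and b1: "b 1 = 0"
    unfolding a_def b_def using class_KH0_coefficients(1-4)[OF fK] class_KH0_coefficients(1-4)[OF gK] by simp_all
  \<comment> \<open>A crude majorant, enough for convergence in the unit disc: (n+1)/2 \<le> n for n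
    \<ge> 1, and both sequences vanish at index 0.\<close>
  have a2: "cmod (a n) \<le> (real n)\<^sup>2" and b2: "cmod (b n) \<le> (real n)\<^sup>2" for n
  proof -
    have "cmod (a n) \<le> (real n)\<^sup>2 \<and> cmod (b n) \<le> (real n)\<^sup>2"
    proof (cases "n = 0")
      case False
      then have n: "1 \<le> n" by simp
      have "((real n + 1) / 2)\<^sup>2 \<le> (real n)\<^sup>2" "((real n - 1) / 2)\<^sup>2 \<le> (real n)\<^sup>2"
        using n by (intro power_mono; simp)+
      then show ?thesis using order_trans[OF ale[OF n]] order_trans[OF ble[OF n]] by blast
    qed (simp add: ab0)
    then show "cmod (a n) \<le> (real n)\<^sup>2" "cmod (b n) \<le> (real n)\<^sup>2" by auto
  qed
  have sH: "(\<lambda>n. a n * z ^ n) sums H z" and sK: "(\<lambda>n. b n * z ^ n) sums K z" if "z \<in> ball 0 1" for z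
    unfolding H_def K_def by (intro power_series_square_bound a2 b2 that)+
  have tH: "taylor H = a" and tK: "taylor K = b"
    using taylor_unique(1)[OF zero_less_one sH] taylor_unique(1)[OF zero_less_one sK] by auto
  have hol: "H holomorphic_on ball 0 1" "K holomorphic_on ball 0 1"
    using taylor_unique(2)[OF zero_less_one sH] taylor_unique(2)[OF zero_less_one sK] by auto
  have K0: "K 0 = 0" using tK ab0(2) by (auto simp: taylor_def dest: fun_cong[of _ _ 0])
  have conv: "harmonic_convolution f g z = H z + cnj (K z)" for z
    by (simp add: harmonic_convolution_def H_def K_def a_def b_def)
  have tail: "weighted_tail \<alpha> (taylor H) (taylor K) r < (1 - \<alpha>) * r" if "0 < r" "r < s0 \<alpha>" for r
    unfolding tH tK using weighted_tail_products[OF \<alpha> that ale ble] .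
  have le1: "s0 \<alpha> \<le> 1" using s0_properties[OF \<alpha>] by simp
  show "inj_on (harmonic_convolution f g) (ball 0 (s0 \<alpha>))"
    and "fully_convex_of_order \<alpha> (s0 \<alpha>) (harmonic_convolution f g)"
    using fully_convex_of_weighted_tail[OF hol _ _ K0 \<alpha> le1 conv tail] a1 b1 tH tK by auto
qed

theorem corollary4p5:
  fixes f g :: "complex \<Rightarrow> complex" and \<alpha> :: real
  assumes "f \<in> class_KH0" and "g \<in> class_KH0"
    and "0 \<le> \<alpha>" and "\<alpha> < 1"
  shows "(\<exists>!r. r \<in> {0<..<1} \<and> s0_equation \<alpha> r) \<and>
         inj_on (harmonic_convolution f g) (ball 0 (s0 \<alpha>)) \<and>
         fully_convex_of_order \<alpha> (s0 \<alpha>) (harmonic_convolution f g) \<and>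
         inj_on (harmonic_convolution f g) (ball 0 (s0 0)) \<and>
         fully_convex (s0 0) (harmonic_convolution f g) \<and>
         \<bar>s0 0 - 0.0712543\<bar> \<le> 0.00000005"
  using s0_unique_root[OF assms(3,4)] convolution_fully_convex[OF assms]
    convolution_fully_convex[OF assms(1,2), of 0] s0_zero_approx by simp

end
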